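(* The integral homology $H_*(\hat F_P,\mathbb{Z})$ of $\hat F_P$ is isomorphic to the homology of the chain complex whose $p$th group, for $0\le p\le n-1$, is $\tilde H_{p-1}(|L_{[1,p]}|)$ (and $0$ for other $p$), and whose boundary homomorphism $\tilde H_{p-1}(|L_{[1,p]}|)\to\tilde H_{p-2}(|L_{[1,p-1]}|)$ is given, at the level of chains, by $$\sum_\sigma a_\sigma\,\sigma\;\longmapsto\;\sum_\sigma a_\sigma\,\Omega(\sigma).$$
   Context: Let $W$ be a finite irreducible real reflection group of rank $n$ with set of reflections $T$. For $w\in W$ let $|w|$ be the least $k$ such that $w$ is a product of $k$ elements of $T$. Partially order $W$ by $u\le w$ iff $|u|+|u^{-1}w|=|w|$, and write $u\lessdot w$ if $w$ covers $u$. Fix a Coxeter element $\gamma$ (so $|\gamma|=n$) and let $L=[e,\gamma]$ be the interval in $(W,\le)$ (the non-crossing partition lattice). For integers $i\le j$ put $L_{[i,j]}=\{w\in L: i\le|w|\le j\}$; $|L_{[i,j]}|$ is its order complex, and $L_{[1,0]}=\emptyset$. Homology is with integer coefficients; $\tilde H$ is reduced simplicial homology (computed from the augmented chain complex, with the empty chain spanning degree $-1$), so $\tilde H_{-1}(\emptyset)=\mathbb{Z}$. An initialized chain is a chain $e<w_1<\dots<w_k$ in $L$ ($k\ge0$; for $k=0$ put $w_0=e$). $\hat F_P$ is the finite $\Delta$-complex whose $k$-cells are the pairs $(m,\,e<w_1<\dots<w_k)$ with $e<w_1<\dots<w_k$ an initialized chain and $m$ an integer with $0\le m<n-|w_k|$.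 Such a $k$-cell (for $k\ge1$) has the faces $(m,\,e<w_1<\dots<\widehat{w_i}<\dots<w_k)$, $1\le i\le k$, together with the face obtained by deleting $e$, namely $(m+|w_1|,\,e<w_1^{-1}w_2<\dots<w_1^{-1}w_k)$. $C_{q}(L_{[1,p]})$ denotes the (augmented) simplicial $q$-chains of $|L_{[1,p]}|$. The top face map $\Omega\colon C_{p-1}(L_{[1,p]})\to C_{p-2}(L_{[1,p-1]})$ is the homomorphism defined by $$\Omega(w_1\lessdot w_2\lessdot\dots\lessdot w_p)=(w_1^{-1}w_2\lessdot w_1^{-1}w_3\lessdot\dots\lessdot w_1^{-1}w_p)$$ (for $p=1$ the right-hand side is the empty chain). Since $|L_{[1,p]}|$ has dimension $p-1$, elements of $\tilde H_{p-1}(|L_{[1,p]}|)$ are cycles $\sum a_\sigma\sigma$ in $C_{p-1}(L_{[1,p]})$, with $\sigma$ running over the chains $w_1\lessdot\dots\lessdot w_p$ in $L_{[1,p]}$. *)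

theory Defs
  imports "HOL-Analysis.Analysis" "HOL-Algebra.Free_Abelian_Groups"
begin

section \<open>Chain complexes of abelian groups and their homology\<close>

text \<open>Complexes are indexed by all integers; \<open>d p\<close> goes from \<open>C p\<close> to \<open>C (p - 1)\<close>.\<close>

definition chain_complex :: "(int \<Rightarrow> 'c monoid) \<Rightarrow> (int \<Rightarrow> 'c \<Rightarrow> 'c) \<Rightarrow> bool" where
  "chain_complex C d \<longleftrightarrow>
     (\<forall>p. comm_group (C p) \<and> d p \<in> hom (C p) (C (p - 1)) \<and>
          (\<forall>x \<in> carrier (C p). d (p - 1) (d p x) = \<one>\<^bsub>C (p - 2)\<^esub>))"

definition cycle_group ::
    "(int \<Rightarrow> 'c monoid) \<Rightarrow> (int \<Rightarrow> 'c \<Rightarrow> 'c) \<Rightarrow> int \<Rightarrow> 'c monoid" where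
  "cycle_group C d p = subgroup_generated (C p) (kernel (C p) (C (p - 1)) (d p))"

definition boundary_set ::
    "(int \<Rightarrow> 'c monoid) \<Rightarrow> (int \<Rightarrow> 'c \<Rightarrow> 'c) \<Rightarrow> int \<Rightarrow> 'c set" where
  "boundary_set C d p = d (p + 1) ` carrier (C (p + 1))"

definition complex_homology ::
    "(int \<Rightarrow> 'c monoid) \<Rightarrow> (int \<Rightarrow> 'c \<Rightarrow> 'c) \<Rightarrow> int \<Rightarrow> 'c set monoid" where
  "complex_homology C d p = cycle_group C d p Mod boundary_set C d p"

definition homology_class ::
    "(int \<Rightarrow> 'c monoid) \<Rightarrow> (int \<Rightarrow> 'c \<Rightarrow> 'c) \<Rightarrow> int \<Rightarrow> 'c \<Rightarrow> 'c set" where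
  "homology_class C d p z = boundary_set C d p #>\<^bsub>cycle_group C d p\<^esub> z"


section \<open>Reduced simplicial homology of order complexes\<close>

definition delete_nth :: "nat \<Rightarrow> 'w list \<Rightarrow> 'w list" where
  "delete_nth i ws = take i ws @ drop (Suc i) ws"

text \<open>
  A simplex of the order complex of \<open>P\<close> (strict order \<open>lt\<close>) is represented, with its orientation,
  by the increasing list of its vertices. The empty list is the empty chain; it spans
  degree \<open>-1\<close>, so the complex below is the augmented one.
\<close>

definition order_chain_group ::
    "('w \<Rightarrow> 'w \<Rightarrow> bool) \<Rightarrow> 'w set \<Rightarrow> int \<Rightarrow> ('w list \<Rightarrow>\<^sub>0 int) monoid" where
  "order_chain_group lt P q =
     free_Abelian_group {ws. set ws \<subseteq> P \<and> sorted_wrt lt ws \<and> int (length ws) = q + 1}"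

definition order_boundary :: "int \<Rightarrow> ('w list \<Rightarrow>\<^sub>0 int) \<Rightarrow> ('w list \<Rightarrow>\<^sub>0 int)" where
  "order_boundary q =
     frag_extend (\<lambda>ws. \<Sum>i<length ws. frag_cmul ((-1) ^ i) (frag_of (delete_nth i ws)))"

definition reduced_homology ::
    "('w \<Rightarrow> 'w \<Rightarrow> bool) \<Rightarrow> 'w set \<Rightarrow> int \<Rightarrow> ('w list \<Rightarrow>\<^sub>0 int) set monoid" where
  "reduced_homology lt P = complex_homology (order_chain_group lt P) order_boundary"


section \<open>Finite real reflection groups\<close>

definition reflection :: "'a::euclidean_space \<Rightarrow> 'a \<Rightarrow> 'a" where
  "reflection a x = x - (2 * (x \<bullet> a) / (a \<bullet> a)) *\<^sub>R a"

definition reflections :: "('a::euclidean_space \<Rightarrow> 'a) set \<Rightarrow> ('a \<Rightarrow> 'a) set" where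
  "reflections W = {t \<in> W. \<exists>a. a \<noteq> 0 \<and> t = reflection a}"

definition compose_list :: "('a \<Rightarrow> 'a) list \<Rightarrow> ('a \<Rightarrow> 'a)" where
  "compose_list ts = foldr (\<circ>) ts id"

text \<open>
  Reflections are involutions, so the products of reflections in \<open>W\<close> form the subgroup of the
  orthogonal group generated by these reflections.
\<close>

definition finite_reflection_group :: "('a::euclidean_space \<Rightarrow> 'a) set \<Rightarrow> bool" where
  "finite_reflection_group W \<longleftrightarrow>
     finite W \<and> W = {compose_list ts | ts. set ts \<subseteq> reflections W}"

definition unit_roots :: "('a::euclidean_space \<Rightarrow> 'a) set \<Rightarrow> 'a set" where
  "unit_roots W = {a. norm a = 1 \<and> reflection a \<in> W}"

text \<open>
  The action on the ambient space is not assumed to be essential: rank and irreducibility refer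
  to the span of the roots, which is the orthogonal complement of the fixed space.
\<close>

definition reflection_rank :: "('a::euclidean_space \<Rightarrow> 'a) set \<Rightarrow> nat" where
  "reflection_rank W = dim (span (unit_roots W))"

definition irreducible_reflection_group :: "('a::euclidean_space \<Rightarrow> 'a) set \<Rightarrow> bool" where
  "irreducible_reflection_group W \<longleftrightarrow>
     span (unit_roots W) \<noteq> {0} \<and>
     (\<forall>U. subspace U \<and> U \<subseteq> span (unit_roots W) \<and> (\<forall>w\<in>W. w ` U \<subseteq> U)
        \<longrightarrow> U = {0} \<or> U = span (unit_roots W))"

definition simple_system :: "('a::euclidean_space \<Rightarrow> 'a) set \<Rightarrow> 'a set \<Rightarrow> bool" where
  "simple_system W D \<longleftrightarrow>
     D \<subseteq> unit_roots W \<and> independent D \<and> span D = span (unit_roots W) \<and>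
     (\<forall>a \<in> unit_roots W. \<exists>c. a = (\<Sum>b\<in>D. c b *\<^sub>R b) \<and>
        ((\<forall>b\<in>D. 0 \<le> c b) \<or> (\<forall>b\<in>D. c b \<le> 0)))"

definition coxeter_element :: "('a::euclidean_space \<Rightarrow> 'a) set \<Rightarrow> ('a \<Rightarrow> 'a) \<Rightarrow> bool" where
  "coxeter_element W g \<longleftrightarrow>
     (\<exists>as. distinct as \<and> simple_system W (set as) \<and> g = compose_list (map reflection as))"

definition reflection_length ::
    "('a::euclidean_space \<Rightarrow> 'a) set \<Rightarrow> ('a \<Rightarrow> 'a) \<Rightarrow> nat" where
  "reflection_length W w =
     (LEAST k. \<exists>ts. length ts = k \<and> set ts \<subseteq> reflections W \<and> w = compose_list ts)"


section \<open>Non-crossing partition lattices\<close>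

text \<open>Inverses are written \<open>inv_into UNIV u\<close>, since HOL-Algebra takes over the notation
  for functional inverses.\<close>

definition absolute_le ::
    "('a::euclidean_space \<Rightarrow> 'a) set \<Rightarrow> ('a \<Rightarrow> 'a) \<Rightarrow> ('a \<Rightarrow> 'a) \<Rightarrow> bool" where
  "absolute_le W u w \<longleftrightarrow> u \<in> W \<and> w \<in> W \<and>
     reflection_length W u + reflection_length W (inv_into UNIV u \<circ> w) = reflection_length W w"

definition absolute_less ::
    "('a::euclidean_space \<Rightarrow> 'a) set \<Rightarrow> ('a \<Rightarrow> 'a) \<Rightarrow> ('a \<Rightarrow> 'a) \<Rightarrow> bool" where
  "absolute_less W u w \<longleftrightarrow> absolute_le W u w \<and> u \<noteq> w"

definition nc_lattice ::
    "('a::euclidean_space \<Rightarrow> 'a) set \<Rightarrow> ('a \<Rightarrow> 'a) \<Rightarrow> ('a \<Rightarrow> 'a) set" where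
  "nc_lattice W g = {w. absolute_le W id w \<and> absolute_le W w g}"

definition nc_ranks ::
    "('a::euclidean_space \<Rightarrow> 'a) set \<Rightarrow> ('a \<Rightarrow> 'a) \<Rightarrow> nat \<Rightarrow> nat \<Rightarrow> ('a \<Rightarrow> 'a) set" where
  "nc_ranks W g i j =
     {w \<in> nc_lattice W g. i \<le> reflection_length W w \<and> reflection_length W w \<le> j}"

text \<open>\<open>[w\<^sub>1, \<dots>, w\<^sub>k]\<close> is sent to \<open>[w\<^sub>1\<inverse> w\<^sub>2, \<dots>, w\<^sub>1\<inverse> w\<^sub>k]\<close>.\<close>

definition shift_chain :: "('a \<Rightarrow> 'a) list \<Rightarrow> ('a \<Rightarrow> 'a) list" where
  "shift_chain ws = map (\<lambda>w. inv_into UNIV (hd ws) \<circ> w) (tl ws)"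


section \<open>The Delta-complex\<close>

text \<open>The cell \<open>(m, e < w\<^sub>1 < \<dots> < w\<^sub>k)\<close> is encoded as \<open>(m, [w\<^sub>1, \<dots>, w\<^sub>k])\<close>.
  Its ordered vertices are \<open>e, w\<^sub>1, \<dots>, w\<^sub>k\<close>, so deleting \<open>e\<close> gives the face number \<open>0\<close>.\<close>

definition FP_cells ::
    "('a::euclidean_space \<Rightarrow> 'a) set \<Rightarrow> ('a \<Rightarrow> 'a) \<Rightarrow> nat \<Rightarrow> int \<Rightarrow> (nat \<times> ('a \<Rightarrow> 'a) list) set"
  where
  "FP_cells W g n k =
     {(m, ws). int (length ws) = k \<and> set ws \<subseteq> nc_lattice W g \<and>
        sorted_wrt (absolute_less W) (id # ws) \<and>
        int m < int n - int (reflection_length W (last (id # ws)))}"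

definition FP_face ::
    "('a::euclidean_space \<Rightarrow> 'a) set \<Rightarrow> nat \<Rightarrow> nat \<times> ('a \<Rightarrow> 'a) list \<Rightarrow> nat \<times> ('a \<Rightarrow> 'a) list"
  where
  "FP_face W i c = (case c of (m, ws) \<Rightarrow>
     if i = 0 then (m + reflection_length W (hd ws), shift_chain ws)
     else (m, delete_nth (i - 1) ws))"

definition FP_chain_group ::
    "('a::euclidean_space \<Rightarrow> 'a) set \<Rightarrow> ('a \<Rightarrow> 'a) \<Rightarrow> nat \<Rightarrow> int
       \<Rightarrow> (nat \<times> ('a \<Rightarrow> 'a) list \<Rightarrow>\<^sub>0 int) monoid" where
  "FP_chain_group W g n k = free_Abelian_group (FP_cells W g n k)"

definition FP_boundary ::
    "('a::euclidean_space \<Rightarrow> 'a) set \<Rightarrow> int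
       \<Rightarrow> (nat \<times> ('a \<Rightarrow> 'a) list \<Rightarrow>\<^sub>0 int) \<Rightarrow> (nat \<times> ('a \<Rightarrow> 'a) list \<Rightarrow>\<^sub>0 int)" where
  "FP_boundary W k c =
     (if k \<le> 0 then 0
      else frag_extend (\<lambda>s. \<Sum>i\<le>nat k. frag_cmul ((-1) ^ i) (frag_of (FP_face W i s))) c)"

definition FP_homology ::
    "('a::euclidean_space \<Rightarrow> 'a) set \<Rightarrow> ('a \<Rightarrow> 'a) \<Rightarrow> nat \<Rightarrow> int
       \<Rightarrow> (nat \<times> ('a \<Rightarrow> 'a) list \<Rightarrow>\<^sub>0 int) set monoid" where
  "FP_homology W g n = complex_homology (FP_chain_group W g n) (FP_boundary W)"


section \<open>The complex of top homology groups\<close>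

text \<open>A chain of \<open>p\<close> elements in ranks \<open>1, \<dots>, p\<close> has exactly one element in each rank,
  so it is automatically saturated.\<close>

definition top_face_map :: "(('a \<Rightarrow> 'a) list \<Rightarrow>\<^sub>0 int) \<Rightarrow> (('a \<Rightarrow> 'a) list \<Rightarrow>\<^sub>0 int)" where
  "top_face_map = frag_extend (\<lambda>ws. frag_of (shift_chain ws))"

definition top_group ::
    "('a::euclidean_space \<Rightarrow> 'a) set \<Rightarrow> ('a \<Rightarrow> 'a) \<Rightarrow> nat \<Rightarrow> int
       \<Rightarrow> (('a \<Rightarrow> 'a) list \<Rightarrow>\<^sub>0 int) set monoid" where
  "top_group W g n p =
     (if 0 \<le> p \<and> p \<le> int n - 1
      then reduced_homology (absolute_less W) (nc_ranks W g 1 (nat p)) (p - 1)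
      else singleton_group {0})"

text \<open>The map induced by \<open>top_face_map\<close>: the class \<open>X\<close> of a cycle \<open>z\<close> goes to the class of the
  image of \<open>z\<close>. (There are no nonzero boundaries in these degrees, so \<open>X = {z}\<close>.)\<close>

definition top_boundary ::
    "('a::euclidean_space \<Rightarrow> 'a) set \<Rightarrow> ('a \<Rightarrow> 'a) \<Rightarrow> nat \<Rightarrow> int
       \<Rightarrow> (('a \<Rightarrow> 'a) list \<Rightarrow>\<^sub>0 int) set \<Rightarrow> (('a \<Rightarrow> 'a) list \<Rightarrow>\<^sub>0 int) set" where
  "top_boundary W g n p X =
     (if 1 \<le> p \<and> p \<le> int n - 1
      then \<Union>z\<in>X. homology_class
             (order_chain_group (absolute_less W) (nc_ranks W g 1 (nat (p - 1))))
             order_boundary (p - 2) (top_face_map z)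
      else \<one>\<^bsub>top_group W g n (p - 1)\<^esub>)"

end

(*
  Filter the cells (m, e < w_1 < ... < w_k) by m. On the graded pieces the faces deleting some w_i
  form the augmented chain complex of L_[1,n-1-m], while the face deleting e raises m. If the
  reduced homology of every L_[1,p] is concentrated in degree p - 1, then each cycle of the total
  complex can be pushed, one level at a time, into the subcomplex of the top cycles of the L_[1,p],
  where only the face deleting e survives; it raises m by exactly 1.

  The concentration is obtained from a recursive atom ordering of the intervals of L. Let
  E(b, v) = 2 (1 - \<gamma>)^(-1) b . v. For a reduced factorization of \<gamma> with roots b_1, ..., b_n one has
  E(b_i, b_j) = 0 for i < j and E(b_i, b_i) = 1. Order the positive roots by the first time at which
  the successive letters of the infinite word s_1 ... s_n s_1 ... s_n ... make them negative; then
  E(b, a) <= 0 whenever a comes before b. If the first letter b_1 of an increasing word of w in L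
  were not the first reflection below w, then the root d of an earlier reflection would be a
  combination of the b_i with nonpositive coefficients, contradicting positivity.
*)

theory Submission
  imports Defs
begin

section \<open>Cone formulas for the simplicial boundary\<close>

section \<open>The boundary of chains of lists\<close>

text \<open>Why the form has its sign: let s be the letter that makes a negative. The letters before
  s carry a to s itself; applying s as well conjugates \<gamma> to the product \<gamma>' of a
  rotated Coxeter word that ends in s. The other letters move vectors only within the span of the
  other simple roots, so the s-coefficient of (1 - \<gamma>') y is 2 y . s. If (1 - \<gamma>') y is
  a positive root, then y . s is nonnegative; the inequality reverses for a, which has been sent to
  -s.

  Concentration is proved by gluing, not by a shelling: the principal filters of the atoms are added
  one at a time with a Mayer-Vietoris argument. All edges share one label scale, so the overlap of a
  new filter with the earlier ones is again a union of filters one rank higher, with the same label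
  threshold.

  The pushing step is stated for chains whose boundary lies in the embedded top complex, not just
  for cycles. Boundary zero then gives surjectivity on homology, and a general boundary gives
  injectivity.\<close>

abbreviation chain_boundary :: "('w list \<Rightarrow>\<^sub>0 int) \<Rightarrow> ('w list \<Rightarrow>\<^sub>0 int)" where
  "chain_boundary \<equiv> order_boundary 0"

abbreviation supp :: "('b \<Rightarrow>\<^sub>0 int) \<Rightarrow> 'b set" where
  "supp \<equiv> Poly_Mapping.keys"

text \<open>Cone operators with a fixed first or last vertex. They impose no order condition on that
  vertex, so supports are checked separately.\<close>

definition cons_chain :: "'w \<Rightarrow> ('w list \<Rightarrow>\<^sub>0 int) \<Rightarrow> ('w list \<Rightarrow>\<^sub>0 int)" where
  "cons_chain x = frag_extend (\<lambda>ws. frag_of (x # ws))"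

definition snoc_chain :: "'w \<Rightarrow> ('w list \<Rightarrow>\<^sub>0 int) \<Rightarrow> ('w list \<Rightarrow>\<^sub>0 int)" where
  "snoc_chain x = frag_extend (\<lambda>ws. frag_of (ws @ [x]))"

lemma supp_add_subset: "supp a \<subseteq> S \<Longrightarrow> supp b \<subseteq> S \<Longrightarrow> supp (a + b) \<subseteq> S"
  using Poly_Mapping.keys_add [of a b] by blast

lemma supp_diff_subset: "supp a \<subseteq> S \<Longrightarrow> supp b \<subseteq> S \<Longrightarrow> supp (a - b) \<subseteq> S"
  using keys_diff [of a b] by blast

text \<open>Fixing the dummy degree at 0 lets the chain-level lemmas be stated once for all
  degrees.\<close>

lemma order_boundary_eq: "order_boundary q = chain_boundary"
  by (simp add: order_boundary_def)

lemma chain_boundary_diff: "chain_boundary (a - b) = chain_boundary a - chain_boundary b"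
  by (simp add: order_boundary_def frag_extend_diff)

lemma chain_boundary_add: "chain_boundary (a + b) = chain_boundary a + chain_boundary b"
  by (simp add: order_boundary_def frag_extend_add)

lemma chain_boundary_0 [simp]: "chain_boundary 0 = 0"
  by (simp add: order_boundary_def)

lemma chain_boundary_Nil [simp]: "chain_boundary (frag_of []) = 0"
  by (simp add: order_boundary_def)

lemma cons_chain_of [simp]: "cons_chain x (frag_of ws) = frag_of (x # ws)"
  by (simp add: cons_chain_def)

lemma snoc_chain_of [simp]: "snoc_chain x (frag_of ws) = frag_of (ws @ [x])"
  by (simp add: snoc_chain_def)

lemma cons_chain_0 [simp]: "cons_chain x 0 = 0"
  by (simp add: cons_chain_def)

lemma snoc_chain_0 [simp]: "snoc_chain x 0 = 0"
  by (simp add: snoc_chain_def)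

lemma cons_chain_diff: "cons_chain x (a - b) = cons_chain x a - cons_chain x b"
  by (simp add: cons_chain_def frag_extend_diff)

lemma cons_chain_minus: "cons_chain x (- a) = - cons_chain x a"
  by (simp add: cons_chain_def frag_extend_minus)

lemma snoc_chain_diff: "snoc_chain x (a - b) = snoc_chain x a - snoc_chain x b"
  by (simp add: snoc_chain_def frag_extend_diff)

lemma supp_cons_chain: "supp (cons_chain x c) \<subseteq> (#) x ` supp c"
  unfolding cons_chain_def by (rule order_trans [OF keys_frag_extend]) auto

text \<open>Deleting the head leaves \<open>ws\<close>; every other face keeps the head and has its
  index raised by one, which flips its sign. Induction on lists through this formula avoids double
  sums.\<close>

lemma chain_boundary_Cons:
  "chain_boundary (frag_of (x # ws)) = frag_of ws - cons_chain x (chain_boundary (frag_of ws))"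
proof -
  have "chain_boundary (frag_of (x # ws))
      = (\<Sum>i<Suc (length ws). frag_cmul ((-1) ^ i) (frag_of (delete_nth i (x # ws))))"
    by (simp add: order_boundary_def)
  also have "\<dots> = frag_of ws
      + (\<Sum>i<length ws. frag_cmul ((-1) ^ Suc i) (frag_of (x # delete_nth i ws)))"
    by (subst sum.lessThan_Suc_shift) (simp add: delete_nth_def)
  also have "(\<Sum>i<length ws. frag_cmul ((-1) ^ Suc i) (frag_of (x # delete_nth i ws)))
      = - cons_chain x (chain_boundary (frag_of ws))"
    by (simp add: order_boundary_def cons_chain_def frag_extend_sum o_def frag_extend_cmul
        flip: sum_negf)
  finally show ?thesis by simp
qed

lemma chain_boundary_cons_chain:
  "chain_boundary (cons_chain x c) = c - cons_chain x (chain_boundary c)"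
  using subset_UNIV
proof (induction c rule: frag_induction)
  case (one ws)
  then show ?case by (simp add: chain_boundary_Cons)
next
  case (diff a b)
  then show ?case by (simp add: cons_chain_diff chain_boundary_diff)
qed simp

lemma chain_boundary_boundary [simp]: "chain_boundary (chain_boundary c) = 0"
  using subset_UNIV
proof (induction c rule: frag_induction)
  case (one ws)
  show ?case
    by (induction ws rule: list.induct) (simp_all add: chain_boundary_Cons chain_boundary_diff chain_boundary_cons_chain)
next
  case (diff a b)
  then show ?case by (simp add: chain_boundary_diff)
qed simp

lemma chain_boundary_snoc:
  "chain_boundary (frag_of (ws @ [x]))
     = snoc_chain x (chain_boundary (frag_of ws)) + frag_cmul ((-1) ^ length ws) (frag_of ws)"
proof (induction ws)
  case Nil
  then show ?case by (simp add: chain_boundary_Cons)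
next
  case (Cons a ws)
  have comm: "cons_chain a (snoc_chain x c) = snoc_chain x (cons_chain a c)" for c
    using frag_extend_compose [of "\<lambda>ws. frag_of (a # ws)" "\<lambda>ws. ws @ [x]" c]
      frag_extend_compose [of "\<lambda>ws. frag_of (ws @ [x])" "(#) a" c]
    by (simp add: cons_chain_def snoc_chain_def o_def)
  have neg: "frag_cmul (- k) u = - frag_cmul k u" for k and u :: "'a list \<Rightarrow>\<^sub>0 int"
    by simp
  have "chain_boundary (frag_of ((a # ws) @ [x])) = frag_of (ws @ [x])
      - (snoc_chain x (cons_chain a (chain_boundary (frag_of ws)))
         + frag_cmul ((-1) ^ length ws) (frag_of (a # ws)))"
    using comm by (simp add: chain_boundary_Cons Cons.IH) (simp add: cons_chain_def frag_extend_add frag_extend_cmul)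
  also have "\<dots> = snoc_chain x (chain_boundary (frag_of (a # ws)))
      + frag_cmul (- ((-1) ^ length ws)) (frag_of (a # ws))"
    by (simp add: chain_boundary_Cons snoc_chain_diff neg del: minus_frag_cmul)
  finally show ?case by simp
qed

lemma supp_chain_boundary:
  assumes "ws \<in> supp (chain_boundary c)"
  obtains i vs where "vs \<in> supp c" "i < length vs" "ws = delete_nth i vs"
proof -
  define b where "b = (\<lambda>vs :: 'a list. \<Sum>i<length vs. frag_cmul ((-1) ^ i) (frag_of (delete_nth i vs)))"
  have "ws \<in> supp (frag_extend b c)"
    using assms by (simp add: order_boundary_def b_def)
  from subsetD [OF keys_frag_extend this]
  obtain vs where vs: "vs \<in> supp c" "ws \<in> supp (b vs)" by blast
  from subsetD [OF keys_sum vs(2) [unfolded b_def]]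
  obtain i where "i < length vs" "ws = delete_nth i vs" by auto
  with vs(1) show ?thesis by (rule that)
qed

text \<open>Counting vertices instead of dimension keeps the index a natural number: the
  augmentation spanned by the empty chain sits at 0.\<close>

definition order_chains :: "('w \<Rightarrow> 'w \<Rightarrow> bool) \<Rightarrow> 'w set \<Rightarrow> nat \<Rightarrow> 'w list set" where
  "order_chains lt P l = {ws. set ws \<subseteq> P \<and> sorted_wrt lt ws \<and> length ws = l}"

lemma length_delete_nth: "i < length ws \<Longrightarrow> length (delete_nth i ws) = length ws - 1"
  by (simp add: delete_nth_def)

lemma set_delete_nth: "set (delete_nth i ws) \<subseteq> set ws"
  by (auto simp: delete_nth_def dest: in_set_takeD in_set_dropD)

lemma sorted_wrt_delete_nth:
  assumes "sorted_wrt R ws"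
  shows "sorted_wrt R (delete_nth i ws)"
proof -
  have "sorted_wrt R (take i ws @ drop i ws)"
    using assms by simp
  then have "sorted_wrt R (take i ws)" "sorted_wrt R (drop i ws)"
    "\<forall>x\<in>set (take i ws). \<forall>y\<in>set (drop i ws). R x y"
    unfolding sorted_wrt_append by blast+
  moreover have "set (drop (Suc i) ws) \<subseteq> set (drop i ws)"
    by (simp add: set_drop_subset_set_drop)
  ultimately show ?thesis
    unfolding delete_nth_def sorted_wrt_append
    by (metis assms sorted_wrt_drop subsetD)
qed

lemma order_chains_delete_nth:
  "ws \<in> order_chains lt P (Suc l) \<Longrightarrow> i < Suc l \<Longrightarrow> delete_nth i ws \<in> order_chains lt P l"
  using set_delete_nth [of i ws] 
  by (auto simp: order_chains_def length_delete_nth sorted_wrt_delete_nth)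

text \<open>At \<open>l = 0\<close> the truncated \<open>l - 1\<close> is harmless, since the empty
  list has no faces.\<close>

lemma supp_chain_boundary_subset:
  assumes "supp c \<subseteq> order_chains lt P l"
  shows "supp (chain_boundary c) \<subseteq> order_chains lt P (l - 1)"
proof
  fix ws assume "ws \<in> supp (chain_boundary c)"
  then obtain i vs where "vs \<in> supp c" "i < length vs" "ws = delete_nth i vs"
    by (rule supp_chain_boundary)
  moreover from this have "vs \<in> order_chains lt P l" "length vs = l"
    using assms by (auto simp: order_chains_def)
  ultimately show "ws \<in> order_chains lt P (l - 1)"
    by (cases l) (auto intro: order_chains_delete_nth)
qed

lemma order_chains_mono: "P \<subseteq> Q \<Longrightarrow> order_chains lt P l \<subseteq> order_chains lt Q l"
  by (auto simp: order_chains_def)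

lemma order_chains_0: "order_chains lt P 0 = {[]}"
  by (auto simp: order_chains_def)

section \<open>Cones, Mayer-Vietoris gluing and deletion of maximal elements\<close>

section \<open>Posets with vanishing low-dimensional homology\<close>

text \<open>Lists of length \<open>l\<close> span degree \<open>l - 1\<close>, so this says that the reduced homology
  vanishes in all degrees below \<open>r - 1\<close>.\<close>

definition acyclic_below :: "('w \<Rightarrow> 'w \<Rightarrow> bool) \<Rightarrow> 'w set \<Rightarrow> nat \<Rightarrow> bool" where
  "acyclic_below lt P r \<longleftrightarrow> (\<forall>l<r. \<forall>z. supp z \<subseteq> order_chains lt P l \<longrightarrow> chain_boundary z = 0 \<longrightarrow>
     (\<exists>y. supp y \<subseteq> order_chains lt P (Suc l) \<and> chain_boundary y = z))"

lemma acyclic_belowD: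
  assumes "acyclic_below lt P r" "l < r" "supp z \<subseteq> order_chains lt P l" "chain_boundary z = 0"
  obtains y where "supp y \<subseteq> order_chains lt P (Suc l)" "chain_boundary y = z"
  using assms unfolding acyclic_below_def by blast

lemma acyclic_below_mono: "acyclic_below lt P r \<Longrightarrow> s \<le> r \<Longrightarrow> acyclic_below lt P s"
  unfolding acyclic_below_def by (meson less_le_trans)

text \<open>Split a cycle as \<open>cons_chain a p' + q\<close> with \<open>a\<close> absent from
  \<open>q\<close>. The part of its boundary that avoids \<open>a\<close> gives
  \<open>chain_boundary q = - p'\<close>, and then \<open>cons_chain a q\<close> fills the cycle, in
  every degree.\<close>

lemma acyclic_below_cone:
  assumes "a \<in> P" and min: "\<And>x. x \<in> P \<Longrightarrow> x \<noteq> a \<Longrightarrow> lt a x" and irr: "\<And>x. x \<in> P \<Longrightarrow> \<not> lt x a"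
  shows "acyclic_below lt P r"
  unfolding acyclic_below_def
proof (intro allI impI)
  fix l z
  assume z: "supp z \<subseteq> order_chains lt P l" and bz: "chain_boundary z = 0"
  define A where "A = {ws \<in> order_chains lt P l. ws \<noteq> [] \<and> hd ws = a}"
  define B where "B = {ws \<in> order_chains lt P l. a \<notin> set ws}"
  have "order_chains lt P l \<subseteq> A \<union> B"
  proof
    fix ws assume ws: "ws \<in> order_chains lt P l"
    show "ws \<in> A \<union> B"
    proof (cases ws)
      case Nil then show ?thesis using ws by (auto simp: B_def)
    next
      case (Cons v vs)
      then have "a \<notin> set vs" using ws irr by (auto simp: order_chains_def)
      then show ?thesis using ws Cons by (auto simp: A_def B_def)
    qed
  qed
  with z obtain p q where pq: "supp p \<subseteq> A" "supp q \<subseteq> B" "p + q = z"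
    by (meson frag_split order_trans)
  define p' where "p' = frag_extend (\<lambda>ws. frag_of (tl ws)) p"
  have p: "p = cons_chain a p'"
    using pq(1) unfolding p'_def cons_chain_def
  proof (induction p rule: frag_induction)
    case (one x)
    then show ?case by (cases x) (auto simp: A_def)
  qed (auto simp: frag_extend_diff)
  \<comment> \<open>Projection onto the lists that avoid \<open>a\<close>; it isolates the equation
    for \<open>p'\<close>.\<close>
  define f where "f = frag_extend (\<lambda>ws. if a \<in> set ws then 0 else frag_of ws)"
  have f_id: "f c = c" if "\<And>ws. ws \<in> supp c \<Longrightarrow> a \<notin> set ws" for c
  proof -
    have "supp c \<subseteq> {ws. a \<notin> set ws}" using that by blast
    then show ?thesis by (induction c rule: frag_induction) (auto simp: f_def frag_extend_diff)
  qed
  have f_cons: "f (cons_chain a c) = 0" for c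
    unfolding f_def using supp_cons_chain by (intro frag_extend_eq_0) fastforce
  have p'a: "a \<notin> set ws" if ws: "ws \<in> supp p'" for ws
  proof -
    have "ws \<in> (\<Union>vs\<in>supp p. supp (frag_of (tl vs)))"
      using ws unfolding p'_def by (rule subsetD [OF keys_frag_extend])
    then obtain vs where "vs \<in> supp p" "ws = tl vs" by auto
    moreover from this have "vs \<in> order_chains lt P l" "vs \<noteq> []" "hd vs = a" using pq(1) by (auto simp: A_def)
    ultimately show ?thesis using irr by (cases vs) (auto simp: order_chains_def)
  qed
  have qa: "a \<notin> set ws" if "ws \<in> supp q" for ws
    using that pq(2) by (auto simp: B_def)
  have bqa: "a \<notin> set ws" if "ws \<in> supp (chain_boundary q)" for ws
    using that by (rule supp_chain_boundary) (use qa set_delete_nth in fastforce)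
  have "f (chain_boundary z) = 0" using bz by (simp add: f_def)
  then have "p' + chain_boundary q = 0"
    using f_id [OF p'a] f_id [OF bqa] f_cons
    by (simp add: p pq(3) [symmetric] chain_boundary_add chain_boundary_cons_chain)
      (simp add: f_def frag_extend_add frag_extend_diff)
  then have "chain_boundary q = - p'" by (simp add: add_eq_0_iff)
  then have "chain_boundary (cons_chain a q) = z"
    using pq(3) p by (simp add: chain_boundary_cons_chain cons_chain_minus add.commute)
  moreover have "supp (cons_chain a q) \<subseteq> order_chains lt P (Suc l)"
    using supp_cons_chain [of a q] pq(2) min \<open>a \<in> P\<close>
    by (fastforce simp: B_def order_chains_def)
  ultimately show "\<exists>y. supp y \<subseteq> order_chains lt P (Suc l) \<and> chain_boundary y = z" by blast
qed

text \<open>Mayer-Vietoris made explicit. The two halves of a cycle have, up to sign, a common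
  boundary in the intersection, one degree lower, hence the bound \<open>r - 1\<close> there.
  Filling it closes each half, which is then filled on its own side.\<close>

lemma acyclic_below_union:
  assumes P: "acyclic_below lt P r" and Q: "acyclic_below lt Q r"
    and I: "acyclic_below lt (P \<inter> Q) (r - 1)"
    and cover: "\<And>l. order_chains lt (P \<union> Q) l \<subseteq> order_chains lt P l \<union> order_chains lt Q l"
  shows "acyclic_below lt (P \<union> Q) r"
  unfolding acyclic_below_def
proof (intro allI impI)
  fix l z
  assume "l < r" and z: "supp z \<subseteq> order_chains lt (P \<union> Q) l" and bz: "chain_boundary z = 0"
  obtain p q where pq: "supp p \<subseteq> order_chains lt P l" "supp q \<subseteq> order_chains lt Q l" "p + q = z"
    using z cover by (meson frag_split order_trans)
  have bpq: "chain_boundary p = - chain_boundary q"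
    using bz unfolding pq(3) [symmetric] chain_boundary_add by (rule eq_neg_iff_add_eq_0 [THEN iffD2])
  have "\<exists>y. supp y \<subseteq> order_chains lt (P \<inter> Q) l \<and> chain_boundary y = chain_boundary p"
  proof (cases l)
    case 0
    \<comment> \<open>A multiple of the empty chain has no boundary, so 0 is a filling.\<close>
    have "chain_boundary p = 0"
      using pq(1) unfolding order_boundary_def 0 order_chains_0 by (intro frag_extend_eq_0) auto
    then show ?thesis by (intro exI [of _ 0]) auto
  next
    case (Suc k)
    have "supp (chain_boundary p) \<subseteq> order_chains lt P k \<inter> order_chains lt Q k"
      using supp_chain_boundary_subset [OF pq(1)] supp_chain_boundary_subset [OF pq(2)]
      by (auto simp: bpq Suc)
    then have "supp (chain_boundary p) \<subseteq> order_chains lt (P \<inter> Q) k"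
      by (auto simp: order_chains_def)
    then show ?thesis
      using acyclic_belowD [OF I, of k "chain_boundary p"] \<open>l < r\<close> Suc by fastforce
  qed
  then obtain y where y: "supp y \<subseteq> order_chains lt (P \<inter> Q) l" "chain_boundary y = chain_boundary p" by blast
  have y': "supp y \<subseteq> order_chains lt P l" "supp y \<subseteq> order_chains lt Q l"
    using y(1) order_chains_mono [of "P \<inter> Q" P lt l] order_chains_mono [of "P \<inter> Q" Q lt l] by auto
  have "supp (p - y) \<subseteq> order_chains lt P l" "chain_boundary (p - y) = 0"
    using y'(1) pq(1) y(2) by (simp_all add: supp_diff_subset chain_boundary_diff)
  then obtain u where u: "supp u \<subseteq> order_chains lt P (Suc l)" "chain_boundary u = p - y"
    by (rule acyclic_belowD [OF P \<open>l < r\<close>])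
  have "supp (q + y) \<subseteq> order_chains lt Q l" "chain_boundary (q + y) = 0"
    using y'(2) pq(2) y(2) bpq by (simp_all add: supp_add_subset chain_boundary_add)
  then obtain v where v: "supp v \<subseteq> order_chains lt Q (Suc l)" "chain_boundary v = q + y"
    by (rule acyclic_belowD [OF Q \<open>l < r\<close>])
  have "supp (u + v) \<subseteq> order_chains lt (P \<union> Q) (Suc l)"
    using u(1) v(1) order_chains_mono [of P "P \<union> Q" lt "Suc l"] order_chains_mono [of Q "P \<union> Q" lt "Suc l"]
    by (intro supp_add_subset) auto
  then show "\<exists>y. supp y \<subseteq> order_chains lt (P \<union> Q) (Suc l) \<and> chain_boundary y = z"
    using pq(3) u(2) v(2) by (intro exI [of _ "u + v"]) (simp add: chain_boundary_add)
qed

text \<open>\<open>P\<close> arises from \<open>P - {w}\<close> by attaching a cone over the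
  elements below \<open>w\<close>. A filling in \<open>P\<close> is pushed off \<open>w\<close>: its
  part through \<open>w\<close> gives a cycle below \<open>w\<close>, and subtracting the boundary
  of the cone over a filling of that cycle removes every occurrence of \<open>w\<close>.\<close>

lemma acyclic_below_remove_maximal:
  assumes P: "acyclic_below lt P r" and link: "acyclic_below lt {x \<in> P. lt x w} r"
    and "w \<in> P" and max: "\<And>x. x \<in> P \<Longrightarrow> \<not> lt w x"
  shows "acyclic_below lt (P - {w}) r"
  unfolding acyclic_below_def
proof (intro allI impI)
  fix l z
  assume "l < r" and z: "supp z \<subseteq> order_chains lt (P - {w}) l" and bz: "chain_boundary z = 0"
  obtain y where y: "supp y \<subseteq> order_chains lt P (Suc l)" "chain_boundary y = z"
  proof (rule acyclic_belowD [OF P \<open>l < r\<close>])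
    show "supp z \<subseteq> order_chains lt P l" using z order_chains_mono [of "P - {w}" P lt l] by auto
  qed (use bz in auto)
  \<comment> \<open>\<open>f\<close> extracts the coefficient of \<open>w\<close>, which can only be
    a last vertex because it is maximal.\<close>
  define f where "f = frag_extend (\<lambda>ws. if ws \<noteq> [] \<and> last ws = w then frag_of (butlast ws) else 0)"
  have w_last: "ws = butlast ws @ [w] \<and> w \<notin> set (butlast ws)"
    if ws: "ws \<in> order_chains lt P k" and w: "w \<in> set ws" for ws k
  proof -
    obtain us vs where "ws = us @ w # vs" using split_list [OF w] by blast
    moreover from this have "vs = []"
      using ws max by (cases vs) (auto simp: order_chains_def sorted_wrt_append)
    moreover have "w \<notin> set us"
      using ws max \<open>w \<in> P\<close> calculation by (auto simp: order_chains_def sorted_wrt_append)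
    ultimately show ?thesis by simp
  qed
  have f_free: "f c = 0" if "\<And>ws. ws \<in> supp c \<Longrightarrow> w \<notin> set ws" for c
    unfolding f_def
  proof (rule frag_extend_eq_0)
    fix ws assume "ws \<in> supp c"
    then show "(if ws \<noteq> [] \<and> last ws = w then frag_of (butlast ws) else 0) = 0"
      using that [of ws] last_in_set [of ws] by auto
  qed
  have f_snoc: "f (snoc_chain w c) = c" for c
    unfolding f_def snoc_chain_def
    using frag_extend_compose [of "\<lambda>ws. if ws \<noteq> [] \<and> last ws = w then frag_of (butlast ws) else 0"
        "\<lambda>ws. ws @ [w]" c] frag_expansion [of c]
    by (simp add: o_def)
  have bd_free: "w \<notin> set ws" if "ws \<in> supp (chain_boundary (frag_of us))" "w \<notin> set us" for us ws
    using that(1) by (rule supp_chain_boundary) (use that(2) set_delete_nth in fastforce)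
  have f_bd: "f (chain_boundary c) = chain_boundary (f c)" if "supp c \<subseteq> order_chains lt P (Suc l)" for c
    using that
  proof (induction c rule: frag_induction)
    case (one ws)
    show ?case
    proof (cases "w \<in> set ws")
      case True
      define us where "us = butlast ws"
      have ws: "ws = us @ [w]" and us: "w \<notin> set us"
        using w_last [OF one True] by (auto simp: us_def)
      have "f (frag_cmul k (frag_of us)) = 0" for k
        using us by (intro f_free) auto
      then have "f (chain_boundary (frag_of ws)) = f (snoc_chain w (chain_boundary (frag_of us)))"
        by (simp add: ws chain_boundary_snoc f_def frag_extend_add)
      then show ?thesis by (simp add: f_snoc) (simp add: f_def ws)
    next
      case False
      then have "f (chain_boundary (frag_of ws)) = 0" by (intro f_free) (rule bd_free)
      then show ?thesis using False f_free [of "frag_of ws"] by simp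
    qed
  qed (simp_all add: f_def frag_extend_diff chain_boundary_diff)
  have "f z = 0" using z by (intro f_free) (auto simp: order_chains_def)
  then have "chain_boundary (f y) = 0" using f_bd [OF y(1)] y(2) by simp
  moreover have fy: "supp (f y) \<subseteq> order_chains lt {x \<in> P. lt x w} l"
  proof
    fix ws assume "ws \<in> supp (f y)"
    then obtain vs where vs: "vs \<in> supp y" "vs \<noteq> []" "last vs = w" "ws = butlast vs"
      using keys_frag_extend [of "\<lambda>ws. if ws \<noteq> [] \<and> last ws = w then frag_of (butlast ws) else 0" y]
      unfolding f_def by (auto split: if_split_asm)
    then have "vs = ws @ [w]" by (metis append_butlast_last_id)
    then have "ws @ [w] \<in> order_chains lt P (Suc l)"
      using vs(1) y(1) by auto
    then show "ws \<in> order_chains lt {x \<in> P. lt x w} l"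
      by (auto simp: order_chains_def sorted_wrt_append)
  qed
  ultimately obtain x where x: "supp x \<subseteq> order_chains lt {x \<in> P. lt x w} (Suc l)" "chain_boundary x = f y"
    using acyclic_belowD [OF link \<open>l < r\<close> fy] by metis
  have bsx: "chain_boundary (snoc_chain w x) = snoc_chain w (f y) + frag_cmul ((-1) ^ Suc l) x"
    unfolding x(2) [symmetric] using x(1)
  proof (induction x rule: frag_induction)
    case (one x)
    then show ?case by (simp add: chain_boundary_snoc order_chains_def)
  next
    case (diff a b)
    have "frag_cmul k (a - b) = frag_cmul k a - frag_cmul k b" for k
      by (simp add: poly_mapping_eqI lookup_minus right_diff_distrib)
    then show ?case using diff by (simp add: snoc_chain_diff chain_boundary_diff)
  qed simp
  define v where "v = y - snoc_chain w (f y)"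
  have yv: "supp v \<subseteq> order_chains lt (P - {w}) (Suc l)"
    unfolding v_def using y(1)
  proof (induction y rule: frag_induction)
    case (one ws)
    show ?case
    proof (cases "w \<in> set ws")
      case True
      then have "snoc_chain w (f (frag_of ws)) = frag_of ws"
        using w_last [OF one True] by (metis f_snoc snoc_chain_of)
      then show ?thesis by simp
    next
      case False
      then show ?thesis using one f_free [of "frag_of ws"] by (auto simp: order_chains_def)
    qed
  next
    case (diff a b)
    have "a - b - snoc_chain w (f (a - b)) = (a - snoc_chain w (f a)) - (b - snoc_chain w (f b))"
      by (simp add: f_def frag_extend_diff snoc_chain_diff)
    then show ?case using diff by (metis supp_diff_subset)
  qed (simp add: f_def)
  have "supp (frag_cmul ((-1) ^ Suc l) x) \<subseteq> supp x" by (rule keys_cmul)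
  also have "\<dots> \<subseteq> order_chains lt (P - {w}) (Suc l)"
    using x(1) max \<open>w \<in> P\<close> by (auto simp: order_chains_def)
  finally have "supp (v - frag_cmul ((-1) ^ Suc l) x) \<subseteq> order_chains lt (P - {w}) (Suc l)"
    using yv by (intro supp_diff_subset)
  \<comment> \<open>One chain in two forms: the left one visibly avoids \<open>w\<close>, the right
    one differs from \<open>y\<close> by a boundary.\<close>
  moreover have "v - frag_cmul ((-1) ^ Suc l) x = y - chain_boundary (snoc_chain w x)"
    by (simp add: v_def bsx)
  then have "chain_boundary (v - frag_cmul ((-1) ^ Suc l) x) = z"
    by (simp add: chain_boundary_diff y(2))
  ultimately show "\<exists>y. supp y \<subseteq> order_chains lt (P - {w}) (Suc l) \<and> chain_boundary y = z" by blast
qed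

text \<open>The members of \<open>M\<close> are maximal, so deleting some of them does not alter the
  sets below the others.\<close>

lemma acyclic_below_remove_antichain:
  assumes "finite M" "M \<subseteq> P" and P: "acyclic_below lt P r"
    and link: "\<And>w. w \<in> M \<Longrightarrow> acyclic_below lt {x \<in> P. lt x w} r"
    and max: "\<And>x w. w \<in> M \<Longrightarrow> x \<in> P \<Longrightarrow> \<not> lt w x"
  shows "acyclic_below lt (P - M) r"
  using assms(1,2) link max
proof (induction M rule: finite_induct)
  case empty
  then show ?case using P by simp
next
  case (insert w M)
  have "{x \<in> P - M. lt x w} = {x \<in> P. lt x w}" using insert.prems by auto
  then have link_w: "acyclic_below lt {x \<in> P - M. lt x w} r"
    using insert.prems(2) [of w] by simp
  have PM: "acyclic_below lt (P - M) r"
  proof (rule insert.IH)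
    show "M \<subseteq> P" using insert.prems(1) by blast
    show "acyclic_below lt {x \<in> P. lt x v} r" if "v \<in> M" for v
      using that by (intro insert.prems(2)) blast
    show "\<not> lt v x" if "v \<in> M" "x \<in> P" for x v
      using that by (intro insert.prems(3)) blast+
  qed
  have "acyclic_below lt (P - M - {w}) r"
    using PM link_w
  proof (rule acyclic_below_remove_maximal)
    show "w \<in> P - M" using insert.prems(1) insert.hyps(2) by blast
    show "\<not> lt w x" if "x \<in> P - M" for x
      using that by (intro insert.prems(3)) blast+
  qed
  then show ?case by (metis Diff_insert)
qed

text \<open>The smallest vertex of a chain lies in one of two upward closed pieces and draws the
  rest of the chain into it.\<close>

lemma order_chains_union_upward:
  assumes "\<And>x y. x \<in> A \<Longrightarrow> y \<in> A \<union> B \<Longrightarrow> lt x y \<Longrightarrow> y \<in> A"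
    and "\<And>x y. x \<in> B \<Longrightarrow> y \<in> A \<union> B \<Longrightarrow> lt x y \<Longrightarrow> y \<in> B"
  shows "order_chains lt (A \<union> B) l \<subseteq> order_chains lt A l \<union> order_chains lt B l"
proof
  fix ws assume ws: "ws \<in> order_chains lt (A \<union> B) l"
  show "ws \<in> order_chains lt A l \<union> order_chains lt B l"
  proof (cases ws)
    case Nil
    then show ?thesis using ws by (auto simp: order_chains_def)
  next
    case (Cons v vs)
    have "set vs \<subseteq> A" if "v \<in> A"
      using ws that assms(1) [OF that] unfolding Cons order_chains_def by auto
    moreover have "set vs \<subseteq> B" if "v \<in> B"
      using ws that assms(2) [OF that] unfolding Cons order_chains_def by auto
    moreover have "v \<in> A \<or> v \<in> B" using ws by (auto simp: Cons order_chains_def)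
    ultimately show ?thesis using ws by (auto simp: Cons order_chains_def)
  qed
qed

section \<open>Gluing principal filters in the order of the atoms\<close>

section \<open>Recursive atom orderings\<close>

text \<open>A recursive atom ordering expressed by edge labels. The last two conditions identify the
  elements above both \<open>a\<close> and an earlier atom of \<open>u\<close> with the elements
  above a cover of \<open>a\<close> whose label is less than \<open>lab u a\<close>; consecutive
  edges are compared on one scale.\<close>

locale atom_ordered_poset =
  fixes L :: "'w set" and lt :: "'w \<Rightarrow> 'w \<Rightarrow> bool" and rk :: "'w \<Rightarrow> nat" and lab :: "'w \<Rightarrow> 'w \<Rightarrow> nat"
  assumes lt_trans: "\<lbrakk>x \<in> L; y \<in> L; z \<in> L; lt x y; lt y z\<rbrakk> \<Longrightarrow> lt x z"
    and lt_rank: "\<lbrakk>x \<in> L; y \<in> L; lt x y\<rbrakk> \<Longrightarrow> rk x < rk y"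
    and lab_inj: "\<lbrakk>u \<in> L; a \<in> L; b \<in> L; lt u a; rk a = Suc (rk u); lt u b; rk b = Suc (rk u);
        lab u a = lab u b\<rbrakk> \<Longrightarrow> a = b"
    and descent_below: "\<lbrakk>u \<in> L; a \<in> L; x \<in> L; lt u a; rk a = Suc (rk u); lt a x; rk x = Suc (rk a);
        lab a x < lab u a\<rbrakk> \<Longrightarrow> \<exists>b\<in>L. lt u b \<and> rk b = Suc (rk u) \<and> lt b x \<and> lab u b < lab u a"
    and descent_exists: "\<lbrakk>u \<in> L; a \<in> L; b \<in> L; y \<in> L; lt u a; rk a = Suc (rk u);
        lt u b; rk b = Suc (rk u); lt a y; lt b y; lab u b < lab u a\<rbrakk>
        \<Longrightarrow> \<exists>x\<in>L. lt a x \<and> rk x = Suc (rk a) \<and> (x = y \<or> lt x y) \<and> lab a x < lab u a"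
begin

definition cov :: "'w \<Rightarrow> 'w \<Rightarrow> bool" where
  "cov u a \<longleftrightarrow> u \<in> L \<and> a \<in> L \<and> lt u a \<and> rk a = Suc (rk u)"

text \<open>The part of the open interval that is already glued once the atoms with labels below
  \<open>k\<close> have been treated.\<close>

definition above_atoms :: "'w \<Rightarrow> 'w \<Rightarrow> nat \<Rightarrow> 'w set" where
  "above_atoms u w k =
     {x \<in> L. lt u x \<and> lt x w \<and> (\<exists>a. cov u a \<and> (a = x \<or> lt a x) \<and> lab u a < k)}"

lemma lt_irrefl: "x \<in> L \<Longrightarrow> \<not> lt x x"
  using lt_rank by blast

text \<open>The threshold survives the passage from \<open>u\<close> to \<open>a\<close>, which is
  what makes the recursion close. One inclusion is \<open>descent_exists\<close>, the other
  \<open>descent_below\<close>.\<close>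

lemma above_atoms_inter_cone:
  assumes a: "cov u a" "lt a w" and k: "lab u a = k" and w: "w \<in> L"
  shows "above_atoms u w k \<inter> {x \<in> L. lt x w \<and> (a = x \<or> lt a x)} = above_atoms a w k"
proof (intro equalityI subsetI)
  fix x assume x: "x \<in> above_atoms u w k \<inter> {x \<in> L. lt x w \<and> (a = x \<or> lt a x)}"
  then obtain b where b: "cov u b" "b = x \<or> lt b x" "lab u b < k"
    unfolding above_atoms_def by blast
  have xL: "x \<in> L" "lt x w" "a = x \<or> lt a x" using x by blast+
  have aL: "a \<in> L" "u \<in> L" "lt u a" "rk a = Suc (rk u)" using a(1) by (simp_all add: cov_def)
  have bL: "b \<in> L" "lt u b" "rk b = Suc (rk u)" using b(1) by (simp_all add: cov_def)
  have "a \<noteq> b" using b(3) k by blast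
  \<comment> \<open>Two atoms have equal rank, so they are incomparable and \<open>x\<close> lies
    strictly above both.\<close>
  moreover have "\<not> lt a b" "\<not> lt b a"
    using aL bL lt_rank [of a b] lt_rank [of b a] by linarith+
  ultimately have "lt a x" "lt b x" using xL(3) b(2) by blast+
  moreover obtain v where "v \<in> L" "lt a v" "rk v = Suc (rk a)" "v = x \<or> lt v x" "lab a v < k"
    using descent_exists [OF aL(2,1) bL(1) xL(1) aL(3,4) bL(2,3) calculation] b(3) k by blast
  ultimately show "x \<in> above_atoms a w k"
    using xL(1,2) aL(1) unfolding above_atoms_def cov_def by blast
next
  fix x assume x: "x \<in> above_atoms a w k"
  then obtain v where v: "cov a v" "v = x \<or> lt v x" "lab a v < k"
    unfolding above_atoms_def by blast
  have xL: "x \<in> L" "lt a x" "lt x w" using x by (simp_all add: above_atoms_def)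
  have aL: "a \<in> L" "u \<in> L" "lt u a" "rk a = Suc (rk u)" using a(1) by (simp_all add: cov_def)
  have vL: "v \<in> L" "lt a v" "rk v = Suc (rk a)" using v(1) by (simp_all add: cov_def)
  obtain b where b: "b \<in> L" "lt u b" "rk b = Suc (rk u)" "lt b v" "lab u b < k"
    using descent_below [OF aL(2,1) vL(1) aL(3,4) vL(2,3)] v(3) k by blast
  have "lt u x" by (rule lt_trans [OF aL(2,1) xL(1) aL(3) xL(2)])
  moreover have "lt b x" using lt_trans [OF b(1) vL(1) xL(1) b(4)] b(4) v(2) by blast
  ultimately show "x \<in> above_atoms u w k \<inter> {x \<in> L. lt x w \<and> (a = x \<or> lt a x)}"
    using xL aL(2) b unfolding above_atoms_def cov_def by blast
qed

lemma above_atoms_mono: "k \<le> k' \<Longrightarrow> above_atoms u w k \<subseteq> above_atoms u w k'"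
  unfolding above_atoms_def by (rule Collect_mono) (use less_le_trans in blast)

text \<open>Labels determine atoms, so raising the threshold by one adds a single principal
  filter.\<close>

lemma above_atoms_Suc:
  assumes a: "cov u a" "lt a w" and k: "lab u a = k" and w: "w \<in> L"
  shows "above_atoms u w (Suc k) = above_atoms u w k \<union> {x \<in> L. lt x w \<and> (a = x \<or> lt a x)}"
proof (intro equalityI subsetI)
  fix x assume x: "x \<in> above_atoms u w (Suc k)"
  then obtain b where b: "cov u b" "b = x \<or> lt b x" "lab u b < Suc k"
    unfolding above_atoms_def by blast
  have "b = a \<or> lab u b < k"
  proof (cases "lab u b = k")
    case True
    then show ?thesis using lab_inj [of u b a] a(1) b(1) k unfolding cov_def by simp
  qed (use b(3) in simp)
  then show "x \<in> above_atoms u w k \<union> {x \<in> L. lt x w \<and> (a = x \<or> lt a x)}"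
    using x b unfolding above_atoms_def by blast
next
  fix x assume x: "x \<in> above_atoms u w k \<union> {x \<in> L. lt x w \<and> (a = x \<or> lt a x)}"
  show "x \<in> above_atoms u w (Suc k)"
  proof (cases "x \<in> above_atoms u w k")
    case True
    then show ?thesis using above_atoms_mono [of k "Suc k" u w] by auto
  next
    case False
    then have xL: "x \<in> L" "lt x w" "a = x \<or> lt a x" using x by blast+
    have "lt u x"
      using lt_trans [of u a x] a(1) xL unfolding cov_def by blast
    then show ?thesis using xL a(1) k unfolding above_atoms_def by blast
  qed
qed

lemma above_atoms_upward:
  assumes "x \<in> above_atoms u w k" "y \<in> L" "lt y w" "lt x y" "u \<in> L"
  shows "y \<in> above_atoms u w k"
proof -
  obtain a where a: "cov u a" "a = x \<or> lt a x" "lab u a < k" and x: "x \<in> L" "lt u x"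
    using assms(1) by (auto simp: above_atoms_def)
  have "lt u y" using lt_trans [of u x y] assms x by blast
  moreover have "lt a y" using lt_trans [of a x y] assms x a by (auto simp: cov_def)
  ultimately show ?thesis using assms a by (auto simp: above_atoms_def)
qed

text \<open>Outer induction on the length of the interval, inner induction on the threshold. Each
  new atom attaches a cone along an overlap handled by the outer hypothesis. The atom
  \<open>a\<close> guarantees, for rank difference above 1, that the set is nonempty: in the empty
  set the empty chain is a cycle that bounds nothing.\<close>

lemma acyclic_below_above_atoms:
  assumes "u \<in> L" "w \<in> L" "cov u a" "a = w \<or> lt a w" "lab u a < k"
  shows "acyclic_below lt (above_atoms u w k) (rk w - rk u - 1)"
  using assms
proof (induction "rk w - rk u" arbitrary: u a k rule: less_induct)
  case less
  note IH = less.hyps and uL = \<open>u \<in> L\<close>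
  show ?case
  proof (cases "rk w - rk u \<le> 1")
    \<comment> \<open>The bound is 0, so the claim is vacuous; this disposes of
      \<open>a = w\<close>.\<close>
    case True
    then show ?thesis by (simp add: acyclic_below_def)
  next
    case big: False
    have atom_lt: "lt b w" if "cov u b" "b = w \<or> lt b w" for b
      using that big by (auto simp: cov_def)
    show ?thesis
      using less.prems(3-5)
    proof (induction k arbitrary: a)
      case 0
      then show ?case by simp
    next
      case (Suc k)
      show ?case
      proof (cases "\<exists>c. cov u c \<and> lt c w \<and> lab u c = k")
        case False
        have "above_atoms u w (Suc k) = above_atoms u w k"
        proof
          show "above_atoms u w (Suc k) \<subseteq> above_atoms u w k"
          proof
            fix x assume x: "x \<in> above_atoms u w (Suc k)"
            then obtain b where b: "cov u b" "b = x \<or> lt b x" "lab u b < Suc k"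
              unfolding above_atoms_def by blast
            have "lt b w"
              using x b lt_trans [of b x w] \<open>w \<in> L\<close> unfolding above_atoms_def cov_def by blast
            then have "lab u b < k" using False b by (metis less_Suc_eq)
            then show "x \<in> above_atoms u w k" using x b unfolding above_atoms_def by blast
          qed
        qed (rule above_atoms_mono, simp)
        moreover have "lab u a < k" using Suc.prems False atom_lt by (auto simp: less_Suc_eq)
        ultimately show ?thesis using Suc.IH [OF Suc.prems(1,2)] by simp
      next
        case True
        then obtain c where c: "cov u c" "lt c w" "lab u c = k" by blast
        define C where "C = {x \<in> L. lt x w \<and> (c = x \<or> lt c x)}"
        have cL: "c \<in> L" "rk c = Suc (rk u)" using c(1) by (auto simp: cov_def)
        have C: "acyclic_below lt C r" for r
        proof (rule acyclic_below_cone)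
          show "\<not> lt x c" if "x \<in> C" for x
            using that lt_irrefl [of c] lt_rank [of c x] lt_rank [of x c] cL by (auto simp: C_def)
        qed (use c cL in \<open>auto simp: C_def\<close>)
        have U: "above_atoms u w (Suc k) = above_atoms u w k \<union> C"
          unfolding C_def by (rule above_atoms_Suc [OF c \<open>w \<in> L\<close>])
        show ?thesis
        proof (cases "\<exists>b. cov u b \<and> lt b w \<and> lab u b < k")
          \<comment> \<open>Here \<open>c\<close> is the first atom, and the union is the cone
            alone.\<close>
          case False
          have "above_atoms u w k = {}"
          proof -
            have False if "cov u b" "b = x \<or> lt b x" "lab u b < k" "lt x w" "x \<in> L" for b x
              using that False lt_trans [of b x w] \<open>w \<in> L\<close> by (auto simp: cov_def)
            then show ?thesis by (auto simp: above_atoms_def)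
          qed
          then show ?thesis using C U by simp
        next
          case True
          then obtain b where b: "cov u b" "lt b w" "lab u b < k" by blast
          then have P: "acyclic_below lt (above_atoms u w k) (rk w - rk u - 1)"
            by (intro Suc.IH [of b]) blast+
          \<comment> \<open>Taking \<open>y = w\<close> in \<open>descent_exists\<close> yields an
            atom above \<open>c\<close> with label below \<open>k\<close>, the witness that the
            outer hypothesis asks for.\<close>
          have "lab u b < lab u c" using b(3) c(3) by simp
          then obtain v where v: "v \<in> L" "lt c v" "rk v = Suc (rk c)" "v = w \<or> lt v w" "lab c v < k"
            using descent_exists [of u c b w] b(1,2) c(1,2) \<open>w \<in> L\<close>
            unfolding cov_def c(3) by blast
          have "acyclic_below lt (above_atoms c w k) (rk w - rk c - 1)"
          proof (rule IH)
            show "rk w - rk c < rk w - rk u" using cL big by linarith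
            show "cov c v" using v cL by (simp add: cov_def)
          qed (use v cL \<open>w \<in> L\<close> in auto)
          then have I: "acyclic_below lt (above_atoms u w k \<inter> C) (rk w - rk u - 1 - 1)"
            using above_atoms_inter_cone [OF c \<open>w \<in> L\<close>] cL by (simp add: C_def)
          show ?thesis
            unfolding U
          proof (rule acyclic_below_union [OF P C I order_chains_union_upward])
            fix x y assume y: "y \<in> above_atoms u w k \<union> C" and xy: "lt x y"
            have yL: "y \<in> L" "lt y w" using y unfolding above_atoms_def C_def by blast+
            show "y \<in> above_atoms u w k" if "x \<in> above_atoms u w k"
              using above_atoms_upward [OF that yL xy uL] .
            show "y \<in> C" if "x \<in> C"
              using that yL xy lt_trans [of c x y] cL(1) unfolding C_def by blast
          qed
        qed
      qed
    qed
  qed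
qed

text \<open>With a threshold above all labels, atomicity makes \<open>above_atoms\<close> the whole
  open interval.\<close>

lemma acyclic_below_open_interval:
  assumes "u \<in> L" "w \<in> L" "finite L"
    and atomic: "\<And>x. x \<in> L \<Longrightarrow> lt u x \<Longrightarrow> \<exists>a. cov u a \<and> (a = x \<or> lt a x)"
    and "lt u w"
  shows "acyclic_below lt {x \<in> L. lt u x \<and> lt x w} (rk w - rk u - 1)"
proof -
  define k where "k = Suc (Max (lab u ` L))"
  have k: "lab u a < k" if "a \<in> L" for a
    using that \<open>finite L\<close> by (simp add: k_def less_Suc_eq_le)
  have "above_atoms u w k = {x \<in> L. lt u x \<and> lt x w}"
  proof (intro equalityI subsetI)
    fix x assume x: "x \<in> {x \<in> L. lt u x \<and> lt x w}"
    then obtain a where "cov u a" "a = x \<or> lt a x" using atomic by blast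
    then show "x \<in> above_atoms u w k" using x k by (auto simp: above_atoms_def cov_def)
  qed (auto simp: above_atoms_def)
  moreover obtain a where "cov u a" "a = w \<or> lt a w" using atomic \<open>w \<in> L\<close> \<open>lt u w\<close> by blast
  ultimately show ?thesis
    using acyclic_below_above_atoms [of u w a k] k assms(1,2) by (auto simp: cov_def)
qed

text \<open>The order complex of the ranks \<open>1, \<dots>, p\<close> is cut down from that of all ranks below the top
  by removing one rank after another; the link of a removed element is an open interval.\<close>

lemma acyclic_below_truncation:
  assumes "e \<in> L" "g \<in> L" "finite L" "rk e = 0" "p < rk g"
    and greatest: "\<And>x. x \<in> L \<Longrightarrow> x \<noteq> g \<Longrightarrow> lt x g"
    and least: "\<And>x. x \<in> L \<Longrightarrow> x \<noteq> e \<Longrightarrow> lt e x"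
    and atomic: "\<And>x. x \<in> L \<Longrightarrow> lt e x \<Longrightarrow> \<exists>a. cov e a \<and> (a = x \<or> lt a x)"
  shows "acyclic_below lt {x \<in> L. 1 \<le> rk x \<and> rk x \<le> p} p"
proof -
  have pos: "lt e x \<longleftrightarrow> 1 \<le> rk x" if "x \<in> L" for x
    using that least [of x] lt_rank [of e x] \<open>e \<in> L\<close> \<open>rk e = 0\<close> by fastforce
  have interval: "acyclic_below lt {x \<in> L. lt e x \<and> lt x w} (rk w - 1)" if "w \<in> L" "lt e w" for w
    using acyclic_below_open_interval [of e w] that assms by simp
  have "p \<le> rk g - 1" using \<open>p < rk g\<close> by simp
  then show ?thesis
  proof (induction p rule: inc_induct)
    case base
    have "{x \<in> L. 1 \<le> rk x \<and> rk x \<le> rk g - 1} = {x \<in> L. lt e x \<and> lt x g}"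
      using pos greatest lt_rank [of _ g] \<open>g \<in> L\<close> \<open>p < rk g\<close> by fastforce
    then show ?case using interval [of g] pos \<open>g \<in> L\<close> \<open>p < rk g\<close> by simp
  next
    case (step p)
    let ?P = "{x \<in> L. 1 \<le> rk x \<and> rk x \<le> Suc p}"
    let ?M = "{x \<in> L. rk x = Suc p}"
    \<comment> \<open>The bound drops together with the top rank: for a removed element of rank
      \<open>Suc p\<close> the open interval below it is acyclic below exactly
      \<open>p\<close>.\<close>
    have "acyclic_below lt (?P - ?M) p"
    proof (rule acyclic_below_remove_antichain)
      show "acyclic_below lt ?P p" using step.IH by (rule acyclic_below_mono) simp
    next
      fix w assume w: "w \<in> ?M"
      have "{x \<in> ?P. lt x w} = {x \<in> L. lt e x \<and> lt x w}"
        using pos w lt_rank [of _ w] by fastforce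
      then show "acyclic_below lt {x \<in> ?P. lt x w} p"
        using interval [of w] pos w by simp
    next
      fix x w assume "w \<in> ?M" "x \<in> ?P"
      then show "\<not> lt w x" using lt_rank [of w x] by auto
    qed (use \<open>finite L\<close> in auto)
    moreover have "?P - ?M = {x \<in> L. 1 \<le> rk x \<and> rk x \<le> p}" by auto
    ultimately show ?case by simp
  qed
qed

end

section \<open>Moved and fixed vectors of words in reflections\<close>

section \<open>Products of reflections\<close>

abbreviation refl_prod :: "'a::euclidean_space list \<Rightarrow> 'a \<Rightarrow> 'a" where
  "refl_prod bs \<equiv> compose_list (map reflection bs)"

lemma compose_list_Nil [simp]: "compose_list [] = id"
  by (simp add: compose_list_def)

lemma compose_list_Cons [simp]: "compose_list (t # ts) = t \<circ> compose_list ts"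
  by (simp add: compose_list_def)

lemma compose_list_append [simp]: "compose_list (ts @ us) = compose_list ts \<circ> compose_list us"
  by (induction ts) auto

lemma reflection_unit: "norm a = 1 \<Longrightarrow> reflection a x = x - (2 * (x \<bullet> a)) *\<^sub>R a"
  by (simp add: reflection_def norm_eq_1)

lemma linear_reflection: "linear (reflection a)"
  by (intro linearI) (simp_all add: reflection_def inner_add_left add_divide_distrib algebra_simps)

lemma reflection_reflection [simp]: "reflection a (reflection a x) = x"
proof (cases "a = 0")
  case False
  then show ?thesis
    by (simp add: reflection_def inner_diff_left field_simps)
qed (simp add: reflection_def)

lemma reflection_comp_self [simp]: "reflection a \<circ> reflection a = id"
  by auto

lemma inner_reflection [simp]: "reflection a x \<bullet> reflection a y = x \<bullet> y"
proof (cases "a = 0")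
  case False
  then show ?thesis
    by (simp add: reflection_def inner_diff_left inner_diff_right field_simps inner_commute)
qed (simp add: reflection_def)

lemma reflection_uminus [simp]: "reflection (- a) = reflection a"
  by (simp add: reflection_def fun_eq_iff)

lemma reflection_scaleR: "c \<noteq> 0 \<Longrightarrow> reflection (c *\<^sub>R a) = reflection a"
  by (simp add: reflection_def fun_eq_iff power2_eq_square field_simps)

lemma reflection_self: "reflection a a = - a"
  by (cases "a = 0") (simp_all add: reflection_def algebra_simps flip: scaleR_2)

lemma reflection_eq_unitD:
  assumes "norm a = 1" "norm b = 1" "reflection a = reflection b"
  shows "a = b \<or> a = - b"
proof -
  have "- a = a - (2 * (a \<bullet> b)) *\<^sub>R b"
    using reflection_self [of a] assms(2,3) by (simp add: reflection_unit)
  then have "2 *\<^sub>R a = 2 *\<^sub>R ((a \<bullet> b) *\<^sub>R b)"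
    by (simp add: algebra_simps scaleR_2)
  then have a: "a = (a \<bullet> b) *\<^sub>R b" by (metis scaleR_left_imp_eq zero_neq_numeral)
  then have "norm a = \<bar>a \<bullet> b\<bar> * norm b" by (metis norm_scaleR)
  then have "\<bar>a \<bullet> b\<bar> = 1" using assms by simp
  then have "a \<bullet> b = 1 \<or> a \<bullet> b = -1" by linarith
  then show ?thesis using a by (metis scaleR_one scaleR_minus1_left)
qed

lemma linear_refl_prod: "linear (refl_prod bs)"
proof (induction bs)
  case (Cons b bs)
  then show ?case
    using linear_compose [OF Cons linear_reflection [of b]] by (simp only: list.map compose_list_Cons)
qed (simp add: linear_ident id_def)

lemma inner_refl_prod [simp]: "refl_prod bs x \<bullet> refl_prod bs y = x \<bullet> y"
  by (induction bs) auto

lemma reflection_image: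
  assumes "linear f" "\<And>x y. f x \<bullet> f y = x \<bullet> y"
  shows "reflection (f a) (f x) = f (reflection a x)"
  using assms by (simp add: reflection_def linear_diff linear_scale)

lemma refl_prod_rev: "refl_prod (rev bs) (refl_prod bs x) = x" "refl_prod bs (refl_prod (rev bs) x) = x"
  by (induction bs arbitrary: x) (simp_all add: rev_map [symmetric])

lemma refl_prod_fix_orthogonal:
  "(\<And>b. b \<in> set bs \<Longrightarrow> x \<bullet> b = 0) \<Longrightarrow> refl_prod bs x = x"
  by (induction bs) (auto simp: reflection_def)

text \<open>Each letter alters a vector by a multiple of its own root. Hence the image of 1 - w lies
  in the span of the letters of any word for w, which is how different words are compared.\<close>

lemma diff_refl_prod_in_span: "x - refl_prod bs x \<in> span (set bs)"
proof (induction bs)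
  case (Cons b bs)
  let ?y = "refl_prod bs x"
  have "x - reflection b ?y = (x - ?y) + (2 * (?y \<bullet> b) / (b \<bullet> b)) *\<^sub>R b"
    by (simp add: reflection_def)
  moreover have "x - ?y \<in> span (set (b # bs))"
    using Cons.IH span_mono [of "set bs" "set (b # bs)"] by auto
  moreover have "(2 * (?y \<bullet> b) / (b \<bullet> b)) *\<^sub>R b \<in> span (set (b # bs))"
    by (intro span_scale span_base) simp
  ultimately have "x - reflection b ?y \<in> span (set (b # bs))"
    by (metis span_add)
  then show ?case by simp
qed (simp add: span_0)

lemma scaleR_in_span_imp_0:
  assumes "k *\<^sub>R a \<in> span S" "a \<notin> span S"
  shows "k = 0"
proof (rule ccontr)
  assume "k \<noteq> 0"
  then have "a = inverse k *\<^sub>R (k *\<^sub>R a)" by simp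
  then show False using assms span_scale [OF assms(1), of "inverse k"] by simp
qed

text \<open>On a fixed vector the first letter \<open>c\<close> must undo what the remaining letters
  do. One movement is a multiple of \<open>c\<close>, the other lies in a span that does not contain
  \<open>c\<close>, so both vanish.\<close>

lemma refl_prod_fixed_imp_orthogonal:
  assumes "distinct bs" "independent (set bs)" "refl_prod bs x = x" "b \<in> set bs"
  shows "x \<bullet> b = 0"
  using assms
proof (induction bs)
  case (Cons c bs)
  let ?y = "refl_prod bs x"
  have c: "c \<notin> span (set bs)" "independent (set bs)" "c \<noteq> 0"
    using Cons.prems(1,2) by (auto simp: independent_insert span_0)
  have y: "?y = reflection c x"
    using Cons.prems(3) by (metis comp_apply compose_list_Cons list.simps(9) reflection_reflection)
  then have "x - ?y = (2 * (x \<bullet> c) / (c \<bullet> c)) *\<^sub>R c" by (simp add: reflection_def)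
  then have "(2 * (x \<bullet> c) / (c \<bullet> c)) *\<^sub>R c \<in> span (set bs)"
    using diff_refl_prod_in_span [of x bs] by simp
  then have "2 * (x \<bullet> c) / (c \<bullet> c) = 0"
    using c(1) by (rule scaleR_in_span_imp_0)
  then have "x \<bullet> c = 0" using c(3) by simp
  moreover from this have "?y = x" using y by (simp add: reflection_def)
  ultimately show ?case using Cons c(2) by auto
qed simp

text \<open>Extend the prescribed values to a linear functional and represent it by an inner
  product.\<close>

lemma independent_inner_interpolation:
  fixes B :: "'a::euclidean_space set"
  assumes "independent B"
  obtains x where "\<And>b. b \<in> B \<Longrightarrow> x \<bullet> b = f b"
proof -
  obtain g :: "'a \<Rightarrow> real" where g: "linear g" "\<And>b. b \<in> B \<Longrightarrow> g b = f b"
    using linear_independent_extend [OF assms] by blast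
  have *: "(\<Sum>e\<in>Basis. g e *\<^sub>R e) \<bullet> y = g y" for y
  proof -
    have "g y = g (\<Sum>e\<in>Basis. (y \<bullet> e) *\<^sub>R e)" by (simp add: euclidean_representation)
    also have "\<dots> = (\<Sum>e\<in>Basis. (y \<bullet> e) * g e)"
      by (simp add: linear_sum [OF g(1)] linear_scale [OF g(1)])
    also have "\<dots> = (\<Sum>e\<in>Basis. g e *\<^sub>R e) \<bullet> y"
      unfolding inner_sum_left by (intro sum.cong) (simp_all add: inner_commute)
    finally show ?thesis by simp
  qed
  show ?thesis by (rule that [of "\<Sum>e\<in>Basis. g e *\<^sub>R e"]) (simp only: * g(2))
qed

text \<open>The vectors \<open>x\<close> play the role of \<open>(1 - \<gamma>)\<inverse> b\<close>: for a reduced factorization of \<open>\<gamma>\<close>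
  the form \<open>E(b, v) = 2 (1 - \<gamma>)\<inverse> b \<bullet> v\<close> is unitriangular in the roots of the factors.\<close>

lemma refl_prod_dual_vector:
  assumes "distinct (us @ b # vs)" "independent (set (us @ b # vs))" "norm b = 1"
  obtains x where "x - refl_prod (us @ b # vs) x = b" "x \<bullet> b = 1 / 2" "\<And>v. v \<in> set vs \<Longrightarrow> x \<bullet> v = 0"
proof -
  \<comment> \<open>The values are solved from the right end of the word: \<open>vs\<close> is to
    fix \<open>x\<close>, \<open>b\<close> is to send it to \<open>x - b\<close>, and
    \<open>us\<close> is to fix \<open>x - b\<close>.\<close>
  define f where "f c = (if c \<in> set vs then 0 else if c = b then 1 / 2 else b \<bullet> c)" for c
  obtain x where x: "\<And>c. c \<in> set (us @ b # vs) \<Longrightarrow> x \<bullet> c = f c"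
    by (rule independent_inner_interpolation [OF assms(2), of f]) blast
  have vs: "x \<bullet> v = 0" if "v \<in> set vs" for v using x [of v] that by (simp add: f_def)
  have b: "x \<bullet> b = 1 / 2" using x [of b] assms(1) by (simp add: f_def)
  have "refl_prod vs x = x" using vs by (rule refl_prod_fix_orthogonal)
  moreover have "reflection b x = x - b" unfolding reflection_unit [OF assms(3)] b by simp
  moreover have "refl_prod us (x - b) = x - b"
  proof (rule refl_prod_fix_orthogonal)
    fix c assume "c \<in> set us"
    then have "x \<bullet> c = b \<bullet> c" using x [of c] assms(1) by (auto simp: f_def)
    then show "(x - b) \<bullet> c = 0" by (simp add: inner_diff_left)
  qed
  ultimately have "x - refl_prod (us @ b # vs) x = b" by simp
  then show thesis using b vs by (rule that)
qed

section \<open>Positive roots, simple reflections and the order on roots\<close>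

section \<open>The ordering of the reflections attached to a Coxeter element\<close>

text \<open>On any root \<rho> gives the sum of the simple coefficients, so its sign separates
  positive from negative roots.\<close>

locale coxeter_word =
  fixes W :: "('a::euclidean_space \<Rightarrow> 'a) set" and as :: "'a list" and \<rho> :: 'a
  assumes refl_group: "finite_reflection_group W"
    and simple: "simple_system W (set as)"
    and distinct_as: "distinct as" and as_nonempty: "as \<noteq> []"
    and rho: "a \<in> set as \<Longrightarrow> \<rho> \<bullet> a = 1"
begin

definition \<gamma> :: "'a \<Rightarrow> 'a" where "\<gamma> = refl_prod as"

definition pos_roots :: "'a set" where "pos_roots = {b \<in> unit_roots W. \<rho> \<bullet> b > 0}"

lemma finite_W: "finite W"
  using refl_group by (simp add: finite_reflection_group_def)

lemma W_eq: "W = {compose_list ts | ts. set ts \<subseteq> reflections W}"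
  using refl_group by (simp add: finite_reflection_group_def)

lemma independent_as: "independent (set as)"
  using simple by (simp add: simple_system_def)

lemma as_unit_roots: "set as \<subseteq> unit_roots W"
  using simple by (simp add: simple_system_def)

lemma span_as: "span (set as) = span (unit_roots W)"
  using simple by (simp add: simple_system_def)

lemma norm_unit_root: "b \<in> unit_roots W \<Longrightarrow> norm b = 1"
  by (simp add: unit_roots_def)

lemma reflection_in_W: "b \<in> unit_roots W \<Longrightarrow> reflection b \<in> W"
  by (simp add: unit_roots_def)

lemma reflection_in_reflections: "b \<in> unit_roots W \<Longrightarrow> reflection b \<in> reflections W"
  by (auto simp: unit_roots_def reflections_def intro!: exI [of _ b])

lemma reflectionsE:
  assumes "t \<in> reflections W"
  obtains b where "b \<in> unit_roots W" "t = reflection b"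
proof -
  obtain a where a: "t \<in> W" "a \<noteq> 0" "t = reflection a" using assms by (auto simp: reflections_def)
  have "reflection ((1 / norm a) *\<^sub>R a) = reflection a" using a(2) by (intro reflection_scaleR) simp
  with a that [of "(1 / norm a) *\<^sub>R a"] show ?thesis by (simp add: unit_roots_def)
qed

lemma refl_prod_in_W: "set bs \<subseteq> unit_roots W \<Longrightarrow> refl_prod bs \<in> W"
  by (subst W_eq) (use reflection_in_reflections in \<open>fastforce intro!: exI [of _ "map reflection bs"]\<close>)

lemma WE:
  assumes "w \<in> W"
  obtains bs where "set bs \<subseteq> unit_roots W" "w = refl_prod bs"
proof -
  obtain ts where ts: "set ts \<subseteq> reflections W" "w = compose_list ts" using assms W_eq by blast
  have "\<exists>bs. set bs \<subseteq> unit_roots W \<and> ts = map reflection bs"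
    using ts(1)
  proof (induction ts)
    case (Cons t ts)
    then obtain bs where "set bs \<subseteq> unit_roots W" "ts = map reflection bs" by auto
    moreover obtain b where "b \<in> unit_roots W" "t = reflection b" using Cons.prems reflectionsE by auto
    ultimately show ?case by (intro exI [of _ "b # bs"]) auto
  qed simp
  with ts(2) that show ?thesis by blast
qed

text \<open>Conjugation by \<open>w\<close> carries the reflection in \<open>b\<close> to that in
  \<open>w b\<close>; the palindrome \<open>bs @ b # rev bs\<close> exhibits the conjugate as an
  element of \<open>W\<close>.\<close>

lemma unit_roots_image:
  assumes "w \<in> W" "b \<in> unit_roots W"
  shows "w b \<in> unit_roots W"
proof -
  obtain bs where bs: "set bs \<subseteq> unit_roots W" "w = refl_prod bs" using assms(1) by (rule WE)
  have "refl_prod (bs @ b # rev bs) x = reflection (refl_prod bs b) x" for x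
    using reflection_image [OF linear_refl_prod inner_refl_prod, of bs b "refl_prod (rev bs) x"]
    by (simp add: refl_prod_rev)
  then have "refl_prod (bs @ b # rev bs) = reflection (w b)" using bs(2) by blast
  moreover have "refl_prod (bs @ b # rev bs) \<in> W"
    using bs(1) assms(2) by (intro refl_prod_in_W) auto
  moreover have "norm (w b) = 1"
    using norm_unit_root [OF assms(2)] bs(2) by (simp add: norm_eq_sqrt_inner)
  ultimately show ?thesis by (simp add: unit_roots_def)
qed

lemma root_coefficients:
  assumes "b \<in> unit_roots W"
  obtains c where "b = (\<Sum>a\<in>set as. c a *\<^sub>R a)" "\<rho> \<bullet> b = sum c (set as)"
    "(\<forall>a\<in>set as. 0 \<le> c a) \<or> (\<forall>a\<in>set as. c a \<le> 0)"
proof -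
  obtain c where c: "b = (\<Sum>a\<in>set as. c a *\<^sub>R a)"
    "(\<forall>a\<in>set as. 0 \<le> c a) \<or> (\<forall>a\<in>set as. c a \<le> 0)"
    using simple assms unfolding simple_system_def by blast
  moreover have "\<rho> \<bullet> b = sum c (set as)" unfolding c(1) by (simp add: inner_sum_right rho)
  ultimately show ?thesis using that by blast
qed

text \<open>Coefficients of one sign whose sum is zero all vanish, but a root does not.\<close>

lemma rho_root_nonzero:
  assumes "b \<in> unit_roots W"
  shows "\<rho> \<bullet> b \<noteq> 0"
proof
  assume 0: "\<rho> \<bullet> b = 0"
  obtain c where c: "b = (\<Sum>a\<in>set as. c a *\<^sub>R a)" "\<rho> \<bullet> b = sum c (set as)"
    "(\<forall>a\<in>set as. 0 \<le> c a) \<or> (\<forall>a\<in>set as. c a \<le> 0)"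
    using assms by (rule root_coefficients)
  from c(3) have "\<forall>a\<in>set as. c a = 0"
  proof
    assume "\<forall>a\<in>set as. 0 \<le> c a"
    then show ?thesis using 0 c(2) sum_nonneg_eq_0_iff [of "set as" c] by simp
  next
    assume "\<forall>a\<in>set as. c a \<le> 0"
    then show ?thesis using 0 c(2) sum_nonneg_eq_0_iff [of "set as" "\<lambda>a. - c a"]
      by (simp add: sum_negf)
  qed
  then have "b = 0" using c(1) by simp
  then show False using norm_unit_root [OF assms] by simp
qed

lemma pos_root_coefficients:
  assumes "b \<in> pos_roots"
  obtains c where "b = (\<Sum>a\<in>set as. c a *\<^sub>R a)" "\<forall>a\<in>set as. 0 \<le> c a"
proof -
  have b: "b \<in> unit_roots W" "0 < \<rho> \<bullet> b" using assms by (auto simp: pos_roots_def)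
  from b(1) obtain c where c: "b = (\<Sum>a\<in>set as. c a *\<^sub>R a)" "\<rho> \<bullet> b = sum c (set as)"
    "(\<forall>a\<in>set as. 0 \<le> c a) \<or> (\<forall>a\<in>set as. c a \<le> 0)"
    by (rule root_coefficients)
  have "\<not> (\<forall>a\<in>set as. c a \<le> 0)" using b(2) c(2) sum_nonpos [of "set as" c] by auto
  then show ?thesis using that c by blast
qed

lemma pos_roots_unit: "pos_roots \<subseteq> unit_roots W"
  by (auto simp: pos_roots_def)

text \<open>Only the coefficient at \<open>a\<close> changes. Another positive coefficient of
  \<open>b\<close> survives and determines the sign of the image.\<close>

lemma reflection_simple_pos:
  assumes "b \<in> pos_roots" "a \<in> set as" "b \<noteq> a"
  shows "reflection a b \<in> pos_roots"
proof -
  have bW: "b \<in> unit_roots W" and aW: "a \<in> unit_roots W"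
    using assms pos_roots_unit as_unit_roots by auto
  obtain c where c: "b = (\<Sum>v\<in>set as. c v *\<^sub>R v)" "\<forall>v\<in>set as. 0 \<le> c v"
    using assms(1) by (rule pos_root_coefficients)
  have r: "reflection a b \<in> unit_roots W"
    using unit_roots_image reflection_in_W aW bW by blast
  then obtain d where d: "reflection a b = (\<Sum>v\<in>set as. d v *\<^sub>R v)"
    "\<rho> \<bullet> reflection a b = sum d (set as)" "(\<forall>v\<in>set as. 0 \<le> d v) \<or> (\<forall>v\<in>set as. d v \<le> 0)"
    by (rule root_coefficients)
  \<comment> \<open>Otherwise \<open>b\<close> is a nonnegative multiple of \<open>a\<close>, and
    equal norms force \<open>b = a\<close>.\<close>
  have "\<exists>v\<in>set as. v \<noteq> a \<and> 0 < c v"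
  proof (rule ccontr)
    assume "\<not> ?thesis"
    then have "\<forall>v\<in>set as - {a}. c v *\<^sub>R v = 0" using c(2) by force
    then have "(\<Sum>v\<in>set as - {a}. c v *\<^sub>R v) = 0" by (rule sum.neutral)
    then have b: "b = c a *\<^sub>R a"
      using c(1) assms(2) by (simp add: sum.remove [of "set as" a])
    have "norm b = c a * norm a" using c(2) assms(2) by (subst b) simp
    then have "c a = 1" using norm_unit_root [OF aW] norm_unit_root [OF bW] by simp
    then show False using b assms(3) by simp
  qed
  then obtain v where v: "v \<in> set as" "v \<noteq> a" "0 < c v" by blast
  define k where "k = 2 * (b \<bullet> a)"
  have "(\<Sum>v\<in>set as. (c v - d v - (if v = a then k else 0)) *\<^sub>R v) = b - reflection a b - k *\<^sub>R a"
    using assms(2) by (simp add: c(1) [symmetric] d(1) [symmetric] scaleR_diff_left sum_subtractf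
        if_distrib [of "\<lambda>x. x *\<^sub>R _"] sum.delta cong: if_cong)
  also have "\<dots> = 0" using norm_unit_root [OF aW] by (simp add: reflection_unit k_def)
  finally have "c v - d v - (if v = a then k else 0) = 0"
    by (rule independentD [OF independent_as finite_set order_refl _ v(1),
          where u = "\<lambda>v. c v - d v - (if v = a then k else 0)"])
  then have "0 < d v" using v by simp
  then have "\<forall>v\<in>set as. 0 \<le> d v" using d(3) v(1) by force
  then have "0 \<le> \<rho> \<bullet> reflection a b" unfolding d(2) by (intro sum_nonneg) auto
  then show ?thesis using r rho_root_nonzero [OF r] by (simp add: pos_roots_def)
qed

lemma gamma_fixed_orthogonal: "\<gamma> x = x \<Longrightarrow> a \<in> set as \<Longrightarrow> x \<bullet> a = 0"
  using refl_prod_fixed_imp_orthogonal [OF distinct_as independent_as] by (simp add: \<gamma>_def)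

lemma root_in_span: "b \<in> unit_roots W \<Longrightarrow> b \<in> span (set as)"
  using span_as span_base by blast

section \<open>The periodic Coxeter word and its inversion times\<close>

subsection \<open>Rotating the Coxeter word\<close>

text \<open>Letters of the periodic word are applied in order, so this is the inverse of the product
  of its first \<open>k\<close> letters.\<close>

fun prefix :: "nat \<Rightarrow> 'a \<Rightarrow> 'a" where
  "prefix 0 = id"
| "prefix (Suc k) = reflection (hd (rotate k as)) \<circ> prefix k"

lemma hd_rotate_in: "hd (rotate k as) \<in> set as"
  using as_nonempty by (metis hd_in_set rotate_is_Nil_conv set_rotate)

lemma prefix_in_W: "prefix k \<in> W"
proof -
  have "\<exists>bs. set bs \<subseteq> unit_roots W \<and> prefix k = refl_prod bs"
  proof (induction k)
    case 0
    then show ?case by (intro exI [of _ "[]"]) simp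
  next
    case (Suc k)
    then obtain bs where "set bs \<subseteq> unit_roots W" "prefix k = refl_prod bs" by blast
    then show ?case
      using hd_rotate_in as_unit_roots by (intro exI [of _ "hd (rotate k as) # bs"]) auto
  qed
  then show ?thesis using refl_prod_in_W by auto
qed

lemma inj_prefix: "inj (prefix k)"
proof (induction k)
  case (Suc k)
  have "inj (reflection (hd (rotate k as)))" by (metis injI reflection_reflection)
  then show ?case using Suc by (simp only: prefix.simps inj_compose)
qed simp

lemma linear_prefix: "linear (prefix k)"
proof (induction k)
  case (Suc k)
  show ?case using linear_compose [OF Suc linear_reflection] by (simp only: prefix.simps)
qed (simp add: linear_ident id_def)

lemma inner_prefix [simp]: "prefix k x \<bullet> prefix k y = x \<bullet> y"
  by (induction k) auto

lemma rotate_split: "rotate k as = hd (rotate k as) # tl (rotate k as)"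
  "rotate (Suc k) as = tl (rotate k as) @ [hd (rotate k as)]"
proof -
  show "rotate k as = hd (rotate k as) # tl (rotate k as)" using as_nonempty by simp
  then show "rotate (Suc k) as = tl (rotate k as) @ [hd (rotate k as)]"
    by (metis rotate1.simps(2) rotate_Suc)
qed

text \<open>Moving the first letter of a word to its end conjugates the product by that letter; this
  is done \<open>k\<close> times.\<close>

lemma prefix_gamma: "prefix k (\<gamma> x) = refl_prod (rotate k as) (prefix k x)"
proof (induction k)
  case (Suc k)
  let ?a = "hd (rotate k as)"
  have "prefix (Suc k) (\<gamma> x) = reflection ?a (refl_prod (rotate k as) (prefix k x))"
    using Suc by simp
  also have "\<dots> = refl_prod (tl (rotate k as)) (prefix k x)"
    by (subst (2) rotate_split(1)) simp
  also have "\<dots> = refl_prod (rotate (Suc k) as) (prefix (Suc k) x)"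
    unfolding rotate_split(2) by simp
  finally show ?case .
qed (simp add: \<gamma>_def)

lemma prefix_take: "k \<le> length as \<Longrightarrow> refl_prod (take k as) (prefix k x) = x"
proof (induction k)
  case (Suc k)
  then have "hd (rotate k as) = as ! k" using as_nonempty by (simp add: hd_rotate_conv_nth)
  then show ?case using Suc by (simp add: take_Suc_conv_app_nth)
qed simp

lemma prefix_add: "prefix (k + m * length as) x = prefix k (prefix (m * length as) x)"
proof (induction k)
  case (Suc k)
  have "rotate (k + m * length as) as = rotate k as"
    by (metis mod_mult_self1 rotate_conv_mod)
  then show ?case using Suc by simp
qed simp

text \<open>A full period of letters is the inverse of \<gamma>, so the images at multiples of
  \<open>length as\<close> run backwards through a \<gamma>-orbit.\<close>

lemma gamma_prefix: "\<gamma> (prefix (Suc m * length as) x) = prefix (m * length as) x"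
  using prefix_add [of "length as" m x] prefix_take [of "length as" "prefix (m * length as) x"]
  by (simp add: \<gamma>_def)

text \<open>Otherwise the sum over the \<open>\<gamma>\<close>-orbit of \<open>b\<close> would be a nonzero fixed vector of \<open>\<gamma>\<close>.\<close>

lemma eventually_negative:
  assumes "b \<in> pos_roots"
  obtains k where "\<rho> \<bullet> prefix (Suc k) b < 0"
proof -
  define v where "v m = prefix (m * length as) b" for m
  have bW: "b \<in> unit_roots W" using assms pos_roots_unit by auto
  have vroot: "v m \<in> unit_roots W" for m
    unfolding v_def using unit_roots_image prefix_in_W bW by blast
  have "\<exists>m. \<rho> \<bullet> v m < 0"
  proof (rule ccontr)
    assume "\<not> ?thesis"
    then have v_pos: "0 < \<rho> \<bullet> v m" for m
      using rho_root_nonzero [OF vroot] by (metis not_less_iff_gr_or_eq)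
    have "finite (range v)"
    proof (rule finite_subset)
      show "range v \<subseteq> (\<lambda>w. w b) ` W" unfolding v_def using prefix_in_W by auto
    qed (simp add: finite_W)
    then have "\<not> inj v" using finite_imageD infinite_UNIV_nat by blast
    then obtain i j where "i \<noteq> j" "v i = v j" by (auto simp: inj_def)
    then obtain i j where ij: "i < j" "v i = v j" by (metis linorder_neqE_nat)
    define S where "S = sum v {i..<j}"
    \<comment> \<open>\<gamma> lowers each index by one, and \<open>v i = v j\<close> closes the
      cycle.\<close>
    have "\<gamma> S = S"
    proof -
      have "v i + sum v {Suc i..<Suc j} = sum v {i..<j} + v j"
        using ij by (metis less_imp_le_nat less_Suc_eq sum.atLeast_Suc_lessThan sum.atLeastLessThan_Suc)
      then have "S = sum v {Suc i..<Suc j}"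
        unfolding S_def using ij(2) by simp
      then have S': "S = (\<Sum>m\<in>{i..<j}. v (Suc m))"
        by (simp only: sum.shift_bounds_Suc_ivl)
      have "linear \<gamma>" by (simp add: \<gamma>_def linear_refl_prod)
      then have "\<gamma> S = (\<Sum>m\<in>{i..<j}. \<gamma> (v (Suc m)))" unfolding S' by (rule linear_sum)
      also have "\<dots> = S" unfolding S_def v_def gamma_prefix by simp
      finally show ?thesis .
    qed
    then have orth: "S \<bullet> a = 0" if "a \<in> set as" for a using gamma_fixed_orthogonal that by blast
    have "S \<in> span (set as)"
      unfolding S_def using vroot root_in_span by (intro span_sum) auto
    \<comment> \<open>A vector in the span of the simple roots and orthogonal to all of them is
      zero, whereas \<rho> is positive on every summand.\<close>
    then have "orthogonal S S"
      using orth by (intro orthogonal_to_span [of S "set as" S]) (auto simp: orthogonal_def)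
    then have "S = 0" by (simp add: orthogonal_def)
    moreover have "0 < \<rho> \<bullet> S"
      unfolding S_def inner_sum_right using ij v_pos by (intro sum_pos) auto
    ultimately show False by simp
  qed
  then obtain m where m: "\<rho> \<bullet> prefix (m * length as) b < 0" by (auto simp: v_def)
  moreover have "m * length as \<noteq> 0" using m assms by (cases "m * length as") (auto simp: pos_roots_def)
  ultimately show ?thesis using that by (metis not0_implies_Suc)
qed

text \<open>The zero-based position of the letter that turns \<open>b\<close> negative, hence the
  \<open>Suc\<close>.\<close>

definition time :: "'a \<Rightarrow> nat" where
  "time b = (LEAST k. \<rho> \<bullet> prefix (Suc k) b < 0)"

lemma prefix_pos:
  assumes "b \<in> pos_roots" "k \<le> time b"
  shows "prefix k b \<in> pos_roots"
proof -
  have r: "prefix k b \<in> unit_roots W"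
    using unit_roots_image prefix_in_W pos_roots_unit assms(1) by blast
  moreover have "\<not> \<rho> \<bullet> prefix k b < 0"
  proof (cases k)
    case 0
    then show ?thesis using assms(1) by (simp add: pos_roots_def)
  next
    case (Suc j)
    then show ?thesis using not_less_Least [of j "\<lambda>k. \<rho> \<bullet> prefix (Suc k) b < 0"] assms(2)
      by (simp add: time_def)
  qed
  ultimately show ?thesis using rho_root_nonzero [OF r] by (simp add: pos_roots_def)
qed

text \<open>A simple reflection negates no positive root except its own, so the image that is about
  to become negative must be the current letter.\<close>

lemma prefix_time:
  assumes "b \<in> pos_roots"
  shows "prefix (time b) b = hd (rotate (time b) as)"
proof (rule ccontr)
  assume "\<not> ?thesis"
  then have "prefix (Suc (time b)) b \<in> pos_roots"
    using reflection_simple_pos [OF prefix_pos [OF assms order_refl] hd_rotate_in] by simp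
  moreover obtain k where "\<rho> \<bullet> prefix (Suc k) b < 0" using assms by (rule eventually_negative)
  then have "\<rho> \<bullet> prefix (Suc (time b)) b < 0"
    unfolding time_def by (rule LeastI)
  ultimately show False by (simp add: pos_roots_def)
qed

text \<open>Roots with equal times are carried to the same letter by the same injective
  prefix.\<close>

lemma inj_on_time: "inj_on time pos_roots"
  by (rule inj_onI) (metis inj_prefix injD prefix_time)

text \<open>Modulo the span of \<open>vs\<close> only the last letter acts, so the coefficient of
  \<open>v\<close> at \<open>a\<close> is twice \<open>y \<bullet> a\<close>; positivity of
  \<open>v\<close> gives the sign.\<close>

lemma last_letter_nonneg:
  assumes "set (vs @ [a]) = set as" "distinct (vs @ [a])" "v \<in> pos_roots"
    and y: "y - refl_prod (vs @ [a]) y = v"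
  shows "0 \<le> y \<bullet> a"
proof -
  have a: "a \<in> set as" "a \<notin> set vs" "set as = insert a (set vs)" using assms(1,2) by auto
  have na: "norm a = 1" using a(1) as_unit_roots norm_unit_root by auto
  obtain c where c: "v = (\<Sum>b\<in>set as. c b *\<^sub>R b)" "\<forall>b\<in>set as. 0 \<le> c b"
    using assms(3) by (rule pos_root_coefficients)
  let ?z = "reflection a y"
  have "(c a - 2 * (y \<bullet> a)) *\<^sub>R a = (?z - refl_prod vs ?z) - (\<Sum>b\<in>set vs. c b *\<^sub>R b)"
    using y c(1) a(2) by (simp add: a(3) reflection_unit [OF na] algebra_simps)
  moreover have "(?z - refl_prod vs ?z) - (\<Sum>b\<in>set vs. c b *\<^sub>R b) \<in> span (set vs)"
    by (intro span_diff diff_refl_prod_in_span span_sum span_scale span_base)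
  ultimately have in_span: "(c a - 2 * (y \<bullet> a)) *\<^sub>R a \<in> span (set vs)" by simp
  have "a \<notin> span (set vs)"
    using independent_as a by (simp add: independent_insert)
  then have "c a - 2 * (y \<bullet> a) = 0"
    using scaleR_in_span_imp_0 in_span by blast
  then show ?thesis using c(2) a(1) by auto
qed

text \<open>The ordering of the positive roots by \<^term>\<open>time\<close> makes the form \<open>E\<close> nonpositive
  below the diagonal.\<close>

lemma earlier_nonpos:
  assumes "a \<in> pos_roots" "b \<in> pos_roots" "time a < time b" and x: "x - \<gamma> x = b"
  shows "x \<bullet> a \<le> 0"
proof -
  define k where "k = time a"
  define s where "s = hd (rotate k as)"
  \<comment> \<open>Transport past \<open>s\<close> makes it the last letter of the rotated word,
    while \<open>b\<close>, being later, is still positive.\<close>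
  define y where "y = prefix (Suc k) x"
  have s: "prefix k a = s" using prefix_time [OF assms(1)] by (simp add: s_def k_def)
  have "y - refl_prod (rotate (Suc k) as) y = prefix (Suc k) b"
    unfolding y_def using prefix_gamma [of "Suc k" x] x linear_diff [OF linear_prefix [of "Suc k"]]
    by metis
  then have "y - refl_prod (tl (rotate k as) @ [s]) y = prefix (Suc k) b"
    by (simp only: rotate_split(2) s_def)
  moreover have "prefix (Suc k) b \<in> pos_roots"
    using assms by (intro prefix_pos) (auto simp: k_def)
  moreover have "set (tl (rotate k as) @ [s]) = set as" "distinct (tl (rotate k as) @ [s])"
    unfolding s_def rotate_split(2) [symmetric] using distinct_as by simp_all
  ultimately have "0 \<le> y \<bullet> s" using last_letter_nonneg by blast
  \<comment> \<open>\<open>a\<close> has become \<open>- s\<close>, which reverses the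
    inequality.\<close>
  moreover have "y \<bullet> reflection s s = x \<bullet> a"
    unfolding y_def s [symmetric] by (simp add: s s_def [symmetric]) (metis inner_prefix s)
  ultimately show ?thesis by (simp add: reflection_self)
qed

section \<open>Spans of the letters of reduced words\<close>

subsection \<open>Factorizations of the Coxeter element\<close>

text \<open>The preimage is the dual vector of the letter \<open>a\<close> in the word
  \<open>as\<close> itself. Consequently the letters of every factorization of \<gamma> span the
  simple roots.\<close>

lemma simple_in_range:
  assumes "a \<in> set as"
  obtains x where "x - \<gamma> x = a"
proof -
  obtain us vs where as: "as = us @ a # vs" using split_list [OF assms] by blast
  have "norm a = 1" using assms as_unit_roots norm_unit_root by auto
  then obtain x where "x - refl_prod (us @ a # vs) x = a"
    by (rule refl_prod_dual_vector [OF distinct_as [unfolded as] independent_as [unfolded as]]) blast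
  then show ?thesis using that unfolding \<gamma>_def as [symmetric] by blast
qed

lemma simple_in_span_factorization:
  assumes "refl_prod cs = \<gamma>"
  shows "set as \<subseteq> span (set cs)"
proof
  fix a assume "a \<in> set as"
  then obtain x where "x - \<gamma> x = a" by (rule simple_in_range)
  then show "a \<in> span (set cs)" using diff_refl_prod_in_span [of x cs] assms by simp
qed

lemma length_factorization:
  assumes "refl_prod cs = \<gamma>"
  shows "length as \<le> length cs"
proof -
  have "card (set as) \<le> card (set cs)"
    using independent_span_bound [OF _ independent_as simple_in_span_factorization [OF assms]] by auto
  then show ?thesis using distinct_card [OF distinct_as] card_length [of cs] by simp
qed

text \<open>The letters span a space of dimension \<open>length as\<close>, so a list of that length
  has neither repetitions nor linear relations.\<close>

lemma minimal_factorization: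
  assumes "refl_prod cs = \<gamma>" "length cs = length as"
  shows "distinct cs" "independent (set cs)"
proof -
  have sub: "set as \<subseteq> span (set cs)" using assms(1) by (rule simple_in_span_factorization)
  have le: "card (set as) \<le> card (set cs)"
    using independent_span_bound [OF _ independent_as sub] by auto
  then show "distinct cs"
    using assms(2) distinct_card [OF distinct_as] card_length [of cs] by (intro card_distinct) simp
  have "card (set cs) \<le> dim (span (set cs))"
  proof -
    have "card (set cs) \<le> card (set as)"
      using assms(2) distinct_card [OF distinct_as] card_length [of cs] by simp
    also have "\<dots> = dim (set as)" using independent_as by (simp add: dim_eq_card_independent)
    also have "\<dots> \<le> dim (span (set cs))" using sub by (rule dim_subset)
    finally show ?thesis .
  qed
  then show "independent (set cs)"
    using card_le_dim_spanning [of "set cs" "span (set cs)"] span_superset by auto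
qed

text \<open>A letter of a reduced prefix has a dual vector for that prefix, so it lies in the image
  of 1 - w, which the span of any other word for the same w contains.\<close>

lemma prefix_letters_in_span:
  assumes "refl_prod (bs @ ds) = \<gamma>" "length (bs @ ds) = length as" "set bs \<subseteq> unit_roots W"
    and "refl_prod bs = refl_prod bs'" "d \<in> set bs"
  shows "d \<in> span (set bs')"
proof -
  have ind: "distinct bs" "independent (set bs)"
    using minimal_factorization [OF assms(1,2)] independent_mono [of "set (bs @ ds)" "set bs"] by auto
  obtain us vs where bs: "bs = us @ d # vs" using split_list [OF assms(5)] by blast
  have "norm d = 1" using assms(3,5) norm_unit_root by auto
  then obtain x where "x - refl_prod bs x = d"
    unfolding bs by (rule refl_prod_dual_vector [OF ind [unfolded bs]]) blast
  then show ?thesis using diff_refl_prod_in_span [of x bs'] assms(4) by simp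
qed

lemma increasing_factorization_starts_minimal:
  assumes word: "refl_prod (bs @ ds) = \<gamma>" "length (bs @ ds) = length as"
    and pos: "set bs \<subseteq> pos_roots" and sorted: "sorted_wrt (\<lambda>a b. time a < time b) bs"
    and d: "d \<in> pos_roots" "d \<in> span (set bs)"
  shows "\<exists>b\<in>set bs. time b \<le> time d"
proof (rule ccontr)
  assume "\<not> ?thesis"
  then have small: "time d < time b" if "b \<in> set bs" for b using that by force
  note ind = minimal_factorization [OF word]
  obtain c where c: "d = (\<Sum>b\<in>set bs. c b *\<^sub>R b)"
    using d(2) by (auto simp: span_finite)
  \<comment> \<open>Pair the expansion of \<open>d\<close> with the dual vector of \<open>b\<close>.
    Letters after \<open>b\<close> drop out, letters before \<open>b\<close> contribute nonnegative
    terms by induction, and the total is nonpositive; so the term at \<open>b\<close> is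
    nonpositive.\<close>
  have c_neg: "c b \<le> 0" if "b \<in> set bs" for b
    using that
  proof (induction "time b" arbitrary: b rule: less_induct)
    case less
    obtain us vs where bs: "bs = us @ b # vs" using split_list [OF less.prems] by blast
    have bW: "b \<in> pos_roots" using less.prems pos by auto
    then have "norm b = 1" using pos_roots_unit norm_unit_root by auto
    then obtain x where x: "x - refl_prod (us @ b # (vs @ ds)) x = b" "x \<bullet> b = 1 / 2"
      "\<And>v. v \<in> set (vs @ ds) \<Longrightarrow> x \<bullet> v = 0"
      using refl_prod_dual_vector [of us b "vs @ ds"] ind unfolding bs by (metis append_Cons append_assoc)
    have "refl_prod (us @ b # (vs @ ds)) = \<gamma>" using word(1) by (simp add: bs comp_assoc)
    then have x\<gamma>: "x - \<gamma> x = b" using x(1) by simp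
    have "0 \<le> c v * (x \<bullet> v)" if "v \<in> set bs - {b}" for v
    proof (cases "v \<in> set vs")
      case True
      then show ?thesis using x(3) by simp
    next
      case False
      then have "v \<in> set us" using that bs by auto
      then have "time v < time b" using sorted by (auto simp: bs sorted_wrt_append)
      moreover from this have "c v \<le> 0" using less.hyps that by blast
      ultimately show ?thesis
        using earlier_nonpos [OF _ bW _ x\<gamma>, of v] that pos by (auto intro: mult_nonpos_nonpos)
    qed
    then have "0 \<le> (\<Sum>v\<in>set bs - {b}. c v * (x \<bullet> v))" by (rule sum_nonneg)
    moreover have "x \<bullet> d = c b * (x \<bullet> b) + (\<Sum>v\<in>set bs - {b}. c v * (x \<bullet> v))"
      unfolding c inner_sum_right inner_scaleR_right using less.prems by (intro sum.remove) auto
    moreover have "x \<bullet> d \<le> 0"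
      using earlier_nonpos [OF d(1) bW small [OF less.prems] x\<gamma>] .
    ultimately show ?case using x(2) by simp
  qed
  have "\<rho> \<bullet> d = (\<Sum>b\<in>set bs. c b * (\<rho> \<bullet> b))"
    by (simp add: c inner_sum_right)
  also have "\<dots> \<le> 0"
  proof (rule sum_nonpos)
    fix b assume "b \<in> set bs"
    then show "c b * (\<rho> \<bullet> b) \<le> 0"
      using c_neg [of b] pos by (intro mult_nonpos_nonneg) (auto simp: pos_roots_def)
  qed
  finally show False using d(1) by (simp add: pos_roots_def)
qed

end

context coxeter_word
begin

section \<open>Reflection length, left division and lower intervals\<close>

section \<open>The absolute order\<close>

abbreviation ginv :: "('a \<Rightarrow> 'a) \<Rightarrow> 'a \<Rightarrow> 'a" where "ginv \<equiv> inv_into UNIV"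
abbreviation rl :: "('a \<Rightarrow> 'a) \<Rightarrow> nat" where "rl \<equiv> reflection_length W"
abbreviation le :: "('a \<Rightarrow> 'a) \<Rightarrow> ('a \<Rightarrow> 'a) \<Rightarrow> bool" where "le \<equiv> absolute_le W"
abbreviation less :: "('a \<Rightarrow> 'a) \<Rightarrow> ('a \<Rightarrow> 'a) \<Rightarrow> bool" where "less \<equiv> absolute_less W"
abbreviation L :: "('a \<Rightarrow> 'a) set" where "L \<equiv> nc_lattice W \<gamma>"

lemma ginv_refl_prod: "ginv (refl_prod bs) = refl_prod (rev bs)"
  by (rule inv_unique_comp) (simp_all add: fun_eq_iff refl_prod_rev)

lemma id_in_W [simp]: "id \<in> W"
  using refl_prod_in_W [of "[]"] by simp

lemma comp_in_W [simp]: "u \<in> W \<Longrightarrow> v \<in> W \<Longrightarrow> u \<circ> v \<in> W"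
proof -
  assume "u \<in> W" "v \<in> W"
  then obtain bs cs where "set bs \<subseteq> unit_roots W" "u = refl_prod bs"
    "set cs \<subseteq> unit_roots W" "v = refl_prod cs" by (metis WE)
  then show ?thesis using refl_prod_in_W [of "bs @ cs"] by simp
qed

lemma ginv_in_W [simp]: "u \<in> W \<Longrightarrow> ginv u \<in> W"
proof -
  assume "u \<in> W"
  then obtain bs where "set bs \<subseteq> unit_roots W" "u = refl_prod bs" by (rule WE)
  then show ?thesis using refl_prod_in_W [of "rev bs"] by (simp add: ginv_refl_prod)
qed

lemma ginv_comp: "u \<in> W \<Longrightarrow> ginv u \<circ> u = id" "u \<in> W \<Longrightarrow> u \<circ> ginv u = id"
  by (auto elim!: WE simp: ginv_refl_prod fun_eq_iff refl_prod_rev)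

lemma ginv_cancel [simp]:
  assumes "u \<in> W"
  shows "ginv u \<circ> (u \<circ> f) = f" "u \<circ> (ginv u \<circ> f) = f"
  using ginv_comp [OF assms] by (metis comp_assoc id_comp)+

lemma ginv_ginv [simp]: "u \<in> W \<Longrightarrow> ginv (ginv u) = u"
  by (auto elim!: WE simp: ginv_refl_prod)

lemma ginv_of_comp: "u \<in> W \<Longrightarrow> v \<in> W \<Longrightarrow> ginv (u \<circ> v) = ginv v \<circ> ginv u"
  by (rule inv_unique_comp) (simp_all add: comp_assoc ginv_comp)

lemma ginv_reflection [simp]: "ginv (reflection b) = reflection b"
  by (rule inv_unique_comp) simp_all

lemma reflectionsE_pos:
  assumes "t \<in> reflections W"
  obtains b where "b \<in> pos_roots" "t = reflection b"
proof -
  obtain b where b: "b \<in> unit_roots W" "t = reflection b" using assms by (rule reflectionsE)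
  have m: "- b \<in> unit_roots W" using b(1) by (simp add: unit_roots_def)
  show ?thesis
  proof (cases "\<rho> \<bullet> b > 0")
    case True
    then show ?thesis using that b by (simp add: pos_roots_def)
  next
    case False
    then have "- b \<in> pos_roots" using rho_root_nonzero [OF b(1)] m by (simp add: pos_roots_def)
    then show ?thesis using that [of "- b"] b(2) by simp
  qed
qed

lemma reflection_pos_inj:
  assumes "a \<in> pos_roots" "b \<in> pos_roots" "reflection a = reflection b"
  shows "a = b"
proof -
  have "a = b \<or> a = - b"
    using assms pos_roots_unit norm_unit_root by (intro reflection_eq_unitD) auto
  then show ?thesis using assms(1,2) by (auto simp: pos_roots_def)
qed

lemma rl_le: "set bs \<subseteq> unit_roots W \<Longrightarrow> rl (refl_prod bs) \<le> length bs"
  unfolding reflection_length_def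
  by (rule Least_le) (use reflection_in_reflections in \<open>fastforce intro!: exI [of _ "map reflection bs"]\<close>)

lemma reduced_word:
  assumes "w \<in> W"
  obtains bs where "set bs \<subseteq> pos_roots" "length bs = rl w" "w = refl_prod bs"
proof -
  have "\<exists>k ts. length ts = k \<and> set ts \<subseteq> reflections W \<and> w = compose_list ts"
    using assms W_eq by auto
  then have "\<exists>ts. length ts = rl w \<and> set ts \<subseteq> reflections W \<and> w = compose_list ts"
    unfolding reflection_length_def by (rule LeastI_ex)
  then obtain ts where ts: "length ts = rl w" "set ts \<subseteq> reflections W" "w = compose_list ts" by blast
  have "\<exists>bs. set bs \<subseteq> pos_roots \<and> ts = map reflection bs"
    using ts(2)
  proof (induction ts)
    case (Cons t ts)
    then obtain bs where "set bs \<subseteq> pos_roots" "ts = map reflection bs" by auto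
    moreover obtain b where "b \<in> pos_roots" "t = reflection b" using Cons.prems reflectionsE_pos by auto
    ultimately show ?case by (intro exI [of _ "b # bs"]) auto
  qed simp
  with ts that show ?thesis by (metis length_map)
qed

lemma rl_comp_le:
  assumes "u \<in> W" "v \<in> W"
  shows "rl (u \<circ> v) \<le> rl u + rl v"
proof -
  obtain bs where bs: "set bs \<subseteq> pos_roots" "length bs = rl u" "u = refl_prod bs"
    using assms(1) by (rule reduced_word)
  obtain cs where cs: "set cs \<subseteq> pos_roots" "length cs = rl v" "v = refl_prod cs"
    using assms(2) by (rule reduced_word)
  show ?thesis using rl_le [of "bs @ cs"] bs cs pos_roots_unit by auto
qed

lemma refl_prod_conj:
  assumes "g \<in> W"
  shows "refl_prod (map g bs) = g \<circ> refl_prod bs \<circ> ginv g"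
proof (induction bs)
  case Nil
  then show ?case using assms by (simp add: ginv_comp)
next
  case (Cons b bs)
  obtain cs where cs: "g = refl_prod cs" using assms by (rule WE)
  have g: "reflection (g b) (g x) = g (reflection b x)" for x
    unfolding cs by (rule reflection_image) (simp_all add: linear_refl_prod)
  have IH: "refl_prod (map g bs) x = g (refl_prod bs (ginv g x))" for x
    using Cons by (simp only: comp_apply)
  show ?case
    by (rule ext) (simp only: list.map compose_list_Cons comp_apply IH g)
qed

text \<open>Conjugation permutes the reflections, so it cannot lengthen a word; conjugating back
  gives equality.\<close>

lemma rl_conj:
  assumes "g \<in> W" "w \<in> W"
  shows "rl (g \<circ> w \<circ> ginv g) = rl w"
proof -
  have *: "rl (h \<circ> v \<circ> ginv h) \<le> rl v" if h: "h \<in> W" and v: "v \<in> W" for h v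
  proof -
    obtain bs where bs: "set bs \<subseteq> pos_roots" "length bs = rl v" "v = refl_prod bs"
      using v by (rule reduced_word)
    have "set (map h bs) \<subseteq> unit_roots W" using bs(1) pos_roots_unit unit_roots_image [OF h] by auto
    then show ?thesis using rl_le [of "map h bs"] bs refl_prod_conj [OF h] by simp
  qed
  have "ginv g \<circ> (g \<circ> w \<circ> ginv g) \<circ> ginv (ginv g) = w"
    using assms by (simp add: comp_assoc ginv_comp)
  then show ?thesis using * [OF assms] * [of "ginv g" "g \<circ> w \<circ> ginv g"] assms by simp
qed

lemma rl_eq_0_iff: "w \<in> W \<Longrightarrow> rl w = 0 \<longleftrightarrow> w = id"
proof
  assume "w \<in> W" "rl w = 0"
  then show "w = id" using reduced_word [of w] by (metis compose_list_Nil length_0_conv list.map_disc_iff)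
qed (use rl_le [of "[]"] in simp)

lemma rl_id [simp]: "rl id = 0"
  using rl_le [of "[]"] by simp

lemma rl_reflection:
  assumes "b \<in> unit_roots W"
  shows "rl (reflection b) = 1"
proof -
  have "b \<noteq> - b"
  proof
    assume "b = - b"
    then have "2 *\<^sub>R b = 0" by (metis add.right_inverse scaleR_2)
    then show False using norm_unit_root [OF assms] by simp
  qed
  then have "reflection b \<noteq> id" using reflection_self [of b] by (metis id_apply)
  then have "rl (reflection b) \<noteq> 0" using rl_eq_0_iff reflection_in_W [OF assms] by simp
  moreover have "rl (reflection b) \<le> 1" using rl_le [of "[b]"] assms by simp
  ultimately show ?thesis by linarith
qed

lemma rl_1E:
  assumes "w \<in> W" "rl w = 1"
  obtains b where "b \<in> pos_roots" "w = reflection b"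
proof -
  obtain bs where bs: "set bs \<subseteq> pos_roots" "length bs = rl w" "w = refl_prod bs"
    using assms(1) by (rule reduced_word)
  then obtain b where "bs = [b]" using assms(2) by (auto simp: length_Suc_conv)
  then show ?thesis using that bs by simp
qed

lemma gamma_in_W [simp]: "\<gamma> \<in> W"
  unfolding \<gamma>_def using as_unit_roots by (rule refl_prod_in_W)

lemma rl_gamma: "rl \<gamma> = length as"
proof (rule antisym)
  show "rl \<gamma> \<le> length as" unfolding \<gamma>_def using as_unit_roots by (rule rl_le)
  obtain bs where "length bs = rl \<gamma>" "\<gamma> = refl_prod bs"
    using reduced_word [OF gamma_in_W] by metis
  then show "length as \<le> rl \<gamma>" using length_factorization [of bs] by simp
qed

lemma le_in_W: "le u w \<Longrightarrow> u \<in> W" "le u w \<Longrightarrow> w \<in> W"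
  by (auto simp: absolute_le_def)

lemma le_rl: "le u w \<Longrightarrow> rl u + rl (ginv u \<circ> w) = rl w"
  by (simp add: absolute_le_def)

lemma rl_split_le: "u \<in> W \<Longrightarrow> w \<in> W \<Longrightarrow> rl w \<le> rl u + rl (ginv u \<circ> w)"
  using rl_comp_le [of u "ginv u \<circ> w"] by simp

lemma leI: "u \<in> W \<Longrightarrow> w \<in> W \<Longrightarrow> rl u + rl (ginv u \<circ> w) \<le> rl w \<Longrightarrow> le u w"
  using rl_split_le [of u w] by (simp add: absolute_le_def)

lemma le_refl: "u \<in> W \<Longrightarrow> le u u"
  by (simp add: absolute_le_def ginv_comp)

lemma id_le: "u \<in> W \<Longrightarrow> le id u"
  by (simp add: absolute_le_def)

lemma le_trans:
  assumes "le u v" "le v w"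
  shows "le u w"
proof (rule leI)
  have W: "u \<in> W" "v \<in> W" "w \<in> W" using assms le_in_W by auto
  then show "u \<in> W" "w \<in> W" by auto
  have "ginv u \<circ> w = (ginv u \<circ> v) \<circ> (ginv v \<circ> w)" using W by (simp add: comp_assoc)
  then have "rl (ginv u \<circ> w) \<le> rl (ginv u \<circ> v) + rl (ginv v \<circ> w)"
    using W rl_comp_le [of "ginv u \<circ> v" "ginv v \<circ> w"] by simp
  then show "rl u + rl (ginv u \<circ> w) \<le> rl w"
    using le_rl [OF assms(1)] le_rl [OF assms(2)] by simp
qed

lemma quotient_comp:
  assumes "u \<in> W" "v \<in> W" "w \<in> W"
  shows "ginv (ginv u \<circ> v) \<circ> (ginv u \<circ> w) = ginv v \<circ> w"
  using assms by (simp add: ginv_of_comp comp_assoc)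

text \<open>Left division by \<open>u\<close> moves chains above \<open>u\<close> to chains above
  the identity; this is what makes deletion of the vertex e a face map.\<close>

lemma le_quotient:
  assumes "le u v" "le v w"
  shows "le (ginv u \<circ> v) (ginv u \<circ> w)"
proof (rule leI)
  have W: "u \<in> W" "v \<in> W" "w \<in> W" using assms le_in_W by auto
  then show "ginv u \<circ> v \<in> W" "ginv u \<circ> w \<in> W" by auto
  show "rl (ginv u \<circ> v) + rl (ginv (ginv u \<circ> v) \<circ> (ginv u \<circ> w)) \<le> rl (ginv u \<circ> w)"
    using le_rl [OF assms(1)] le_rl [OF assms(2)] le_rl [OF le_trans [OF assms]]
    unfolding quotient_comp [OF W] by simp
qed

text \<open>The remaining right factor is the conjugate of \<open>u\<close> by the inverse of
  \<open>w\<close>, which has the same length as \<open>u\<close>.\<close>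

lemma le_complement:
  assumes "le u w"
  shows "le (ginv u \<circ> w) w"
proof (rule leI)
  have W: "u \<in> W" "w \<in> W" using assms le_in_W by auto
  then show "ginv u \<circ> w \<in> W" "w \<in> W" by auto
  have "ginv (ginv u \<circ> w) \<circ> w = ginv w \<circ> u \<circ> ginv (ginv w)"
    using W by (simp add: ginv_of_comp)
  then have "rl (ginv (ginv u \<circ> w) \<circ> w) = rl u"
    using rl_conj [of "ginv w" u] W by simp
  then show "rl (ginv u \<circ> w) + rl (ginv (ginv u \<circ> w) \<circ> w) \<le> rl w"
    using le_rl [OF assms] by simp
qed

lemma quotient_eq_id: "u \<in> W \<Longrightarrow> ginv u \<circ> w = id \<longleftrightarrow> w = u"
  by (metis comp_id ginv_cancel(2) ginv_comp(1))

lemma less_rl: "less u w \<Longrightarrow> rl u < rl w"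
  using le_rl [of u w] le_in_W [of u w] rl_eq_0_iff [of "ginv u \<circ> w"] quotient_eq_id [of u w]
  by (cases "rl (ginv u \<circ> w) = 0") (auto simp: absolute_less_def)

lemma less_iff: "less u w \<longleftrightarrow> le u w \<and> rl u < rl w"
  using less_rl by (auto simp: absolute_less_def)

lemma less_trans: "less u v \<Longrightarrow> less v w \<Longrightarrow> less u w"
  unfolding less_iff using le_trans by fastforce

lemma less_quotient: "less u v \<Longrightarrow> less v w \<Longrightarrow> less (ginv u \<circ> v) (ginv u \<circ> w)"
  unfolding less_iff using le_quotient [of u v w] le_rl [of u v] le_rl [of u w] le_trans [of u v w] by auto

lemma in_L_iff: "w \<in> L \<longleftrightarrow> le w \<gamma>"
  using id_le le_in_W by (auto simp: nc_lattice_def)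

lemma L_down: "le u w \<Longrightarrow> w \<in> L \<Longrightarrow> u \<in> L"
  using le_trans in_L_iff by blast

lemma L_in_W: "w \<in> L \<Longrightarrow> w \<in> W"
  using in_L_iff le_in_W by blast

lemma quotient_in_L: "le u w \<Longrightarrow> w \<in> L \<Longrightarrow> ginv u \<circ> w \<in> L"
  using le_complement L_down by blast

section \<open>Increasing words and the two descent conditions\<close>

section \<open>The labelling of the non-crossing partition lattice\<close>

text \<open>A letter can be moved to the front at the cost of conjugating the letters before it,
  which preserves the length of their product.\<close>

lemma letter_le:
  assumes "set bs \<subseteq> unit_roots W" "b \<in> set bs" "rl (refl_prod bs) = length bs"
  shows "le (reflection b) (refl_prod bs)"
proof -
  obtain us vs where bs: "bs = us @ b # vs" using split_list [OF assms(2)] by blast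
  have bW: "b \<in> unit_roots W" and sub: "set us \<subseteq> unit_roots W" "set vs \<subseteq> unit_roots W"
    using assms(1) by (auto simp: bs)
  have W: "refl_prod us \<in> W" "refl_prod vs \<in> W" "reflection b \<in> W" "refl_prod bs \<in> W"
    using sub bW assms(1) refl_prod_in_W reflection_in_W by blast+
  have "reflection b \<circ> refl_prod bs
      = (reflection b \<circ> refl_prod us \<circ> ginv (reflection b)) \<circ> refl_prod vs"
    by (simp add: bs comp_assoc)
  then have "rl (reflection b \<circ> refl_prod bs) \<le> rl (refl_prod us) + rl (refl_prod vs)"
    using rl_comp_le [of "reflection b \<circ> refl_prod us \<circ> ginv (reflection b)" "refl_prod vs"] W
      rl_conj [of "reflection b" "refl_prod us"] by simp
  then have "rl (reflection b \<circ> refl_prod bs) \<le> length us + length vs"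
    using rl_le [OF sub(1)] rl_le [OF sub(2)] by linarith
  then show ?thesis
    using W rl_reflection [OF bW] assms(3) by (intro leI) (auto simp: bs)
qed

text \<open>One \<open>ds\<close> serves all reduced words of \<open>z\<close>, so different words
  can be compared inside minimal factorizations of \<gamma>.\<close>

lemma complete_word:
  assumes "z \<in> L"
  obtains ds where "set ds \<subseteq> pos_roots"
    "\<And>bs. refl_prod bs = z \<Longrightarrow> refl_prod (bs @ ds) = \<gamma>"
    "\<And>bs. length bs = rl z \<Longrightarrow> length (bs @ ds) = length as"
proof -
  have z: "le z \<gamma>" "z \<in> W" using assms in_L_iff L_in_W by auto
  obtain ds where ds: "set ds \<subseteq> pos_roots" "length ds = rl (ginv z \<circ> \<gamma>)" "ginv z \<circ> \<gamma> = refl_prod ds"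
    using reduced_word [of "ginv z \<circ> \<gamma>"] z by auto
  have "refl_prod (bs @ ds) = \<gamma>" if "refl_prod bs = z" for bs
    using that ds(3) [symmetric] z(2) by simp
  moreover have "length (bs @ ds) = length as" if "length bs = rl z" for bs
    using that ds(2) le_rl [OF z(1)] rl_gamma by simp
  ultimately show ?thesis using that ds(1) by blast
qed

lemma remove_first:
  assumes "z \<in> L" "b \<in> pos_roots" "le (reflection b) z"
  shows "reflection b \<circ> z \<in> L" "rl z = Suc (rl (reflection b \<circ> z))"
    "le (reflection b \<circ> z) z" "reflection b \<circ> (reflection b \<circ> z) = z"
proof -
  have b: "b \<in> unit_roots W" using assms(2) pos_roots_unit by auto
  show "le (reflection b \<circ> z) z" using le_complement [OF assms(3)] by simp
  then show "reflection b \<circ> z \<in> L" using assms(1) L_down by blast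
  show "rl z = Suc (rl (reflection b \<circ> z))"
    using le_rl [OF assms(3)] rl_reflection [OF b] by simp
  show "reflection b \<circ> (reflection b \<circ> z) = z" by (simp add: fun_eq_iff)
qed

text \<open>Greedy choice: split off the earliest reflection below \<open>z\<close>. The letters of
  the quotient are again below \<open>z\<close>, so none is earlier, and minimality of the completed
  word excludes a repetition.\<close>

lemma increasing_word:
  assumes "z \<in> L"
  obtains bs where "set bs \<subseteq> pos_roots" "refl_prod bs = z" "length bs = rl z"
    "sorted_wrt (\<lambda>a b. time a < time b) bs"
proof -
  have "\<exists>bs. set bs \<subseteq> pos_roots \<and> refl_prod bs = z \<and> length bs = rl z \<and>
      sorted_wrt (\<lambda>a b. time a < time b) bs"
    using assms
  proof (induction "rl z" arbitrary: z)
    case 0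
    then have "refl_prod [] = z" using rl_eq_0_iff L_in_W by (metis compose_list_Nil list.map(1))
    then show ?case using 0 by (intro exI [of _ "[]"]) simp
  next
    case (Suc k)
    define A where "A = {b \<in> pos_roots. le (reflection b) z}"
    obtain cs where cs: "set cs \<subseteq> pos_roots" "length cs = rl z" "z = refl_prod cs"
      using reduced_word [of z] L_in_W [OF Suc.prems] by metis
    then obtain c where "c \<in> set cs" using Suc.hyps(2) by (cases cs) auto
    then have "c \<in> A" using letter_le [of cs c] cs pos_roots_unit by (auto simp: A_def)
    then obtain b where b: "b \<in> A" and min: "\<And>c. c \<in> A \<Longrightarrow> time b \<le> time c"
      using arg_min_nat_lemma [of "\<lambda>x. x \<in> A" c time] by metis
    have bp: "b \<in> pos_roots" "le (reflection b) z" using b by (auto simp: A_def)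
    note rf = remove_first [OF Suc.prems bp]
    obtain bs where bs: "set bs \<subseteq> pos_roots" "refl_prod bs = reflection b \<circ> z"
      "length bs = rl (reflection b \<circ> z)" "sorted_wrt (\<lambda>a b. time a < time b) bs"
      using Suc.hyps(1) [of "reflection b \<circ> z"] Suc.hyps(2) rf(1,2) by auto
    have word: "refl_prod (b # bs) = z" "length (b # bs) = rl z"
      using bs(2,3) rf(2,4) by simp_all
    obtain ds where ds: "refl_prod ((b # bs) @ ds) = \<gamma>" "length ((b # bs) @ ds) = length as"
      using complete_word [OF Suc.prems] word by metis
    have "time b < time c" if c: "c \<in> set bs" for c
    proof -
      have cp: "c \<in> pos_roots" using c bs(1) by auto
      have "le (reflection c) (refl_prod bs)"
        using bs pos_roots_unit c by (intro letter_le) auto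
      then have "le (reflection c) z" using le_trans [OF _ rf(3)] bs(2) by simp
      then have "time b \<le> time c" using min cp by (simp add: A_def)
      moreover have "b \<noteq> c" using minimal_factorization(1) [OF ds] c by auto
      then have "time b \<noteq> time c" using inj_on_time bp(1) cp by (auto dest: inj_onD)
      ultimately show ?thesis by simp
    qed
    then show ?case using word bs bp(1) by (intro exI [of _ "b # bs"]) simp
  qed
  then show ?thesis using that by blast
qed

text \<open>If all letters of an increasing word for the quotient were later than \<open>a\<close>,
  putting \<open>a\<close> in front would give an increasing word for \<open>v\<close>. All its
  letters would be later than \<open>d\<close>, although \<open>d\<close> lies in their
  span.\<close>

lemma earlier_letter_exists:
  assumes v: "v \<in> L" and ap: "a \<in> pos_roots" "le (reflection a) v"
    and dp: "d \<in> pos_roots" "le (reflection d) v" and "time d < time a"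
  obtains b where "b \<in> pos_roots" "time b < time a" "le (reflection b) (reflection a \<circ> v)"
proof -
  note ra = remove_first [OF v ap] and rd = remove_first [OF v dp]
  obtain bs where bs: "set bs \<subseteq> pos_roots" "refl_prod bs = reflection a \<circ> v"
    "length bs = rl (reflection a \<circ> v)" "sorted_wrt (\<lambda>a b. time a < time b) bs"
    using ra(1) by (rule increasing_word)
  have word: "refl_prod (a # bs) = v" "length (a # bs) = rl v"
    using bs(2,3) ra(2,4) by simp_all
  obtain ds where ds: "\<And>bs. refl_prod bs = v \<Longrightarrow> refl_prod (bs @ ds) = \<gamma>"
    "\<And>bs. length bs = rl v \<Longrightarrow> length (bs @ ds) = length as"
    using complete_word [OF v] by metis
  have "\<exists>b\<in>set bs. \<not> time a < time b"
  proof (rule ccontr)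
    assume "\<not> ?thesis"
    then have sorted: "sorted_wrt (\<lambda>a b. time a < time b) (a # bs)" using bs(4) by simp
    \<comment> \<open>A reduced word for \<open>v\<close> that begins with \<open>d\<close> places
      \<open>d\<close> in the span of \<open>a # bs\<close>.\<close>
    obtain cs where cs: "set cs \<subseteq> pos_roots" "refl_prod cs = reflection d \<circ> v"
      "length cs = rl (reflection d \<circ> v)"
      using rd(1) by (rule increasing_word)
    have dcs: "refl_prod (d # cs) = v" "length (d # cs) = rl v" using cs(2,3) rd(2,4) by simp_all
    have "d \<in> span (set (a # bs))"
    proof (rule prefix_letters_in_span [OF ds(1) [OF dcs(1)] ds(2) [OF dcs(2)]])
      show "refl_prod (d # cs) = refl_prod (a # bs)" using dcs(1) word(1) by (rule trans [OF _ sym])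
      show "set (d # cs) \<subseteq> unit_roots W" using cs(1) dp(1) pos_roots_unit by auto
    qed simp
    moreover have "set (a # bs) \<subseteq> pos_roots" using bs(1) ap(1) by simp
    ultimately have "\<exists>b\<in>set (a # bs). time b \<le> time d"
      using increasing_factorization_starts_minimal [OF ds(1) [OF word(1)] ds(2) [OF word(2)]]
        sorted dp(1) by blast
    then show False using sorted \<open>time d < time a\<close> by auto
  qed
  then obtain b where b: "b \<in> set bs" "\<not> time a < time b" by blast
  have "distinct ((a # bs) @ ds)"
    using ds word by (intro minimal_factorization(1)) blast+
  then have "b \<noteq> a" using b(1) by auto
  have bp: "b \<in> pos_roots" using b(1) bs(1) by auto
  have "time a \<noteq> time b" using \<open>b \<noteq> a\<close> inj_on_time bp ap(1) by (auto dest: inj_onD)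
  moreover have "le (reflection b) (reflection a \<circ> v)"
    using letter_le [of bs b] bs b(1) pos_roots_unit by auto
  ultimately show ?thesis using that [of b] bp b(2) by linarith
qed

text \<open>Meaningful when the quotient is a reflection; the poset conditions constrain it on
  covering pairs, and elsewhere the value is arbitrary.\<close>

definition lab :: "('a \<Rightarrow> 'a) \<Rightarrow> ('a \<Rightarrow> 'a) \<Rightarrow> nat" where
  "lab u a = time (THE b. b \<in> pos_roots \<and> reflection b = ginv u \<circ> a)"

lemma lab_eq: "b \<in> pos_roots \<Longrightarrow> ginv u \<circ> a = reflection b \<Longrightarrow> lab u a = time b"
  unfolding lab_def
  by (rule arg_cong [where f = time], rule the_equality) (auto intro: reflection_pos_inj)

lemma coverE:
  assumes "less u a" "rl a = Suc (rl u)"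
  obtains b where "b \<in> pos_roots" "ginv u \<circ> a = reflection b" "a = u \<circ> reflection b" "lab u a = time b"
proof -
  have le: "le u a" using assms(1) by (simp add: absolute_less_def)
  then have W: "u \<in> W" "a \<in> W" using le_in_W by auto
  have "rl (ginv u \<circ> a) = 1" using le_rl [OF le] assms(2) by simp
  then obtain b where b: "b \<in> pos_roots" "ginv u \<circ> a = reflection b"
    using rl_1E [of "ginv u \<circ> a"] W by auto
  have "a = u \<circ> reflection b" using W by (simp flip: b(2))
  then show ?thesis using that b lab_eq by blast
qed

lemma coverI:
  assumes "u \<in> W" "b \<in> pos_roots" "rl (u \<circ> reflection b) = Suc (rl u)"
  shows "less u (u \<circ> reflection b)" "lab u (u \<circ> reflection b) = time b"
proof -
  have b: "b \<in> unit_roots W" "reflection b \<in> W"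
    using assms(2) pos_roots_unit reflection_in_W by auto
  show "less u (u \<circ> reflection b)"
    unfolding less_iff using assms b rl_reflection [OF b(1)] by (auto intro!: leI)
  show "lab u (u \<circ> reflection b) = time b"
    using assms(1,2) by (intro lab_eq) simp_all
qed

sublocale nc: atom_ordered_poset L less rl lab
proof
  show "less x z" if "less x y" "less y z" for x y z
    using that by (rule less_trans)
  show "rl x < rl y" if "less x y" for x y
    using that by (rule less_rl)
next
  fix u a b
  assume a: "less u a" "rl a = Suc (rl u)" and b: "less u b" "rl b = Suc (rl u)"
    and eq: "lab u a = lab u b"
  from a obtain c where c: "c \<in> pos_roots" "a = u \<circ> reflection c" "lab u a = time c"
    by (rule coverE)
  from b obtain d where d: "d \<in> pos_roots" "b = u \<circ> reflection d" "lab u b = time d"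
    by (rule coverE)
  have "c = d" using inj_on_time c(1,3) d(1,3) eq by (auto dest: inj_onD)
  then show "a = b" using c(2) d(2) by simp
next
  fix u a x
  assume L: "u \<in> L" "a \<in> L" "x \<in> L" and a: "less u a" "rl a = Suc (rl u)"
    and x: "less a x" "rl x = Suc (rl a)" and lab: "lab a x < lab u a"
  from a obtain c where c: "c \<in> pos_roots" "a = u \<circ> reflection c" "lab u a = time c"
    by (rule coverE)
  from x obtain d where d: "d \<in> pos_roots" "x = a \<circ> reflection d" "lab a x = time d"
    by (rule coverE)
  have W: "u \<in> W" "reflection c \<in> W" "reflection d \<in> W"
    using L L_in_W c(1) d(1) pos_roots_unit reflection_in_W by auto
  \<comment> \<open>Exchange the two reflections: after going from \<open>u\<close> by the second
    one, a conjugate of the first leads on to \<open>x\<close>, and the smaller label now comes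
    first.\<close>
  define b where "b = u \<circ> reflection d"
  have bW: "b \<in> W" using W by (simp add: b_def)
  have bx: "ginv b \<circ> x = reflection d \<circ> reflection c \<circ> ginv (reflection d)"
    using W by (simp add: b_def c(2) d(2) ginv_of_comp comp_assoc)
  then have rl_bx: "rl (ginv b \<circ> x) = 1"
    using rl_conj [of "reflection d" "reflection c"] W rl_reflection [of c] c(1) pos_roots_unit by auto
  have "rl b \<le> Suc (rl u)"
    using rl_comp_le [of u "reflection d"] W rl_reflection [of d] d(1) pos_roots_unit
    by (auto simp: b_def)
  moreover have "rl x \<le> rl b + 1" using rl_split_le [of b x] bW L(3) L_in_W rl_bx by simp
  ultimately have rlb: "rl b = Suc (rl u)" using a(2) x(2) by linarith
  then have ub: "less u b" "lab u b = time d"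
    using coverI [of u d] W(1) d(1) by (simp_all add: b_def)
  have "less b x"
    unfolding less_iff using bW L(3) L_in_W rl_bx rlb a(2) x(2) by (auto intro!: leI)
  moreover from this have "b \<in> L" using L(3) L_down by (auto simp: less_iff)
  ultimately show "\<exists>b\<in>L. less u b \<and> rl b = Suc (rl u) \<and> less b x \<and> lab u b < lab u a"
    using ub rlb lab c(3) d(3) by (intro bexI [of _ b]) simp_all
next
  fix u a b y
  assume L: "u \<in> L" "a \<in> L" "b \<in> L" "y \<in> L" and a: "less u a" "rl a = Suc (rl u)"
    and b: "less u b" "rl b = Suc (rl u)" and y: "less a y" "less b y"
    and lab: "lab u b < lab u a"
  from a obtain c where c: "c \<in> pos_roots" "ginv u \<circ> a = reflection c" "a = u \<circ> reflection c"
    "lab u a = time c" by (rule coverE)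
  from b obtain d where d: "d \<in> pos_roots" "ginv u \<circ> b = reflection d" "lab u b = time d"
    by (rule coverE)
  have W: "u \<in> W" "a \<in> W" "y \<in> W" using L L_in_W by auto
  have le: "le u a" "le a y" "le u b" "le b y" "le u y"
    using a b y less_trans [of u a y] by (auto simp: absolute_less_def)
  \<comment> \<open>Dividing by \<open>u\<close> reduces the claim to reflections below one element
    of the lattice.\<close>
  have v: "ginv u \<circ> y \<in> L" using quotient_in_L [OF le(5) L(4)] .
  have lec: "le (reflection c) (ginv u \<circ> y)" and led: "le (reflection d) (ginv u \<circ> y)"
    using le_quotient [OF le(1,2)] le_quotient [OF le(3,4)] c(2) d(2) by simp_all
  obtain e where e: "e \<in> pos_roots" "time e < time c" "le (reflection e) (reflection c \<circ> (ginv u \<circ> y))"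
    using earlier_letter_exists [OF v c(1) lec d(1) led] lab c(4) d(3) by auto
  have cW: "reflection c \<in> W" "reflection e \<in> W"
    using c(1) e(1) pos_roots_unit reflection_in_W by auto
  have "reflection c \<circ> (ginv u \<circ> y) = ginv a \<circ> y"
    using W cW by (simp add: c(3) ginv_of_comp comp_assoc)
  then have lee: "le (reflection e) (ginv a \<circ> y)" using e(3) by simp
  \<comment> \<open>Multiplying back by \<open>a\<close> turns the earlier reflection
    \<open>e\<close> into a cover of \<open>a\<close> that stays below \<open>y\<close>.\<close>
  define x where "x = a \<circ> reflection e"
  have xW: "x \<in> W" using W cW by (simp add: x_def)
  have e1: "rl (reflection e) = 1" using rl_reflection e(1) pos_roots_unit by auto
  have "ginv x \<circ> y = reflection e \<circ> (ginv a \<circ> y)"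
    using W cW by (simp add: x_def ginv_of_comp comp_assoc)
  then have q: "Suc (rl (ginv x \<circ> y)) = rl (ginv a \<circ> y)"
    using le_rl [OF lee] e1 by simp
  have "rl x \<le> Suc (rl a)" using rl_comp_le [of a "reflection e"] W cW e1 by (simp add: x_def)
  moreover have "rl y \<le> rl x + rl (ginv x \<circ> y)" using rl_split_le xW W by blast
  ultimately have rlx: "rl x = Suc (rl a)" using q le_rl [OF le(2)] by linarith
  have "le x y" using xW W q le_rl [OF le(2)] rlx by (intro leI) auto
  then have "x \<in> L" "x = y \<or> less x y" using L(4) L_down by (auto simp: absolute_less_def)
  moreover have "less a x" "lab a x = time e"
    using coverI [of a e] W(2) e(1) rlx by (simp_all add: x_def)
  ultimately show "\<exists>x\<in>L. less a x \<and> rl x = Suc (rl a) \<and> (x = y \<or> less x y) \<and> lab a x < lab u a"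
    using rlx e(2) c(4) by (intro bexI [of _ x]) simp_all
qed

lemma acyclic_nc_ranks:
  assumes "p < length as"
  shows "acyclic_below less (nc_ranks W \<gamma> 1 p) p"
  unfolding nc_ranks_def
proof (rule nc.acyclic_below_truncation)
  show "id \<in> L" using in_L_iff id_le by simp
  show "\<gamma> \<in> L" using in_L_iff le_refl by simp
  show "finite L" using finite_subset [OF _ finite_W] L_in_W by blast
  show "p < rl \<gamma>" using assms rl_gamma by simp
  show "less x \<gamma>" if "x \<in> L" "x \<noteq> \<gamma>" for x using that in_L_iff by (simp add: absolute_less_def)
  show "less id x" if "x \<in> L" "x \<noteq> id" for x
    using that L_in_W id_le by (simp add: absolute_less_def)
  show "\<exists>a. nc.cov id a \<and> (a = x \<or> less a x)" if x: "x \<in> L" "less id x" for x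
  proof -
    obtain bs where bs: "set bs \<subseteq> pos_roots" "length bs = rl x" "x = refl_prod bs"
      using reduced_word [of x] L_in_W [OF x(1)] by metis
    then obtain b where b: "b \<in> set bs" using less_rl [OF x(2)] by (cases bs) auto
    have le: "le (reflection b) x"
      using letter_le [of bs b] bs b pos_roots_unit by auto
    moreover have "b \<in> unit_roots W" using b bs(1) pos_roots_unit by auto
    then have "rl (reflection b) = 1" by (rule rl_reflection)
    moreover have "reflection b \<in> L" using L_down le x(1) by blast
    ultimately show ?thesis
      using \<open>id \<in> L\<close> id_le L_in_W
      by (intro exI [of _ "reflection b"]) (auto simp: nc.cov_def less_iff absolute_less_def)
  qed
qed simp_all

end

section \<open>Isomorphisms in homology from lifting conditions\<close>

section \<open>Quasi-isomorphisms\<close>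

lemma chain_complexD:
  assumes "chain_complex C d"
  shows "comm_group (C p)" "d p \<in> hom (C p) (C (p - 1))"
    "x \<in> carrier (C (p + 1)) \<Longrightarrow> d p (d (p + 1) x) = \<one>\<^bsub>C (p - 1)\<^esub>"
proof -
  show "comm_group (C p)" "d p \<in> hom (C p) (C (p - 1))"
    using assms unfolding chain_complex_def by blast+
  assume "x \<in> carrier (C (p + 1))"
  then have "d (p + 1 - 1) (d (p + 1) x) = \<one>\<^bsub>C (p + 1 - 2)\<^esub>"
    using assms unfolding chain_complex_def by blast
  then show "d p (d (p + 1) x) = \<one>\<^bsub>C (p - 1)\<^esub>" by simp
qed

lemma chain_complex_group_hom:
  assumes "chain_complex C d"
  shows "group_hom (C p) (C (p - 1)) (d p)"
  using chain_complexD(1,2) [OF assms]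
  by (simp add: group_hom_def group_hom_axioms_def comm_group_def)

lemma carrier_cycle_group:
  assumes "chain_complex C d"
  shows "carrier (cycle_group C d p) = {x \<in> carrier (C p). d p x = \<one>\<^bsub>C (p - 1)\<^esub>}"
proof -
  interpret group_hom "C p" "C (p - 1)" "d p" using assms by (rule chain_complex_group_hom)
  show ?thesis
    unfolding cycle_group_def
    by (subst subgroup.carrier_subgroup_generated_subgroup [OF subgroup_kernel]) (simp add: kernel_def)
qed

lemma mult_cycle_group [simp]: "x \<otimes>\<^bsub>cycle_group C d p\<^esub> y = x \<otimes>\<^bsub>C p\<^esub> y"
  by (simp add: cycle_group_def)

lemma comm_group_cycle_group:
  assumes "chain_complex C d"
  shows "comm_group (cycle_group C d p)"
  unfolding cycle_group_def
  using chain_complexD(1) [OF assms, of p]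
  by (intro group.abelian_subgroup_generated) (auto intro: comm_group.axioms(2))

lemma subgroup_boundary_set:
  assumes "chain_complex C d"
  shows "subgroup (boundary_set C d p) (cycle_group C d p)"
proof -
  interpret G: comm_group "cycle_group C d p" using assms by (rule comm_group_cycle_group)
  interpret D: group_hom "C (p + 1)" "C p" "d (p + 1)"
    using chain_complex_group_hom [OF assms, of "p + 1"] by simp
  have sub: "subgroup (boundary_set C d p) (C p)"
    unfolding boundary_set_def using D.img_is_subgroup .
  have "boundary_set C d p \<subseteq> carrier (cycle_group C d p)"
    using chain_complexD(3) [OF assms] by (auto simp: boundary_set_def carrier_cycle_group [OF assms])
  then show ?thesis
    using sub unfolding cycle_group_def by (simp add: D.H.subgroup_subgroup_generated_iff)
qed

lemma comm_group_complex_homology: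
  assumes "chain_complex C d"
  shows "comm_group (complex_homology C d p)"
  unfolding complex_homology_def
  by (intro comm_group.abelian_FactGroup comm_group_cycle_group subgroup_boundary_set assms)

text \<open>The last two assumptions say that \<open>f\<close> is surjective and injective on homology.\<close>

lemma quasi_isomorphism_homology:
  fixes C :: "int \<Rightarrow> 'c monoid" and T :: "int \<Rightarrow> 't monoid"
  assumes C: "chain_complex C d" and T: "chain_complex T d'"
    and hom: "f p \<in> hom (T p) (C p)"
    and comm: "\<And>t. t \<in> carrier (T p) \<Longrightarrow> d' p t = \<one>\<^bsub>T (p - 1)\<^esub> \<Longrightarrow> d p (f p t) = \<one>\<^bsub>C (p - 1)\<^esub>"
    and comm': "\<And>s. s \<in> carrier (T (p + 1)) \<Longrightarrow> f p (d' (p + 1) s) \<in> boundary_set C d p"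
    and surj: "\<And>z. z \<in> carrier (C p) \<Longrightarrow> d p z = \<one>\<^bsub>C (p - 1)\<^esub> \<Longrightarrow>
      \<exists>t\<in>carrier (T p). d' p t = \<one>\<^bsub>T (p - 1)\<^esub> \<and> (\<exists>y\<in>boundary_set C d p. z = y \<otimes>\<^bsub>C p\<^esub> f p t)"
    and inj: "\<And>t. t \<in> carrier (T p) \<Longrightarrow> d' p t = \<one>\<^bsub>T (p - 1)\<^esub> \<Longrightarrow> f p t \<in> boundary_set C d p \<Longrightarrow>
      t \<in> boundary_set T d' p"
  shows "complex_homology C d p \<cong> complex_homology T d' p"
proof -
  let ?G = "cycle_group T d' p" and ?K = "cycle_group C d p" and ?B = "boundary_set C d p"
  let ?H = "complex_homology C d p"
  \<comment> \<open>\<open>f\<close> followed by the passage to homology classes; the first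
    isomorphism theorem is applied to this map.\<close>
  define h where "h t = ?B #>\<^bsub>?K\<^esub> f p t" for t
  interpret G: comm_group ?G using T by (rule comm_group_cycle_group)
  interpret K: comm_group ?K using C by (rule comm_group_cycle_group)
  interpret H: comm_group ?H using C by (rule comm_group_complex_homology)
  have B: "subgroup ?B ?K" using C by (rule subgroup_boundary_set)
  then have "?B \<lhd> ?K" by (rule K.subgroup_imp_normal)
  then interpret N: normal ?B ?K .
  have fK: "f p t \<in> carrier ?K" if "t \<in> carrier ?G" for t
    using that comm hom by (auto simp: carrier_cycle_group [OF T] carrier_cycle_group [OF C] hom_def)
  have carrier_H: "carrier ?H = (\<lambda>x. ?B #>\<^bsub>?K\<^esub> x) ` carrier ?K"
    unfolding complex_homology_def by (rule carrier_FactGroup)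
  have h_hom: "h \<in> hom ?G ?H"
  proof (rule homI)
    fix x y assume xy: "x \<in> carrier ?G" "y \<in> carrier ?G"
    then show "h x \<in> carrier ?H" using fK by (auto simp: h_def carrier_H)
    have "f p (x \<otimes>\<^bsub>?G\<^esub> y) = f p x \<otimes>\<^bsub>?K\<^esub> f p y"
      using xy hom by (auto simp: carrier_cycle_group [OF T] hom_def)
    then show "h (x \<otimes>\<^bsub>?G\<^esub> y) = h x \<otimes>\<^bsub>?H\<^esub> h y"
      using N.rcos_sum [OF fK [OF xy(1)] fK [OF xy(2)]]
      by (simp add: h_def complex_homology_def del: mult_cycle_group)
  qed
  interpret h: group_hom ?G ?H h
    by (rule group_hom.intro) (simp_all add: G.is_group H.is_group group_hom_axioms_def h_hom)
  have "h ` carrier ?G = carrier ?H"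
  proof
    show "carrier ?H \<subseteq> h ` carrier ?G"
    proof
      fix X assume "X \<in> carrier ?H"
      then obtain z where z: "z \<in> carrier ?K" "X = ?B #>\<^bsub>?K\<^esub> z" by (auto simp: carrier_H)
      then obtain t y where t: "t \<in> carrier (T p)" "d' p t = \<one>\<^bsub>T (p - 1)\<^esub>" and y: "y \<in> ?B"
        and zy: "z = y \<otimes>\<^bsub>C p\<^esub> f p t"
        using surj [of z] by (auto simp: carrier_cycle_group [OF C])
      have tG: "t \<in> carrier ?G" using t by (simp add: carrier_cycle_group [OF T])
      have "?B #>\<^bsub>?K\<^esub> z = (?B #>\<^bsub>?K\<^esub> y) #>\<^bsub>?K\<^esub> f p t"
        using zy y fK [OF tG] B subgroup.subset [OF B] by (subst K.coset_mult_assoc) auto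
      also have "?B #>\<^bsub>?K\<^esub> y = ?B" 
        using K.coset_join2 [OF _ B y] y subgroup.subset [OF B] by blast
      finally show "X \<in> h ` carrier ?G" using z(2) tG by (auto simp: h_def)
    qed
  qed auto
  then have "(?G Mod kernel ?G ?H h) \<cong> ?H" by (rule h.FactGroup_iso)
  moreover have "kernel ?G ?H h = boundary_set T d' p"
  proof -
    have one_H: "\<one>\<^bsub>?H\<^esub> = ?B" by (simp add: complex_homology_def)
    have ker: "h t = ?B \<longleftrightarrow> f p t \<in> ?B" if "t \<in> carrier ?G" for t
      unfolding h_def using fK [OF that] B K.coset_join1 [of ?B] K.coset_join2 [of "f p t" ?B]
        subgroup.subset [OF B] by auto
    have bT: "boundary_set T d' p \<subseteq> carrier ?G"
      using subgroup.subset [OF subgroup_boundary_set [OF T]] .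
    show ?thesis
    proof
      show "kernel ?G ?H h \<subseteq> boundary_set T d' p"
      proof
        fix t assume "t \<in> kernel ?G ?H h"
        then have "t \<in> carrier ?G" "f p t \<in> ?B" using ker one_H by (auto simp: kernel_def)
        then show "t \<in> boundary_set T d' p" using inj by (auto simp: carrier_cycle_group [OF T])
      qed
      show "boundary_set T d' p \<subseteq> kernel ?G ?H h"
      proof
        fix t assume t: "t \<in> boundary_set T d' p"
        then have "f p t \<in> ?B" using comm' by (auto simp: boundary_set_def [of T])
        then show "t \<in> kernel ?G ?H h" using t bT ker one_H by (auto simp: kernel_def)
      qed
    qed
  qed
  ultimately have "complex_homology T d' p \<cong> ?H" by (simp add: complex_homology_def [of T])
  then show ?thesis
    using group.iso_sym comm_group_complex_homology [OF T] comm_group.axioms(2) by blast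
qed

section \<open>Splitting the cellular boundary by level\<close>

section \<open>The cellular chain complex\<close>

definition at_level :: "nat \<Rightarrow> ('b \<Rightarrow>\<^sub>0 int) \<Rightarrow> (nat \<times> 'b \<Rightarrow>\<^sub>0 int)" where
  "at_level m = frag_extend (\<lambda>x. frag_of (m, x))"

definition level_part :: "nat \<Rightarrow> (nat \<times> 'b \<Rightarrow>\<^sub>0 int) \<Rightarrow> ('b \<Rightarrow>\<^sub>0 int)" where
  "level_part m = frag_extend (\<lambda>(m', x). if m' = m then frag_of x else 0)"

lemma at_level_simps [simp]:
  "at_level m 0 = 0" "at_level m (frag_of x) = frag_of (m, x)"
  "at_level m (a + b) = at_level m a + at_level m b"
  "at_level m (a - b) = at_level m a - at_level m b"
  "at_level m (- a) = - at_level m a"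
  by (simp_all add: at_level_def frag_extend_add frag_extend_diff frag_extend_minus)

lemma level_part_simps [simp]:
  "level_part m 0 = 0" "level_part m (frag_of (m', x)) = (if m' = m then frag_of x else 0)"
  "level_part m (a + b) = level_part m a + level_part m b"
  "level_part m (a - b) = level_part m a - level_part m b"
  "level_part m (- a) = - level_part m a"
  by (simp_all add: level_part_def frag_extend_add frag_extend_diff frag_extend_minus)

lemma supp_at_level: "supp (at_level m c) \<subseteq> Pair m ` supp c"
  unfolding at_level_def by (rule order_trans [OF keys_frag_extend]) auto

lemma supp_level_part: "supp (level_part m c) \<subseteq> {x. (m, x) \<in> supp c}"
  unfolding level_part_def by (rule order_trans [OF keys_frag_extend]) (auto split: if_split_asm)

lemma level_part_at_level [simp]: "level_part m (at_level m' c) = (if m' = m then c else 0)"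
  using subset_UNIV by (induction c rule: frag_induction) auto

lemma level_part_eq_0: "(\<And>x. (m, x) \<notin> supp c) \<Longrightarrow> level_part m c = 0"
  unfolding level_part_def by (rule frag_extend_eq_0) (auto split: prod.split)

lemma at_level_level_part:
  assumes "\<And>m' x. (m', x) \<in> supp c \<Longrightarrow> m' = m"
  shows "at_level m (level_part m c) = c"
proof -
  have "supp c \<subseteq> {m} \<times> UNIV" using assms by auto
  then show ?thesis by (induction c rule: frag_induction) auto
qed

lemma supp_level_part_removed:
  "(m, x) \<notin> supp c" if "level_part m c = 0"
proof -
  have "Poly_Mapping.lookup (level_part m c) x = Poly_Mapping.lookup c (m, x)"
    using subset_UNIV
  proof (induction c rule: frag_induction)
    case (one y)
    show ?case by (cases y) auto
  qed (simp_all add: lookup_minus)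
  then show ?thesis using that by (simp add: in_keys_iff)
qed

definition map_chain :: "('v \<Rightarrow> 'w) \<Rightarrow> ('v list \<Rightarrow>\<^sub>0 int) \<Rightarrow> ('w list \<Rightarrow>\<^sub>0 int)" where
  "map_chain f = frag_extend (\<lambda>ws. frag_of (map f ws))"

lemma map_chain_simps [simp]:
  "map_chain f 0 = 0" "map_chain f (frag_of ws) = frag_of (map f ws)"
  "map_chain f (a - b) = map_chain f a - map_chain f b"
  by (simp_all add: map_chain_def frag_extend_diff)

lemma map_chain_cons_chain: "map_chain f (cons_chain x c) = cons_chain (f x) (map_chain f c)"
  using subset_UNIV
  by (induction c rule: frag_induction) (simp_all add: cons_chain_diff)

lemma chain_boundary_map:
  "chain_boundary (frag_of (map f ws)) = map_chain f (chain_boundary (frag_of ws))"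
proof (induction ws rule: list.induct)
  case (Cons x ws)
  then show ?case by (simp add: chain_boundary_Cons map_chain_cons_chain)
qed simp

context coxeter_word
begin

definition first_face :: "(nat \<times> ('a \<Rightarrow> 'a) list \<Rightarrow>\<^sub>0 int) \<Rightarrow> (nat \<times> ('a \<Rightarrow> 'a) list \<Rightarrow>\<^sub>0 int)" where
  "first_face = frag_extend (\<lambda>(m, ws). frag_of (m + rl (hd ws), shift_chain ws))"

definition level_boundary :: "(nat \<times> ('a \<Rightarrow> 'a) list \<Rightarrow>\<^sub>0 int) \<Rightarrow> (nat \<times> ('a \<Rightarrow> 'a) list \<Rightarrow>\<^sub>0 int)" where
  "level_boundary = frag_extend (\<lambda>(m, ws). at_level m (chain_boundary (frag_of ws)))"

lemma first_face_simps [simp]: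
  "first_face 0 = 0" "first_face (frag_of (m, ws)) = frag_of (m + rl (hd ws), shift_chain ws)"
  "first_face (a + b) = first_face a + first_face b"
  "first_face (a - b) = first_face a - first_face b"
  by (simp_all add: first_face_def frag_extend_diff frag_extend_add)

lemma level_boundary_simps [simp]:
  "level_boundary 0 = 0" "level_boundary (frag_of (m, ws)) = at_level m (chain_boundary (frag_of ws))"
  "level_boundary (a + b) = level_boundary a + level_boundary b"
  "level_boundary (a - b) = level_boundary a - level_boundary b"
  by (simp_all add: level_boundary_def frag_extend_diff frag_extend_add)

lemma level_boundary_at_level: "level_boundary (at_level m c) = at_level m (chain_boundary c)"
  using subset_UNIV by (induction c rule: frag_induction) (simp_all add: chain_boundary_diff)

lemma level_boundary_level_boundary [simp]: "level_boundary (level_boundary c) = 0"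
  using subset_UNIV
proof (induction c rule: frag_induction)
  case (one x)
  show ?case by (cases x) (simp add: level_boundary_at_level)
qed simp_all

lemma level_part_level_boundary: "level_part m (level_boundary c) = chain_boundary (level_part m c)"
  using subset_UNIV
proof (induction c rule: frag_induction)
  case (one x)
  show ?case by (cases x) simp
qed (simp_all add: chain_boundary_diff)

lemma shift_chain_Cons: "shift_chain (w # ws) = map ((\<circ>) (ginv w)) ws"
  unfolding shift_chain_def by (simp only: list.sel)

lemma first_face_cons:
  "first_face (at_level m (cons_chain w c)) = at_level (m + rl w) (map_chain ((\<circ>) (ginv w)) c)"
  using subset_UNIV
  by (induction c rule: frag_induction)
    (simp_all only: cons_chain_diff cons_chain_of cons_chain_0 at_level_simps first_face_simps
      map_chain_simps list.sel shift_chain_Cons)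

text \<open>Deleting the least vertex twice agrees with deleting \<open>w\<close> and then the
  identity, since lengths add along the chain; the other faces commute with left division. Length at
  least 2 keeps \<open>hd\<close> away from the empty list.\<close>

lemma first_face_level_boundary:
  assumes "supp c \<subseteq> {(m, ws). 2 \<le> length ws \<and> set ws \<subseteq> L \<and> sorted_wrt less ws}"
  shows "first_face (level_boundary c) = first_face (first_face c) - level_boundary (first_face c)"
  using assms
proof (induction c rule: frag_induction)
  case (one x)
  then obtain m w v vs where x: "x = (m, w # v # vs)" and L: "w \<in> L" "v \<in> L" "less w v"
    by (cases x; cases "snd x"; cases "tl (snd x)") auto
  have W: "w \<in> W" "v \<in> W" using L L_in_W by auto
  have le: "le w v" using L(3) by (simp add: absolute_less_def)
  have q: "((\<circ>) (ginv (ginv w \<circ> v)) \<circ> (\<circ>) (ginv w)) u = ginv v \<circ> u" for u :: "'a \<Rightarrow> 'a"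
    using W by (simp add: ginv_of_comp comp_assoc)
  have "shift_chain (shift_chain (w # v # vs)) = shift_chain (v # vs)"
    unfolding shift_chain_Cons list.map map_map by (rule map_cong [OF refl q])
  then have ff: "first_face (first_face (frag_of x)) = frag_of (m + rl v, shift_chain (v # vs))"
    using le_rl [OF le] by (simp only: x first_face_simps list.sel shift_chain_Cons list.map)
      (simp only: add.assoc)
  have "level_boundary (first_face (frag_of x))
      = at_level (m + rl w) (map_chain ((\<circ>) (ginv w)) (chain_boundary (frag_of (v # vs))))"
    by (simp only: x first_face_simps list.sel shift_chain_Cons level_boundary_simps chain_boundary_map)
  then show ?case
    unfolding ff by (simp only: x level_boundary_simps chain_boundary_Cons [of w] at_level_simps
        first_face_simps first_face_cons list.sel)
qed simp_all

definition cells :: "nat \<Rightarrow> (nat \<times> ('a \<Rightarrow> 'a) list) set" where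
  "cells k = {(m, ws). m < length as \<and>
     ws \<in> order_chains less (nc_ranks W \<gamma> 1 (length as - 1 - m)) k}"

text \<open>Deleting a vertex is face i of the cell but face i - 1 of the list, whence the minus
  sign. Degree 0 is set apart because \<open>first_face\<close> has no meaning on the empty
  list.\<close>

definition cell_boundary :: "nat \<Rightarrow> (nat \<times> ('a \<Rightarrow> 'a) list \<Rightarrow>\<^sub>0 int) \<Rightarrow> (nat \<times> ('a \<Rightarrow> 'a) list \<Rightarrow>\<^sub>0 int)" where
  "cell_boundary k c = (if k = 0 then 0 else first_face c - level_boundary c)"

lemma chain_rank_growth:
  assumes "sorted_wrt less (w # ws)"
  shows "rl w + length ws \<le> rl (last (w # ws))"
  using assms
proof (induction ws arbitrary: w)
  case (Cons v ws)
  then have "rl w < rl v" "rl v + length ws \<le> rl (last (v # ws))" by (simp_all add: less_rl)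
  then show ?case by simp
qed simp

text \<open>Ranks grow by at least one per step. For \<open>k = j\<close> the first vertex is forced
  down to rank 1.\<close>

lemma chain_length_le:
  assumes "ws \<in> order_chains less (nc_ranks W \<gamma> 1 j) k" "ws \<noteq> []"
  shows "rl (hd ws) + k \<le> Suc j"
proof -
  obtain w vs where ws: "ws = w # vs" using assms(2) by (cases ws) auto
  have "last ws \<in> nc_ranks W \<gamma> 1 j" using assms last_in_set [of ws] by (auto simp: order_chains_def)
  then show ?thesis
    using chain_rank_growth [of w vs] assms(1) by (auto simp: ws order_chains_def nc_ranks_def)
qed

text \<open>Left division by the first vertex lowers all ranks by exactly the amount by which the
  level rises.\<close>

lemma first_face_cell:
  assumes "(m, ws) \<in> cells (Suc k)"
  shows "(m + rl (hd ws), shift_chain ws) \<in> cells k"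
proof -
  obtain w vs where ws: "ws = w # vs" using assms by (cases ws) (auto simp: cells_def order_chains_def)
  have m: "m < length as" and L: "w \<in> L" "set vs \<subseteq> L" and r: "1 \<le> rl w" "rl w \<le> length as - 1 - m"
    and vs: "\<And>v. v \<in> set vs \<Longrightarrow> rl v \<le> length as - 1 - m" "\<And>v. v \<in> set vs \<Longrightarrow> less w v"
    and sorted: "sorted_wrt less vs" and len: "length vs = k"
    using assms by (auto simp: ws cells_def order_chains_def nc_ranks_def)
  have "ginv w \<circ> v \<in> nc_ranks W \<gamma> 1 (length as - 1 - (m + rl w))" if v: "v \<in> set vs" for v
  proof -
    have le: "le w v" and lt: "rl w < rl v" using vs(2) [OF v] less_iff by auto
    then have "rl (ginv w \<circ> v) = rl v - rl w" using le_rl [OF le] by simp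
    moreover have "ginv w \<circ> v \<in> L" using quotient_in_L [OF le] L(2) v by auto
    ultimately show ?thesis using lt vs(1) [OF v] by (auto simp: nc_ranks_def)
  qed
  moreover have "sorted_wrt less (map ((\<circ>) (ginv w)) vs)"
    unfolding sorted_wrt_map
    by (rule sorted_wrt_mono_rel [OF _ sorted]) (use less_quotient vs(2) in blast)
  ultimately show ?thesis
    using m r len by (simp add: cells_def order_chains_def shift_chain_Cons ws image_subset_iff)
qed

lemma supp_first_face:
  assumes "supp c \<subseteq> cells (Suc k)"
  shows "supp (first_face c) \<subseteq> cells k"
proof
  fix y assume "y \<in> supp (first_face c)"
  then have "y \<in> (\<Union>x\<in>supp c. supp (case x of (m, ws) \<Rightarrow> frag_of (m + rl (hd ws), shift_chain ws)))"
    unfolding first_face_def by (rule subsetD [OF keys_frag_extend])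
  then obtain m ws where "(m, ws) \<in> supp c" "y = (m + rl (hd ws), shift_chain ws)" by auto
  then show "y \<in> cells k" using assms first_face_cell by auto
qed

lemma supp_level_boundary:
  assumes "supp c \<subseteq> cells (Suc k)"
  shows "supp (level_boundary c) \<subseteq> cells k"
proof
  fix y assume "y \<in> supp (level_boundary c)"
  then have "y \<in> (\<Union>x\<in>supp c. supp (case x of (m, ws) \<Rightarrow> at_level m (chain_boundary (frag_of ws))))"
    unfolding level_boundary_def by (rule subsetD [OF keys_frag_extend])
  then obtain m ws where x: "(m, ws) \<in> supp c"
    and y: "y \<in> supp (at_level m (chain_boundary (frag_of ws)))" by auto
  obtain vs where vs: "y = (m, vs)" "vs \<in> supp (chain_boundary (frag_of ws))"
    using supp_at_level y by blast
  have ws: "m < length as" "ws \<in> order_chains less (nc_ranks W \<gamma> 1 (length as - 1 - m)) (Suc k)"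
    using x assms by (auto simp: cells_def)
  then have "supp (chain_boundary (frag_of ws)) \<subseteq> order_chains less (nc_ranks W \<gamma> 1 (length as - 1 - m)) k"
    using supp_chain_boundary_subset [of "frag_of ws" less _ "Suc k"] by simp
  then show "y \<in> cells k" using vs ws(1) by (auto simp: cells_def)
qed

lemma supp_cell_boundary:
  assumes "supp c \<subseteq> cells (Suc k)"
  shows "supp (cell_boundary (Suc k) c) \<subseteq> cells k"
  unfolding cell_boundary_def
  using supp_first_face [OF assms] supp_level_boundary [OF assms] supp_diff_subset by simp

text \<open>The first vertex has positive rank, so deleting the identity strictly raises the
  level.\<close>

lemma level_part_first_face:
  assumes "supp c \<subseteq> cells (Suc k)" "\<And>m' ws. (m', ws) \<in> supp c \<Longrightarrow> j \<le> m'" "m \<le> j"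
  shows "level_part m (first_face c) = 0"
proof -
  have "supp c \<subseteq> {(m', ws). (m', ws) \<in> cells (Suc k) \<and> j \<le> m'}" using assms(1,2) by auto
  then show ?thesis
  proof (induction c rule: frag_induction)
    case (one x)
    obtain m' ws where x: "x = (m', ws)" by (cases x)
    have "ws \<noteq> []" "set ws \<subseteq> nc_ranks W \<gamma> 1 (length as - 1 - m')"
      using one by (auto simp: x cells_def order_chains_def)
    then have "hd ws \<in> nc_ranks W \<gamma> 1 (length as - 1 - m')" using hd_in_set by blast
    then have "1 \<le> rl (hd ws)" by (simp add: nc_ranks_def)
    then show ?case using one \<open>m \<le> j\<close> by (auto simp: x)
  qed simp_all
qed

lemma cell_boundary_diff: "cell_boundary k (a - b) = cell_boundary k a - cell_boundary k b"
  by (simp add: cell_boundary_def)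

lemma cell_boundary_add: "cell_boundary k (a + b) = cell_boundary k a + cell_boundary k b"
  by (simp add: cell_boundary_def)

lemma cell_boundary_0 [simp]: "cell_boundary k 0 = 0"
  by (simp add: cell_boundary_def)

lemma cell_boundary_boundary:
  assumes "supp c \<subseteq> cells (Suc k)"
  shows "cell_boundary k (cell_boundary (Suc k) c) = 0"
proof (cases k)
  case (Suc j)
  have "supp c \<subseteq> {(m, ws). 2 \<le> length ws \<and> set ws \<subseteq> L \<and> sorted_wrt less ws}"
    using assms by (force simp: cells_def order_chains_def nc_ranks_def Suc)
  then show ?thesis
    using first_face_level_boundary [of c] by (simp add: cell_boundary_def)
qed (simp add: cell_boundary_def)

section \<open>Deformation onto the subcomplex of top cycles\<close>

section \<open>Comparison with the complex of top homology groups\<close>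

text \<open>Cycles stand in for their classes, because the top degree has no nonzero
  boundaries.\<close>

definition top_cycles :: "nat \<Rightarrow> (('a \<Rightarrow> 'a) list \<Rightarrow>\<^sub>0 int) set" where
  "top_cycles k = (if k < length as
     then {z. supp z \<subseteq> order_chains less (nc_ranks W \<gamma> 1 k) k \<and> chain_boundary z = 0} else {0})"

text \<open>The guard matters: \<open>top_face_map\<close> fixes the empty chain instead of killing
  it.\<close>

definition top_map :: "nat \<Rightarrow> (('a \<Rightarrow> 'a) list \<Rightarrow>\<^sub>0 int) \<Rightarrow> (('a \<Rightarrow> 'a) list \<Rightarrow>\<^sub>0 int)" where
  "top_map k z = (if k = 0 then 0 else top_face_map z)"

text \<open>For \<open>k < length as\<close> this is the highest level with chains of length
  \<open>k\<close>; the ranks available there are just 1 to \<open>k\<close>.\<close>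

abbreviation top_embed :: "nat \<Rightarrow> (('a \<Rightarrow> 'a) list \<Rightarrow>\<^sub>0 int) \<Rightarrow> (nat \<times> ('a \<Rightarrow> 'a) list \<Rightarrow>\<^sub>0 int)" where
  "top_embed k \<equiv> at_level (length as - 1 - k)"

lemma zero_top_cycles [simp]: "0 \<in> top_cycles k"
  by (simp add: top_cycles_def)

lemma diff_top_cycles: "a \<in> top_cycles k \<Longrightarrow> b \<in> top_cycles k \<Longrightarrow> a - b \<in> top_cycles k"
  by (cases "k < length as") (simp_all add: top_cycles_def chain_boundary_diff supp_diff_subset)

lemma supp_top_embed:
  assumes "z \<in> top_cycles k"
  shows "supp (top_embed k z) \<subseteq> cells k"
proof (cases "k < length as")
  case True
  then have "length as - 1 - (length as - 1 - k) = k" by simp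
  moreover have "supp z \<subseteq> order_chains less (nc_ranks W \<gamma> 1 k) k"
    using assms True by (simp add: top_cycles_def)
  ultimately have "Pair (length as - 1 - k) ` supp z \<subseteq> cells k"
    using True by (auto simp: cells_def)
  then show ?thesis using supp_at_level by (rule order_trans [rotated])
qed (use assms in \<open>simp add: top_cycles_def\<close>)

lemma chain_boundary_eq_0: "supp c \<subseteq> {[]} \<Longrightarrow> chain_boundary c = 0"
  unfolding order_boundary_def by (rule frag_extend_eq_0) auto

text \<open>On a top cycle the level boundary vanishes. The first vertices have rank 1, so deleting
  the identity leads exactly one level up.\<close>

lemma cell_boundary_top_embed:
  assumes "z \<in> top_cycles k"
  shows "cell_boundary k (top_embed k z) = top_embed (k - 1) (top_map k z)"
proof (cases "0 < k \<and> k < length as")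
  case True
  then have k: "0 < k" "k < length as" by auto
  have z: "supp z \<subseteq> order_chains less (nc_ranks W \<gamma> 1 k) k" "chain_boundary z = 0"
    using assms k by (auto simp: top_cycles_def)
  have "first_face (top_embed k z) = top_embed (k - 1) (top_face_map z)"
    using z(1)
  proof (induction z rule: frag_induction)
    case (one ws)
    then have ws: "ws \<noteq> []" using k by (auto simp: order_chains_def)
    have "hd ws \<in> nc_ranks W \<gamma> 1 k"
      using one hd_in_set [OF ws] unfolding order_chains_def by blast
    then have "1 \<le> rl (hd ws)" by (simp add: nc_ranks_def)
    then have "rl (hd ws) = 1" using chain_length_le [OF one ws] by simp
    moreover have "length as - 1 - k + 1 = length as - 1 - (k - 1)" using k by simp
    ultimately show ?case by (simp add: top_face_map_def)
  qed (simp_all add: top_face_map_def frag_extend_diff)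
  then show ?thesis
    using k z(2) by (simp add: cell_boundary_def top_map_def level_boundary_at_level)
next
  case False
  then show ?thesis using assms by (auto simp: cell_boundary_def top_map_def top_cycles_def top_face_map_def)
qed

text \<open>Apply the boundary twice to the embedded cycle. In the result, the faces deleting the
  identity lie strictly above the level of the simplicial boundary, which must therefore vanish by
  itself.\<close>

lemma top_map_in_top_cycles:
  assumes "z \<in> top_cycles (Suc k)"
  shows "top_map (Suc k) z \<in> top_cycles k"
proof (cases "Suc k < length as")
  case False
  then show ?thesis using assms by (simp add: top_cycles_def top_map_def top_face_map_def)
next
  case True
  define y where "y = top_map (Suc k) z"
  have emb: "cell_boundary (Suc k) (top_embed (Suc k) z) = top_embed k y"
    using cell_boundary_top_embed [OF assms] by (simp add: y_def)
  have supp_y: "supp (top_embed k y) \<subseteq> cells k"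
    unfolding emb [symmetric] using supp_top_embed [OF assms] by (rule supp_cell_boundary)
  have "supp y \<subseteq> order_chains less (nc_ranks W \<gamma> 1 k) k"
  proof
    fix ws assume "ws \<in> supp y"
    then have "ws \<in> supp (level_part (length as - 1 - k) (top_embed k y))" by simp
    from subsetD [OF supp_level_part this]
    have "(length as - 1 - k, ws) \<in> cells k" using supp_y by auto
    moreover have "length as - 1 - (length as - 1 - k) = k" using True by simp
    ultimately show "ws \<in> order_chains less (nc_ranks W \<gamma> 1 k) k" by (simp add: cells_def)
  qed
  moreover have "chain_boundary y = 0"
  proof (cases k)
    case 0
    then show ?thesis using calculation by (intro chain_boundary_eq_0) (simp add: order_chains_0)
  next
    case (Suc j)
    have "cell_boundary k (top_embed k y) = 0"
      unfolding emb [symmetric] using supp_top_embed [OF assms] by (rule cell_boundary_boundary)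
    then have "first_face (top_embed k y) = top_embed k (chain_boundary y)"
      by (simp add: cell_boundary_def Suc level_boundary_at_level)
    moreover have "level_part (length as - 1 - k) (first_face (top_embed k y)) = 0"
    proof (rule level_part_first_face)
      show "supp (top_embed k y) \<subseteq> cells (Suc j)" using supp_y by (simp only: Suc)
      show "length as - 1 - k \<le> m'" if "(m', ws) \<in> supp (top_embed k y)" for m' ws
        using subsetD [OF supp_at_level that] by auto
    qed simp
    ultimately show ?thesis by simp
  qed
  ultimately show ?thesis using True by (simp add: top_cycles_def y_def)
qed

lemma cells_level:
  assumes "(m, ws) \<in> cells k"
  shows "m + k < length as"
proof (cases "ws = []")
  case True
  then show ?thesis using assms by (auto simp: cells_def order_chains_def)
next
  case False
  have m: "m < length as" and ws: "ws \<in> order_chains less (nc_ranks W \<gamma> 1 (length as - 1 - m)) k"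
    using assms by (auto simp: cells_def)
  then have "hd ws \<in> nc_ranks W \<gamma> 1 (length as - 1 - m)"
    using hd_in_set [OF False] unfolding order_chains_def by blast
  then have "1 \<le> rl (hd ws)" by (simp add: nc_ranks_def)
  then show ?thesis using chain_length_le [OF ws False] m by linarith
qed

lemma supp_level_part_cells:
  assumes "supp x \<subseteq> cells k"
  shows "supp (level_part m x) \<subseteq> order_chains less (nc_ranks W \<gamma> 1 (length as - 1 - m)) k"
proof
  fix ws assume "ws \<in> supp (level_part m x)"
  from subsetD [OF supp_level_part this] show "ws \<in> order_chains less (nc_ranks W \<gamma> 1 (length as - 1 - m)) k"
    using assms by (auto simp: cells_def)
qed

lemma supp_at_level_cells:
  assumes "supp y \<subseteq> order_chains less (nc_ranks W \<gamma> 1 (length as - 1 - m)) k" "m < length as"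
  shows "supp (at_level m y) \<subseteq> cells k"
proof -
  have "Pair m ` supp y \<subseteq> cells k" using assms by (auto simp: cells_def)
  then show ?thesis using supp_at_level by (rule order_trans [rotated])
qed

text \<open>Nothing arrives at the lowest level from \<open>first_face\<close>, and for positive
  \<open>k\<close> the prescribed boundary sits at level \<open>length as - k\<close>, strictly
  above \<open>j\<close>. Only the simplicial boundary of this component remains.\<close>

lemma chain_boundary_level_part_eq_0:
  assumes x: "supp x \<subseteq> cells k" "\<And>m ws. (m, ws) \<in> supp x \<Longrightarrow> j \<le> m"
    and bx: "cell_boundary k x = top_embed (k - 1) t" and j: "j + k < length as"
  shows "chain_boundary (level_part j x) = 0"
proof (cases k)
  case 0
  show ?thesis
    using supp_level_part_cells [OF x(1), of j] by (intro chain_boundary_eq_0) (simp add: 0 order_chains_0)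
next
  case (Suc k')
  have "length as - 1 - (k - 1) \<noteq> j" using j by (simp add: Suc)
  then have "0 = level_part j (cell_boundary k x)" unfolding bx by simp
  also have "\<dots> = level_part j (first_face x) - chain_boundary (level_part j x)"
    by (simp add: cell_boundary_def Suc level_part_level_boundary)
  also have "level_part j (first_face x) = 0"
    using x(1) x(2) order_refl unfolding Suc by (rule level_part_first_face)
  finally show ?thesis by simp
qed

text \<open>The component of \<open>x\<close> of lowest level is a cycle, which bounds unless its level is the
  largest possible one; subtracting a boundary therefore raises the level.\<close>

lemma deform_to_top_cycle:
  assumes "supp x \<subseteq> cells k" and "cell_boundary k x = top_embed (k - 1) t"
  shows "\<exists>z\<in>top_cycles k. \<exists>y. supp y \<subseteq> cells (Suc k) \<and> x = top_embed k z + cell_boundary (Suc k) y"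
proof (cases "k < length as")
  case False
  then have "cells k = {}" using cells_level by fastforce
  then have "x = 0" using assms(1) by simp
  then show ?thesis by (intro bexI [of _ 0] exI [of _ 0]) simp_all
next
  case True
  define M where "M = length as - 1 - k"
  have M: "M + k < length as" "length as - 1 - M = k" using True by (simp_all add: M_def)
  \<comment> \<open>Generalized by a lower bound \<open>j\<close> for the levels that occur; the
    induction raises it to \<open>M\<close>.\<close>
  have "\<exists>z\<in>top_cycles k. \<exists>y. supp y \<subseteq> cells (Suc k) \<and> x = top_embed k z + cell_boundary (Suc k) y"
    if "supp x \<subseteq> cells k" "cell_boundary k x = top_embed (k - 1) t"
      "\<And>m ws. (m, ws) \<in> supp x \<Longrightarrow> j \<le> m" for j x
    using that
  proof (induction "M - j" arbitrary: j x)
    case 0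
    \<comment> \<open>Cells of degree \<open>k\<close> reach no higher than \<open>M\<close>, so
      nothing but that level is left.\<close>
    have level: "m' = M" if "(m', ws) \<in> supp x" for m' ws
    proof -
      have "m' + k < length as" using that 0(2) cells_level by blast
      moreover have "j \<le> m'" using 0(4) that .
      ultimately show ?thesis using 0(1) by (simp add: M_def)
    qed
    define z where "z = level_part M x"
    have "supp z \<subseteq> order_chains less (nc_ranks W \<gamma> 1 k) k"
      using supp_level_part_cells [OF 0(2), of M] M(2) by (simp only: z_def)
    moreover have "chain_boundary z = 0"
      unfolding z_def using 0(2) _ 0(3) M(1)
      by (rule chain_boundary_level_part_eq_0) (use level in simp)
    ultimately have "z \<in> top_cycles k" using True by (simp add: top_cycles_def)
    moreover have "x = top_embed k z"
      unfolding z_def M_def [symmetric] by (rule at_level_level_part [symmetric]) (rule level)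
    ultimately show ?case by (intro bexI [of _ z] exI [of _ 0]) simp_all
  next
    case (Suc d)
    then have j: "j < M" "j + k < length as" "k < length as - 1 - j" "j < length as"
      by (simp_all add: M_def)
    define z where "z = level_part j x"
    have "supp z \<subseteq> order_chains less (nc_ranks W \<gamma> 1 (length as - 1 - j)) k"
      unfolding z_def using Suc.prems(1) by (rule supp_level_part_cells)
    moreover have "chain_boundary z = 0"
      unfolding z_def using Suc.prems(1,3,2) j(2) by (rule chain_boundary_level_part_eq_0)
    moreover have "acyclic_below less (nc_ranks W \<gamma> 1 (length as - 1 - j)) (length as - 1 - j)"
      using j(4) by (intro acyclic_nc_ranks) simp
    ultimately obtain y where y: "chain_boundary y = z"
      "supp y \<subseteq> order_chains less (nc_ranks W \<gamma> 1 (length as - 1 - j)) (Suc k)"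
      using j(3) by (metis acyclic_belowD)
    define c where "c = at_level j y"
    have c: "supp c \<subseteq> cells (Suc k)"
      unfolding c_def using y(2) j(4) by (rule supp_at_level_cells)
    have c_level: "m' = j" if "(m', ws) \<in> supp c" for m' ws
      using subsetD [OF supp_at_level that [unfolded c_def]] by auto
    \<comment> \<open>The plus sign is right: \<open>level_boundary\<close> enters
      \<open>cell_boundary\<close> negatively, so this cancels \<open>z\<close>.\<close>
    define x' where "x' = x + cell_boundary (Suc k) c"
    have low: "level_part m' x' = 0" if "m' \<le> j" for m'
    proof -
      have "level_part m' (first_face c) = 0"
        using c _ that by (rule level_part_first_face) (use c_level in simp)
      then have "level_part m' x' = level_part m' x - level_part m' (at_level j z)"
        by (simp add: x'_def cell_boundary_def c_def level_boundary_at_level y(1))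
      also have "\<dots> = 0"
      proof (cases "m' = j")
        case False
        then have "level_part m' x = 0"
          using that Suc.prems(3) by (intro level_part_eq_0) fastforce
        then show ?thesis using False by simp
      qed (simp add: z_def)
      finally show ?thesis .
    qed
    have "\<exists>z\<in>top_cycles k. \<exists>y. supp y \<subseteq> cells (Suc k) \<and> x' = top_embed k z + cell_boundary (Suc k) y"
    proof (rule Suc.hyps(1))
      show "d = M - Suc j" using Suc.hyps(2) by simp
      show "supp x' \<subseteq> cells k"
        unfolding x'_def using Suc.prems(1) supp_cell_boundary [OF c] by (rule supp_add_subset)
      show "cell_boundary k x' = top_embed (k - 1) t"
        by (simp add: x'_def cell_boundary_add cell_boundary_boundary [OF c] Suc.prems(2))
      show "Suc j \<le> m'" if "(m', ws) \<in> supp x'" for m' ws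
        using low [of m'] supp_level_part_removed that by (metis not_less_eq_eq)
    qed
    then obtain u v where u: "u \<in> top_cycles k" and v: "supp v \<subseteq> cells (Suc k)"
      and x': "x' = top_embed k u + cell_boundary (Suc k) v" by blast
    have "x = top_embed k u + cell_boundary (Suc k) (v - c)"
      using x' by (simp add: x'_def cell_boundary_diff algebra_simps)
    moreover have "supp (v - c) \<subseteq> cells (Suc k)" using v c by (rule supp_diff_subset)
    ultimately show ?case using u by blast
  qed
  from this [OF assms, of 0] show ?thesis by simp
qed

lemma top_embed_inj: "top_embed k a = top_embed k b \<Longrightarrow> a = b"
  using level_part_at_level [of "length as - 1 - k" "length as - 1 - k"] by metis

text \<open>The embedding is injective and commutes with the boundaries, so the vanishing square is
  inherited from the cells.\<close>

lemma top_map_top_map: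
  assumes "z \<in> top_cycles (Suc k)"
  shows "top_map k (top_map (Suc k) z) = 0"
proof -
  have "top_embed (k - 1) (top_map k (top_map (Suc k) z))
      = cell_boundary k (top_embed k (top_map (Suc k) z))"
    using cell_boundary_top_embed [OF top_map_in_top_cycles [OF assms]] by simp
  also have "\<dots> = cell_boundary k (cell_boundary (Suc k) (top_embed (Suc k) z))"
    using cell_boundary_top_embed [OF assms] by simp
  also have "\<dots> = top_embed (k - 1) 0"
    using cell_boundary_boundary [OF supp_top_embed [OF assms]] by simp
  finally show ?thesis by (rule top_embed_inj)
qed

lemma top_map_0 [simp]: "top_map k 0 = 0"
  by (simp add: top_map_def top_face_map_def)

lemma top_map_add: "top_map k (a + b) = top_map k a + top_map k b"
  by (simp add: top_map_def top_face_map_def frag_extend_add)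

section \<open>Identification with the complexes of the statement\<close>

subsection \<open>Translation to the chain groups\<close>

lemma rl_le_last:
  assumes "sorted_wrt less ws" "w \<in> set ws"
  shows "rl w \<le> rl (last ws)"
proof -
  obtain us vs where ws: "ws = us @ w # vs" using split_list [OF assms(2)] by blast
  have "sorted_wrt less (w # vs)" using assms(1) unfolding ws sorted_wrt_append by blast
  then show ?thesis using chain_rank_growth [of w vs] by (simp add: ws)
qed

text \<open>Ranks increase along a chain, so the bound on the last vertex bounds them all; rank at
  least 1 encodes lying above the identity.\<close>

lemma FP_cells_eq: "FP_cells W \<gamma> (length as) (int k) = cells k"
proof -
  have "(m, ws) \<in> FP_cells W \<gamma> (length as) (int k) \<longleftrightarrow> (m, ws) \<in> cells k" for m ws
  proof
    assume "(m, ws) \<in> FP_cells W \<gamma> (length as) (int k)"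
    then have ws: "length ws = k" "set ws \<subseteq> L" "sorted_wrt less ws" "\<And>w. w \<in> set ws \<Longrightarrow> less id w"
      and m: "int m < int (length as) - int (rl (last (id # ws)))"
      by (auto simp: FP_cells_def simp del: last.simps)
    have "w \<in> nc_ranks W \<gamma> 1 (length as - 1 - m)" if w: "w \<in> set ws" for w
    proof -
      have "last (id # ws) = last ws" using w by auto
      then have "rl w \<le> length as - 1 - m" using rl_le_last [OF ws(3) w] m by simp
      moreover have "1 \<le> rl w" using less_rl [OF ws(4) [OF w]] by simp
      ultimately show ?thesis using ws(2) w by (auto simp: nc_ranks_def)
    qed
    moreover have "m < length as" using m by linarith
    ultimately show "(m, ws) \<in> cells k" using ws by (auto simp: cells_def order_chains_def)
  next
    assume c: "(m, ws) \<in> cells k"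
    then have m: "m < length as" and ws: "length ws = k" "sorted_wrt less ws"
      and r: "\<And>w. w \<in> set ws \<Longrightarrow> w \<in> nc_ranks W \<gamma> 1 (length as - 1 - m)"
      by (auto simp: cells_def order_chains_def)
    have "less id w" "w \<in> L" if "w \<in> set ws" for w
      using r [OF that] L_in_W id_le by (auto simp: nc_ranks_def absolute_less_def)
    moreover have "int m < int (length as) - int (rl (last (id # ws)))"
    proof (cases "ws = []")
      case False
      have "rl (last ws) \<le> length as - 1 - m"
        using r [OF last_in_set [OF False]] by (simp add: nc_ranks_def)
      then show ?thesis using m False by simp
    qed (use m in simp)
    ultimately show "(m, ws) \<in> FP_cells W \<gamma> (length as) (int k)"
      using ws by (auto simp: FP_cells_def simp del: last.simps)
  qed
  then show ?thesis by auto
qed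

lemma FP_cells_negative: "k < 0 \<Longrightarrow> FP_cells W \<gamma> (length as) k = {}"
  by (auto simp: FP_cells_def)

lemma FP_boundary_eq:
  assumes "supp c \<subseteq> cells k"
  shows "FP_boundary W (int k) c = cell_boundary k c"
proof (cases k)
  case (Suc j)
  define g where "g s = (\<Sum>i\<le>k. frag_cmul ((-1) ^ i) (frag_of (FP_face W i s)))" for s
  have "frag_extend g c = first_face c - level_boundary c"
    using assms
  proof (induction c rule: frag_induction)
    case (one x)
    obtain m ws where x: "x = (m, ws)" by (cases x)
    have len: "length ws = Suc j" using one by (simp add: x cells_def order_chains_def Suc)
    have "(\<Sum>i\<le>j. frag_cmul ((-1) ^ Suc i) (frag_of (m, delete_nth i ws)))
        = - at_level m (chain_boundary (frag_of ws))"
      by (simp add: order_boundary_def at_level_def len frag_extend_sum o_def frag_extend_cmul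
          lessThan_Suc_atMost flip: sum_negf)
    moreover have "g x = frag_of (FP_face W 0 x)
        + (\<Sum>i\<le>j. frag_cmul ((-1) ^ Suc i) (frag_of (FP_face W (Suc i) x)))"
      unfolding g_def Suc by (subst sum.atMost_Suc_shift) simp
    ultimately show ?case by (simp add: x FP_face_def)
  qed (simp_all add: frag_extend_diff)
  moreover have "0 < k" using Suc by simp
  then have "FP_boundary W (int k) c = frag_extend g c"
    by (simp add: FP_boundary_def g_def [abs_def])
  ultimately show ?thesis using \<open>0 < k\<close> by (simp add: cell_boundary_def)
qed (simp add: FP_boundary_def cell_boundary_def)

lemma carrier_FP_chain_group:
  "carrier (FP_chain_group W \<gamma> (length as) (int k)) = {c. supp c \<subseteq> cells k}"
  by (auto simp: FP_chain_group_def FP_cells_eq)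

lemma carrier_FP_chain_group_negative:
  "k < 0 \<Longrightarrow> carrier (FP_chain_group W \<gamma> (length as) k) = {0}"
  by (auto simp: FP_chain_group_def FP_cells_negative)

lemma FP_chain_group_simps [simp]:
  "x \<otimes>\<^bsub>FP_chain_group W \<gamma> (length as) p\<^esub> y = x + y" "\<one>\<^bsub>FP_chain_group W \<gamma> (length as) p\<^esub> = 0"
  by (simp_all add: FP_chain_group_def)

lemma FP_boundary_add: "FP_boundary W p (a + b) = FP_boundary W p a + FP_boundary W p b"
  by (simp add: FP_boundary_def frag_extend_add)

lemma FP_boundary_nonpos: "p \<le> 0 \<Longrightarrow> FP_boundary W p c = 0"
  by (simp add: FP_boundary_def)

lemma chain_complex_FP: "chain_complex (FP_chain_group W \<gamma> (length as)) (FP_boundary W)"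
  unfolding chain_complex_def
proof (intro allI conjI ballI)
  fix p :: int
  let ?C = "FP_chain_group W \<gamma> (length as)"
  show "comm_group (?C p)" by (simp add: FP_chain_group_def abelian_free_Abelian_group)
  show "FP_boundary W p \<in> hom (?C p) (?C (p - 1))"
  proof (rule homI)
    fix x assume x: "x \<in> carrier (?C p)"
    show "FP_boundary W p x \<in> carrier (?C (p - 1))"
    proof (cases "p \<le> 0")
      case True
      then show ?thesis by (simp add: FP_boundary_nonpos FP_chain_group_def)
    next
      case False
      then obtain k where k: "p = int (Suc k)" by (metis not_le zero_less_imp_eq_int not0_implies_Suc less_numeral_extra(3))
      then have "p - 1 = int k" by simp
      then show ?thesis
        using x supp_cell_boundary [of x k] FP_boundary_eq [of x "Suc k"]
        unfolding k by (simp only: carrier_FP_chain_group mem_Collect_eq)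
    qed
  qed (simp add: FP_boundary_add)
  fix x assume x: "x \<in> carrier (?C p)"
  show "FP_boundary W (p - 1) (FP_boundary W p x) = \<one>\<^bsub>?C (p - 2)\<^esub>"
  proof (cases "p \<le> 0")
    case True
    then show ?thesis by (simp add: FP_boundary_nonpos)
  next
    case False
    then obtain k where k: "p = int (Suc k)" by (metis not_le zero_less_imp_eq_int not0_implies_Suc less_numeral_extra(3))
    then have p: "p - 1 = int k" by simp
    have xk: "supp x \<subseteq> cells (Suc k)" using x unfolding k carrier_FP_chain_group by simp
    have "FP_boundary W p x = cell_boundary (Suc k) x" unfolding k using xk by (rule FP_boundary_eq)
    then show ?thesis
      unfolding p using FP_boundary_eq [OF supp_cell_boundary [OF xk]] cell_boundary_boundary [OF xk] by simp
  qed
qed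

lemma chain_complex_order_chain_group:
  "chain_complex (order_chain_group lt P) order_boundary"
  unfolding chain_complex_def
proof (intro allI conjI ballI)
  fix p :: int
  let ?C = "order_chain_group lt P"
  show "comm_group (?C p)" by (simp add: order_chain_group_def abelian_free_Abelian_group)
  \<comment> \<open>\<open>nat (q + 1)\<close> is 0 for every \<open>q \<le> - 1\<close>; the extra
    condition keeps the empty chain out of degrees below -1.\<close>
  have C: "carrier (?C q) = {c. supp c \<subseteq> {ws \<in> order_chains lt P (nat (q + 1)). - 1 \<le> q}}" for q
  proof -
    have "{ws. set ws \<subseteq> P \<and> sorted_wrt lt ws \<and> int (length ws) = q + 1}
        = {ws \<in> order_chains lt P (nat (q + 1)). - 1 \<le> q}" by (auto simp: order_chains_def)
    then show ?thesis by (auto simp: order_chain_group_def)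
  qed
  show "order_boundary p \<in> hom (?C p) (?C (p - 1))"
  proof (rule homI)
    fix x assume "x \<in> carrier (?C p)"
    then have x: "supp x \<subseteq> {ws \<in> order_chains lt P (nat (p + 1)). - 1 \<le> p}" using C by simp
    show "order_boundary p x \<in> carrier (?C (p - 1))"
    proof (cases "0 \<le> p")
      case True
      then have "nat (p + 1) - 1 = nat (p - 1 + 1)" "- 1 \<le> p - 1" by auto
      then show ?thesis
        using supp_chain_boundary_subset [of x lt P "nat (p + 1)"] x
        by (auto simp: C order_boundary_eq [of p])
    next
      case False
      then have "supp x \<subseteq> {[]}" using x by (force simp: order_chains_def)
      then show ?thesis by (simp add: chain_boundary_eq_0 order_boundary_eq [of p] C)
    qed
  next
    fix x y
    show "order_boundary p (x \<otimes>\<^bsub>?C p\<^esub> y) = order_boundary p x \<otimes>\<^bsub>?C (p - 1)\<^esub> order_boundary p y"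
      by (simp add: order_chain_group_def order_boundary_def frag_extend_add)
  qed
  show "order_boundary (p - 1) (order_boundary p x) = \<one>\<^bsub>?C (p - 2)\<^esub>" for x
    by (simp add: order_boundary_eq [of p] order_boundary_eq [of "p - 1"] order_chain_group_def)
qed

text \<open>There is no room for \<open>k + 1\<close> increasing ranks between 1 and
  \<open>k\<close>. This is why the top degree has no nonzero boundaries.\<close>

lemma order_chains_too_long: "order_chains less (nc_ranks W \<gamma> 1 k) (Suc k) = {}"
proof -
  have False if ws: "ws \<in> order_chains less (nc_ranks W \<gamma> 1 k) (Suc k)" for ws
  proof -
    have "ws \<noteq> []" "set ws \<subseteq> nc_ranks W \<gamma> 1 k" using ws by (auto simp: order_chains_def)
    then have "hd ws \<in> nc_ranks W \<gamma> 1 k" using hd_in_set by blast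
    then have "1 \<le> rl (hd ws)" by (simp add: nc_ranks_def)
    then show False using chain_length_le [OF ws \<open>ws \<noteq> []\<close>] by simp
  qed
  then show ?thesis by blast
qed

abbreviation rank_complex :: "nat \<Rightarrow> int \<Rightarrow> (('a \<Rightarrow> 'a) list \<Rightarrow>\<^sub>0 int) monoid" where
  "rank_complex k \<equiv> order_chain_group less (nc_ranks W \<gamma> 1 k)"

lemma rank_complex_boundary_set: "boundary_set (rank_complex k) order_boundary (int k - 1) = {0}"
proof -
  have *: "{ws. set ws \<subseteq> nc_ranks W \<gamma> 1 k \<and> sorted_wrt less ws \<and> int (length ws) = int k + 1} = {}"
    using order_chains_too_long [of k] by (auto simp: order_chains_def)
  then have "carrier (rank_complex k (int k)) = {0}"
    unfolding order_chain_group_def * by auto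
  then show ?thesis by (simp add: boundary_set_def order_boundary_def)
qed

lemma rank_complex_coset:
  "{0} #>\<^bsub>cycle_group (rank_complex k) order_boundary q\<^esub> z = {z}"
  by (simp add: r_coset_def cycle_group_def order_chain_group_def)

lemma carrier_rank_complex_cycle_group:
  assumes "k < length as"
  shows "carrier (cycle_group (rank_complex k) order_boundary (int k - 1)) = top_cycles k"
proof -
  have "{ws. set ws \<subseteq> nc_ranks W \<gamma> 1 k \<and> sorted_wrt less ws \<and> int (length ws) = int k - 1 + 1}
      = order_chains less (nc_ranks W \<gamma> 1 k) k" by (auto simp: order_chains_def)
  then have "carrier (rank_complex k (int k - 1))
      = {z. supp z \<subseteq> order_chains less (nc_ranks W \<gamma> 1 k) k}"
    by (auto simp: order_chain_group_def)
  then show ?thesis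
    unfolding carrier_cycle_group [OF chain_complex_order_chain_group] order_boundary_eq [of "int k - 1"]
    using assms by (simp add: top_cycles_def) (simp add: order_chain_group_def)
qed

abbreviation top_groups :: "int \<Rightarrow> (('a \<Rightarrow> 'a) list \<Rightarrow>\<^sub>0 int) set monoid" where
  "top_groups \<equiv> top_group W \<gamma> (length as)"

definition int_top_cycles :: "int \<Rightarrow> (('a \<Rightarrow> 'a) list \<Rightarrow>\<^sub>0 int) set" where
  "int_top_cycles p = (if 0 \<le> p then top_cycles (nat p) else {0})"

text \<open>Within the range, the quotient is by the zero subgroup, so each coset is a singleton and
  can be handled as the cycle it contains.\<close>

lemma top_group_structure:
  "carrier (top_groups p) = (\<lambda>z. {z}) ` int_top_cycles p"
  "a \<in> int_top_cycles p \<Longrightarrow> b \<in> int_top_cycles p \<Longrightarrow> {a} \<otimes>\<^bsub>top_groups p\<^esub> {b} = {a + b}"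
  "\<one>\<^bsub>top_groups p\<^esub> = {0}"
proof -
  have *: "carrier (top_groups p) = (\<lambda>z. {z}) ` int_top_cycles p \<and>
    (\<forall>a\<in>int_top_cycles p. \<forall>b\<in>int_top_cycles p. {a} \<otimes>\<^bsub>top_groups p\<^esub> {b} = {a + b}) \<and>
    \<one>\<^bsub>top_groups p\<^esub> = {0}"
  proof (cases "0 \<le> p \<and> p \<le> int (length as) - 1")
    case True
    define k where "k = nat p"
    have k: "p = int k" "k < length as" using True by (auto simp: k_def)
    have eq: "top_groups p = cycle_group (rank_complex k) order_boundary (int k - 1) Mod {0}"
      using True rank_complex_boundary_set [of k]
      by (simp add: top_group_def reduced_homology_def complex_homology_def k)
    have mult: "{a} \<otimes>\<^bsub>top_groups p\<^esub> {b} = {a + b}" for a b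
      unfolding eq by (simp add: set_mult_def order_chain_group_def)
    have "carrier (top_groups p) = (\<lambda>z. {z}) ` int_top_cycles p"
      unfolding eq carrier_FactGroup rank_complex_coset carrier_rank_complex_cycle_group [OF k(2)]
      using k(1) by (simp add: int_top_cycles_def)
    moreover have "\<one>\<^bsub>top_groups p\<^esub> = {0}" unfolding eq by simp
    ultimately show ?thesis by (intro conjI ballI mult)
  next
    case False
    then have "top_groups p = singleton_group {0}" by (auto simp: top_group_def)
    moreover have "int_top_cycles p = {0}" using False by (auto simp: int_top_cycles_def top_cycles_def)
    ultimately show ?thesis by (simp add: singleton_group_def)
  qed
  show "carrier (top_groups p) = (\<lambda>z. {z}) ` int_top_cycles p" "\<one>\<^bsub>top_groups p\<^esub> = {0}"
    by (rule * [THEN conjunct1], rule * [THEN conjunct2, THEN conjunct2])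
  show "{a} \<otimes>\<^bsub>top_groups p\<^esub> {b} = {a + b}" if "a \<in> int_top_cycles p" "b \<in> int_top_cycles p"
    using that by (rule * [THEN conjunct2, THEN conjunct1, THEN bspec, THEN bspec])
qed

lemma top_boundary_eq:
  assumes "z \<in> int_top_cycles p"
  shows "top_boundary W \<gamma> (length as) p {z} = {top_map (nat p) z}"
proof (cases "1 \<le> p \<and> p \<le> int (length as) - 1")
  case True
  define k where "k = nat (p - 1)"
  have k: "p - 2 = int k - 1" "nat p \<noteq> 0" "nat (p - 1) = k" using True by (auto simp: k_def)
  have "top_boundary W \<gamma> (length as) p {z}
      = homology_class (rank_complex k) order_boundary (int k - 1) (top_face_map z)"
    unfolding top_boundary_def k(1,3) using True by simp
  also have "\<dots> = {top_face_map z}"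
    unfolding homology_class_def rank_complex_boundary_set by (rule rank_complex_coset)
  finally show ?thesis using k(2) by (simp add: top_map_def)
next
  case False
  then have "top_map (nat p) z = 0"
    using assms by (auto simp: top_map_def int_top_cycles_def top_cycles_def top_face_map_def split: if_split_asm)
  moreover have "top_boundary W \<gamma> (length as) p {z} = {0}"
    by (simp only: top_boundary_def if_not_P [OF False] top_group_structure(3))
  ultimately show ?thesis by simp
qed

lemma zero_int_top_cycles [simp]: "0 \<in> int_top_cycles p"
  by (simp add: int_top_cycles_def)

lemma diff_int_top_cycles: "a \<in> int_top_cycles p \<Longrightarrow> b \<in> int_top_cycles p \<Longrightarrow> a - b \<in> int_top_cycles p"
  using diff_top_cycles by (auto simp: int_top_cycles_def)

lemma add_int_top_cycles: "a \<in> int_top_cycles p \<Longrightarrow> b \<in> int_top_cycles p \<Longrightarrow> a + b \<in> int_top_cycles p"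
  using diff_int_top_cycles [of a p "0 - b"] diff_int_top_cycles [of 0 p b] by simp

lemma int_top_cycles_map:
  assumes "z \<in> int_top_cycles p"
  shows "top_map (nat p) z \<in> int_top_cycles (p - 1)"
proof (cases "1 \<le> p")
  case True
  then have "nat p = Suc (nat (p - 1))" by simp
  then show ?thesis
    using assms True top_map_in_top_cycles [of z "nat (p - 1)"] by (simp add: int_top_cycles_def)
qed (simp add: top_map_def)

lemma int_top_cycles_map_map:
  assumes "z \<in> int_top_cycles p"
  shows "top_map (nat (p - 1)) (top_map (nat p) z) = 0"
proof (cases "1 \<le> p")
  case True
  then have "nat p = Suc (nat (p - 1))" by simp
  then show ?thesis
    using assms True top_map_top_map [of z "nat (p - 1)"] by (simp add: int_top_cycles_def)
qed (simp add: top_map_def)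

lemma chain_complex_top: "chain_complex top_groups (top_boundary W \<gamma> (length as))"
  unfolding chain_complex_def
proof (intro allI conjI ballI)
  fix p :: int
  note st = top_group_structure [where p = p]
  show "comm_group (top_groups p)"
  proof (rule comm_groupI)
    fix x assume "x \<in> carrier (top_groups p)"
    then obtain a where a: "x = {a}" "a \<in> int_top_cycles p" using st(1) by auto
    then have "- a \<in> int_top_cycles p" using diff_int_top_cycles [of 0 p a] by simp
    then show "\<exists>y\<in>carrier (top_groups p). y \<otimes>\<^bsub>top_groups p\<^esub> x = \<one>\<^bsub>top_groups p\<^esub>"
      using a st by (intro bexI [of _ "{- a}"]) auto
  qed (auto simp: st add_int_top_cycles add.commute add.assoc)
  show "top_boundary W \<gamma> (length as) p \<in> hom (top_groups p) (top_groups (p - 1))"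
    by (rule homI)
      (auto simp: st top_group_structure [where p = "p - 1"] top_boundary_eq int_top_cycles_map
        add_int_top_cycles top_map_add)
  fix x assume "x \<in> carrier (top_groups p)"
  then obtain a where a: "x = {a}" "a \<in> int_top_cycles p" using st(1) by auto
  then show "top_boundary W \<gamma> (length as) (p - 1) (top_boundary W \<gamma> (length as) p x)
      = \<one>\<^bsub>top_groups (p - 2)\<^esub>"
    using top_group_structure(3)
    by (simp add: top_boundary_eq int_top_cycles_map int_top_cycles_map_map)
qed

lemma FP_homology_iso_top_homology:
  "FP_homology W \<gamma> (length as) p
     \<cong> complex_homology top_groups (top_boundary W \<gamma> (length as)) p"
  unfolding FP_homology_def
proof (rule quasi_isomorphism_homology [OF chain_complex_FP chain_complex_top])
  let ?C = "FP_chain_group W \<gamma> (length as)" and ?B = "boundary_set (FP_chain_group W \<gamma> (length as)) (FP_boundary W)"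
  \<comment> \<open>Classes are singletons, so \<open>the_elem\<close> recovers the cycle to be
    embedded.\<close>
  define f where "f q X = top_embed (nat q) (the_elem X)" for q :: int and X
  have f [simp]: "f q {z} = top_embed (nat q) z" for q z by (simp add: f_def)
  have f_carrier: "top_embed (nat q) z \<in> carrier (?C q)" if "z \<in> int_top_cycles q" for q z
  proof (cases "0 \<le> q")
    case True
    then show ?thesis
      using that supp_top_embed [of z "nat q"] carrier_FP_chain_group [of "nat q"]
      by (simp add: int_top_cycles_def)
  qed (use that in \<open>simp add: int_top_cycles_def FP_chain_group_def\<close>)
  have f_boundary: "FP_boundary W q (top_embed (nat q) z) = top_embed (nat q - 1) (top_map (nat q) z)"
    if "z \<in> int_top_cycles q" for q z
  proof (cases "0 \<le> q")
    case True
    then have z: "z \<in> top_cycles (nat q)" using that by (simp add: int_top_cycles_def)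
    show ?thesis
      using FP_boundary_eq [OF supp_top_embed [OF z]] cell_boundary_top_embed [OF z] True by simp
  qed (use that in \<open>simp add: int_top_cycles_def FP_boundary_nonpos\<close>)
  show "f p \<in> hom (top_groups p) (?C p)"
    by (rule homI) (auto simp: top_group_structure f_carrier [simplified])
  show "FP_boundary W p (f p t) = \<one>\<^bsub>?C (p - 1)\<^esub>"
    if t: "t \<in> carrier (top_groups p)" "top_boundary W \<gamma> (length as) p t = \<one>\<^bsub>top_groups (p - 1)\<^esub>" for t
  proof -
    obtain a where a: "t = {a}" "a \<in> int_top_cycles p"
      using t(1) unfolding top_group_structure(1) by blast
    then have "top_map (nat p) a = 0"
      using t(2) by (simp only: top_boundary_eq top_group_structure(3) singleton_inject)
    then show ?thesis unfolding a(1) f f_boundary [OF a(2)] by simp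
  qed
  show "f p (top_boundary W \<gamma> (length as) (p + 1) s) \<in> ?B p"
    if s: "s \<in> carrier (top_groups (p + 1))" for s
  proof -
    obtain a where a: "s = {a}" "a \<in> int_top_cycles (p + 1)" 
      using s unfolding top_group_structure(1) by blast
    have "f p (top_boundary W \<gamma> (length as) (p + 1) s) = FP_boundary W (p + 1) (top_embed (nat (p + 1)) a)"
    proof (cases "0 \<le> p")
      case True
      then have "nat (p + 1) - 1 = nat p" by simp
      then show ?thesis
        unfolding a(1) top_boundary_eq [OF a(2)] f f_boundary [OF a(2)] by (simp only:)
    next
      case False
      then have "nat (p + 1) = 0" by simp
      then show ?thesis
        unfolding a(1) top_boundary_eq [OF a(2)] f f_boundary [OF a(2)] by (simp add: top_map_def)
    qed
    then show ?thesis using f_carrier [OF a(2)] by (auto simp: boundary_set_def)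
  qed
  show "\<exists>t\<in>carrier (top_groups p). top_boundary W \<gamma> (length as) p t = \<one>\<^bsub>top_groups (p - 1)\<^esub> \<and>
      (\<exists>y\<in>?B p. z = y \<otimes>\<^bsub>?C p\<^esub> f p t)"
    if z: "z \<in> carrier (?C p)" "FP_boundary W p z = \<one>\<^bsub>?C (p - 1)\<^esub>" for z
  proof (cases "0 \<le> p")
    case True
    define k where "k = nat p"
    have p: "p = int k" "p + 1 = int (Suc k)" using True by (simp_all add: k_def)
    have zk: "supp z \<subseteq> cells k" using z(1) by (simp add: p carrier_FP_chain_group)
    have bz: "cell_boundary k z = 0" using z(2) FP_boundary_eq [OF zk] by (simp add: p)
    \<comment> \<open>Surjectivity is the deformation with prescribed boundary zero.\<close>
    then have "cell_boundary k z = top_embed (k - 1) 0" by simp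
    then obtain a y where a: "a \<in> top_cycles k" and y: "supp y \<subseteq> cells (Suc k)"
      and zay: "z = top_embed k a + cell_boundary (Suc k) y"
      using deform_to_top_cycle [OF zk] by blast
    \<comment> \<open>\<open>a\<close> inherits being a cycle from \<open>z\<close>, through the
      injective embedding.\<close>
    have "top_embed (k - 1) (top_map k a) = cell_boundary k (z - cell_boundary (Suc k) y)"
      using zay cell_boundary_top_embed [OF a] by simp
    also have "\<dots> = top_embed (k - 1) 0"
      using bz cell_boundary_boundary [OF y] by (simp add: cell_boundary_diff)
    finally have "top_map k a = 0" by (rule top_embed_inj)
    moreover have ai: "a \<in> int_top_cycles p" using a by (simp add: int_top_cycles_def p)
    ultimately have "top_boundary W \<gamma> (length as) p {a} = \<one>\<^bsub>top_groups (p - 1)\<^esub>"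
      by (simp add: top_boundary_eq top_group_structure p)
    moreover have "cell_boundary (Suc k) y \<in> ?B p"
      unfolding boundary_set_def p(2) carrier_FP_chain_group
      using y FP_boundary_eq [OF y] by (intro image_eqI [of _ _ y]) simp_all
    moreover have "z = cell_boundary (Suc k) y \<otimes>\<^bsub>?C p\<^esub> f p {a}"
      using zay by (simp add: p add.commute)
    ultimately show ?thesis using ai by (intro bexI [of _ "{a}"]) (auto simp: top_group_structure)
  next
    case False
    then have "z = 0" using z(1) carrier_FP_chain_group_negative [of p] by simp
    moreover have "0 \<in> ?B p"
      by (auto simp: boundary_set_def FP_boundary_def FP_chain_group_def intro!: image_eqI [of _ _ 0])
    ultimately show ?thesis
      by (intro bexI [of _ "{0}"] conjI bexI [of _ 0]) (simp_all add: top_boundary_eq top_group_structure)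
  qed
  show "t \<in> boundary_set top_groups (top_boundary W \<gamma> (length as)) p"
    if t: "t \<in> carrier (top_groups p)" "f p t \<in> ?B p" for t
  proof -
    obtain a where a: "t = {a}" "a \<in> int_top_cycles p" 
      using t(1) unfolding top_group_structure(1) by blast
    have "\<exists>s\<in>int_top_cycles (p + 1). a = top_map (nat (p + 1)) s"
    proof (cases "0 \<le> p")
      case True
      define k where "k = nat p"
      have p: "p = int k" "p + 1 = int (Suc k)" "nat (p + 1) = Suc k" using True by (simp_all add: k_def)
      obtain y where y: "y \<in> carrier (?C (p + 1))" "f p t = FP_boundary W (p + 1) y"
        using t(2) by (auto simp: boundary_set_def)
      then have yk: "supp y \<subseteq> cells (Suc k)" unfolding p(2) carrier_FP_chain_group by simp
      have by_eq: "cell_boundary (Suc k) y = top_embed k a"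
        using y(2) FP_boundary_eq [OF yk] unfolding p(2) by (simp add: a(1) p(1))
      \<comment> \<open>Injectivity: the bounding chain itself is deformed, with \<open>a\<close> as
        its prescribed boundary, and its top part \<open>s\<close> still bounds
        \<open>a\<close>.\<close>
      then have "cell_boundary (Suc k) y = top_embed (Suc k - 1) a" by simp
      then obtain s v where s: "s \<in> top_cycles (Suc k)" and v: "supp v \<subseteq> cells (Suc (Suc k))"
        and y_eq: "y = top_embed (Suc k) s + cell_boundary (Suc (Suc k)) v"
        using deform_to_top_cycle [OF yk] by blast
      have "top_embed k a = cell_boundary (Suc k) (top_embed (Suc k) s)"
        using by_eq cell_boundary_boundary [OF v] unfolding y_eq by (simp add: cell_boundary_add)
      also have "\<dots> = top_embed k (top_map (Suc k) s)" using cell_boundary_top_embed [OF s] by simp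
      finally have "a = top_map (Suc k) s" by (rule top_embed_inj)
      moreover have "s \<in> int_top_cycles (p + 1)" using s by (simp add: int_top_cycles_def p(3)) (simp add: p(1))
      ultimately show ?thesis using p(3) by auto
    next
      case False
      then have "a = 0" using a(2) by (simp add: int_top_cycles_def)
      then show ?thesis by (intro bexI [of _ 0]) simp_all
    qed
    then obtain s where s: "s \<in> int_top_cycles (p + 1)" "a = top_map (nat (p + 1)) s" by blast
    then have "t = top_boundary W \<gamma> (length as) (p + 1) {s}" using a(1) by (simp add: top_boundary_eq)
    then show ?thesis using s(1) by (auto simp: boundary_set_def top_group_structure)
  qed
qed

end

section \<open>From a Coxeter word to the given Coxeter element\<close>

theorem theorem6p4:
  fixes W :: "('a::euclidean_space \<Rightarrow> 'a) set"
    and \<gamma> :: "'a \<Rightarrow> 'a"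
    and n :: nat
  assumes "finite_reflection_group W"
    and "irreducible_reflection_group W"
    and "reflection_rank W = n"
    and "coxeter_element W \<gamma>"
  shows "chain_complex (top_group W \<gamma> n) (top_boundary W \<gamma> n) \<and>
    (\<forall>p. FP_homology W \<gamma> n p \<cong>
          complex_homology (top_group W \<gamma> n) (top_boundary W \<gamma> n) p)"
proof -
  obtain as where as: "distinct as" "simple_system W (set as)" "\<gamma> = compose_list (map reflection as)"
    using assms(4) unfolding coxeter_element_def by blast
  have ind: "independent (set as)" and span: "span (set as) = span (unit_roots W)"
    using as(2) by (simp_all add: simple_system_def)
  obtain \<rho> where \<rho>: "\<And>a. a \<in> set as \<Longrightarrow> \<rho> \<bullet> a = 1"
    by (rule independent_inner_interpolation [OF ind, of "\<lambda>_. 1"]) blast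
  \<comment> \<open>Irreducibility includes a nonzero root span, which the empty word cannot
    produce.\<close>
  have "as \<noteq> []"
    using assms(2) span by (auto simp: irreducible_reflection_group_def)
  then interpret cw: coxeter_word W as \<rho>
    using assms(1) as \<rho> by unfold_locales
  have \<gamma>: "cw.\<gamma> = \<gamma>" using as(3) by (simp add: cw.\<gamma>_def)
  have "n = dim (span (set as))" using assms(3) span by (simp add: reflection_rank_def)
  also have "\<dots> = length as"
    using ind as(1) by (simp add: dim_eq_card_independent distinct_card)
  finally have n: "n = length as" .
  show ?thesis
    using cw.chain_complex_top cw.FP_homology_iso_top_homology unfolding \<gamma> n by blast
qed

end
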